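(* Let $(M,\omega,H)$ be an arbitrary Hamiltonian system with a well-defined (finite) partition function, and let $A\in L^1_\beta(M)\cap L^2_\beta(M)$. Let $$\widetilde A(m)=\lim_{T\to\infty}\frac1T\int_0^T A(\gamma_m(t))\,dt$$ be the orbital average of $A$. Then $$\mathcal C(A)=\|\widetilde A\|_\beta^2 .$$
   Context: $(M,\omega,H)$ is a Hamiltonian system: $(M,\omega)$ is a symplectic manifold of finite dimension $2r$, $H:M\to\mathbb R$ is the Hamiltonian, and $\gamma_m:\mathbb R\to M$ is the solution of Hamilton's equations with $\gamma_m(0)=m$. The measure $dm$ on $M$ is given by $\omega^r$ (locally $dq_1\cdots dq_r\,dp_1\cdots dp_r$). The partition function is $\mathcal Z(\beta)=\int_M e^{-\beta H(m)}\,dm$, with $\beta>0$ fixed. $L^p_\beta(M)$ is the space of measurable $f:M\to\mathbb R$ with $\int_M|f|^p e^{-\beta H}\,dm<\infty$, and $$\langle F,G\rangle_\beta=\frac1{\mathcal Z(\beta)}\int_M F(m)G(m)e^{-\beta H(m)}\,dm,\qquad \|F\|_\beta^2=\langle F,F\rangle_\beta .$$ For an observable $A:M\to\mathbb R$ put $A^t(m)=A(\gamma_m(t))$ and $\mathcal C(A)=\lim_{T\to\infty}\frac1T\int_0^T\langle A^0,A^t\rangle_\beta\,dt$. The orbital average $\widetilde A$ is defined for almost every $m$. *)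

theory Defs
  imports "HOL-Analysis.Analysis" "HOL-Combinatorics.Permutations"
begin

section \<open>Smooth functions on open subsets of Euclidean space\<close>

text \<open>Meant for open \<^term>\<open>S\<close>: \<open>k\<close>-times continuously differentiable, by way of iterated
  directional derivatives.\<close>

primrec Ck_on :: "nat \<Rightarrow> 'a::euclidean_space set \<Rightarrow> ('a \<Rightarrow> 'b::real_normed_vector) \<Rightarrow> bool"
  where
    "Ck_on 0 S f \<longleftrightarrow> continuous_on S f"
  | "Ck_on (Suc k) S f \<longleftrightarrow>
       (\<forall>x\<in>S. f differentiable (at x)) \<and>
       (\<forall>v. Ck_on k S (\<lambda>x. frechet_derivative f (at x) v))"

definition smooth_on :: "'a::euclidean_space set \<Rightarrow> ('a \<Rightarrow> 'b::real_normed_vector) \<Rightarrow> bool"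
  where "smooth_on S f \<longleftrightarrow> (\<forall>k. Ck_on k S f)"


section \<open>Symplectic manifolds\<close>

text \<open>
  The manifold is a whole type \<open>'m\<close> of class \<open>t2_space\<close> and \<open>second_countable_topology\<close>. Its
  dimension is \<open>2 * r\<close> with \<open>r = CARD('r)\<close>: the coordinates are indexed by \<open>'r + 'r\<close>, so in a
  canonical chart \<open>Inl i\<close> labels \<open>q\<^sub>i\<close> and \<open>Inr i\<close> labels \<open>p\<^sub>i\<close>. A chart is a pair of its domain
  and its coordinate map, whose values outside the domain are irrelevant.
\<close>

type_synonym ('m, 'r) chart = "'m set \<times> ('m \<Rightarrow> real ^ ('r + 'r))"

abbreviation chart_dom :: "('m, 'r) chart \<Rightarrow> 'm set"
  where "chart_dom c \<equiv> fst c"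

abbreviation coord :: "('m, 'r) chart \<Rightarrow> 'm \<Rightarrow> real ^ ('r + 'r)"
  where "coord c \<equiv> snd c"

definition chart_image :: "('m, 'r) chart \<Rightarrow> (real ^ ('r + 'r)) set"
  where "chart_image c = coord c ` chart_dom c"

definition chart_inv :: "('m, 'r) chart \<Rightarrow> real ^ ('r + 'r) \<Rightarrow> 'm"
  where "chart_inv c = inv_into (chart_dom c) (coord c)"

definition transition :: "('m, 'r) chart \<Rightarrow> ('m, 'r) chart \<Rightarrow> real ^ ('r + 'r) \<Rightarrow> real ^ ('r + 'r)"
  where "transition c c' = coord c' \<circ> chart_inv c"

locale smooth_manifold =
  fixes atlas :: "('m::{t2_space, second_countable_topology}, 'r::finite) chart set"
  assumes dom_open: "c \<in> atlas \<Longrightarrow> open (chart_dom c)"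
    and image_open: "c \<in> atlas \<Longrightarrow> open (chart_image c)"
    and chart_homeomorphism:
      "c \<in> atlas \<Longrightarrow> homeomorphism (chart_dom c) (chart_image c) (coord c) (chart_inv c)"
    and covering: "(\<Union>c\<in>atlas. chart_dom c) = UNIV"
    and smooth_transition:
      "c \<in> atlas \<Longrightarrow> c' \<in> atlas \<Longrightarrow>
         smooth_on (coord c ` (chart_dom c \<inter> chart_dom c')) (transition c c')"

text \<open>
  A 2-form is given by its component matrices: \<open>\<omega> c m $ i $ j\<close> is the value of the form at
  \<open>m \<in> chart_dom c\<close> on the \<open>i\<close>-th and the \<open>j\<close>-th coordinate vector of the chart \<open>c\<close>. Hence
  \<open>u \<bullet> (\<omega> c m *v v)\<close> is its value on the tangent vectors with coordinates \<open>u\<close> and \<open>v\<close>, and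
  \<open>form_covariant\<close> is the transformation rule that makes the form independent of the chart.
\<close>

locale symplectic_manifold = smooth_manifold atlas
  for atlas :: "('m::{t2_space, second_countable_topology}, 'r::finite) chart set" +
  fixes \<omega> :: "('m, 'r) chart \<Rightarrow> 'm \<Rightarrow> real ^ ('r + 'r) ^ ('r + 'r)"
  assumes form_smooth: "c \<in> atlas \<Longrightarrow> smooth_on (chart_image c) (\<lambda>x. \<omega> c (chart_inv c x))"
    and form_covariant:
      "c \<in> atlas \<Longrightarrow> c' \<in> atlas \<Longrightarrow> m \<in> chart_dom c \<inter> chart_dom c' \<Longrightarrow>
         u \<bullet> (\<omega> c m *v v) =
           frechet_derivative (transition c c') (at (coord c m)) u \<bullet>
           (\<omega> c' m *v frechet_derivative (transition c c') (at (coord c m)) v)"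
    and form_alternating:
      "c \<in> atlas \<Longrightarrow> m \<in> chart_dom c \<Longrightarrow> u \<bullet> (\<omega> c m *v u) = 0"
    and form_nondegenerate:
      "c \<in> atlas \<Longrightarrow> m \<in> chart_dom c \<Longrightarrow> (\<forall>v. u \<bullet> (\<omega> c m *v v) = 0) \<Longrightarrow> u = 0"
    and form_closed:
      "c \<in> atlas \<Longrightarrow> x \<in> chart_image c \<Longrightarrow>
         frechet_derivative (\<lambda>y. \<omega> c (chart_inv c y) $ j $ k) (at x) (axis i 1) +
         frechet_derivative (\<lambda>y. \<omega> c (chart_inv c y) $ k $ i) (at x) (axis j 1) +
         frechet_derivative (\<lambda>y. \<omega> c (chart_inv c y) $ i $ j) (at x) (axis k 1) = 0"


section \<open>The measure given by the top power of the symplectic form\<close>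

text \<open>
  For the 2-form with component matrix \<open>A\<close>, the value of its \<open>r\<close>-th wedge power on the coordinate
  vectors, ordered as \<open>q\<^sub>1, p\<^sub>1, \<dots>, q\<^sub>r, p\<^sub>r\<close>, is
  \<open>1 / 2 ^ r * (\<Sum>p. sign p * (\<Prod>i. A (p q\<^sub>i) (p p\<^sub>i)))\<close>. The additional factor \<open>1 / r!\<close> makes this
  \<open>1\<close> for the form \<open>\<Sum>i. dq\<^sub>i \<and> dp\<^sub>i\<close>, so that the resulting measure is Lebesgue measure
  \<open>dq\<^sub>1 \<dots> dq\<^sub>r dp\<^sub>1 \<dots> dp\<^sub>r\<close> in canonical coordinates.
\<close>

definition top_power :: "real ^ ('r::finite + 'r) ^ ('r + 'r) \<Rightarrow> real"
  where "top_power A =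
    (\<Sum>p | p permutes (UNIV :: ('r + 'r) set).
        of_int (sign p) * (\<Prod>i\<in>(UNIV :: 'r set). A $ p (Inl i) $ p (Inr i)))
    / (2 ^ CARD('r) * fact CARD('r))"

text \<open>The measure is taken on the completion of the Borel sets. The Borel measure \<open>\<nu>\<close> is uniquely
  determined, because countably many chart domains cover the manifold.\<close>

definition is_symplectic_measure ::
    "('m::{t2_space, second_countable_topology}, 'r::finite) chart set \<Rightarrow>
     (('m, 'r) chart \<Rightarrow> 'm \<Rightarrow> real ^ ('r + 'r) ^ ('r + 'r)) \<Rightarrow> 'm measure \<Rightarrow> bool"
  where "is_symplectic_measure atlas \<omega> dm \<longleftrightarrow>
    (\<exists>\<nu>. sets \<nu> = sets borel \<and> dm = completion \<nu> \<and>
      (\<forall>c\<in>atlas. \<forall>B\<in>sets borel. B \<subseteq> chart_dom c \<longrightarrow>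
        emeasure \<nu> B =
          (\<integral>\<^sup>+x\<in>coord c ` B. ennreal \<bar>top_power (\<omega> c (chart_inv c x))\<bar> \<partial>lborel)))"


section \<open>Hamiltonian systems\<close>

text \<open>The velocity \<open>X\<close> at time \<open>t\<close>, in coordinates, satisfies \<open>\<omega>(X, v) = dH(v)\<close> for all \<open>v\<close>. In
  canonical coordinates this reads \<open>q\<^sub>i' = \<partial>H/\<partial>p\<^sub>i\<close>, \<open>p\<^sub>i' = - \<partial>H/\<partial>q\<^sub>i\<close>.\<close>

definition solves_hamilton_equations ::
    "('m::{t2_space, second_countable_topology}, 'r::finite) chart set \<Rightarrow>
     (('m, 'r) chart \<Rightarrow> 'm \<Rightarrow> real ^ ('r + 'r) ^ ('r + 'r)) \<Rightarrow> ('m \<Rightarrow> real) \<Rightarrow> (real \<Rightarrow> 'm) \<Rightarrow> bool"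
  where "solves_hamilton_equations atlas \<omega> H x \<longleftrightarrow>
    continuous_on UNIV x \<and>
    (\<forall>t. \<forall>c\<in>atlas. x t \<in> chart_dom c \<longrightarrow>
      (\<exists>X. ((\<lambda>s. coord c (x s)) has_vector_derivative X) (at t) \<and>
           (\<forall>v. X \<bullet> (\<omega> c (x t) *v v) =
                frechet_derivative (H \<circ> chart_inv c) (at (coord c (x t))) v)))"

locale hamiltonian_system = symplectic_manifold atlas \<omega>
  for atlas :: "('m::{t2_space, second_countable_topology}, 'r::finite) chart set"
    and \<omega> :: "('m, 'r) chart \<Rightarrow> 'm \<Rightarrow> real ^ ('r + 'r) ^ ('r + 'r)" +
  fixes H :: "'m \<Rightarrow> real"
    and \<gamma> :: "'m \<Rightarrow> real \<Rightarrow> 'm"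
  assumes hamiltonian_smooth: "c \<in> atlas \<Longrightarrow> smooth_on (chart_image c) (H \<circ> chart_inv c)"
    and flow_solution: "solves_hamilton_equations atlas \<omega> H (\<gamma> m)"
    and flow_initial: "\<gamma> m 0 = m"


section \<open>Canonical averages, autocorrelation and orbital averages\<close>

definition partition_finite :: "'m measure \<Rightarrow> ('m \<Rightarrow> real) \<Rightarrow> real \<Rightarrow> bool"
  where "partition_finite dm H \<beta> \<longleftrightarrow> integrable dm (\<lambda>m. exp (- \<beta> * H m))"

definition partition_function :: "'m measure \<Rightarrow> ('m \<Rightarrow> real) \<Rightarrow> real \<Rightarrow> real"
  where "partition_function dm H \<beta> = (LINT m|dm. exp (- \<beta> * H m))"

definition Lp_beta :: "'m measure \<Rightarrow> ('m \<Rightarrow> real) \<Rightarrow> real \<Rightarrow> real \<Rightarrow> ('m \<Rightarrow> real) set"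
  where "Lp_beta dm H \<beta> p =
    {f \<in> borel_measurable dm. integrable dm (\<lambda>m. \<bar>f m\<bar> powr p * exp (- \<beta> * H m))}"

definition inner_beta ::
    "'m measure \<Rightarrow> ('m \<Rightarrow> real) \<Rightarrow> real \<Rightarrow> ('m \<Rightarrow> real) \<Rightarrow> ('m \<Rightarrow> real) \<Rightarrow> real"
  where "inner_beta dm H \<beta> F G =
    1 / partition_function dm H \<beta> * (LINT m|dm. F m * G m * exp (- \<beta> * H m))"

definition norm_beta :: "'m measure \<Rightarrow> ('m \<Rightarrow> real) \<Rightarrow> real \<Rightarrow> ('m \<Rightarrow> real) \<Rightarrow> real"
  where "norm_beta dm H \<beta> F = sqrt (inner_beta dm H \<beta> F F)"

definition has_time_average :: "(real \<Rightarrow> real) \<Rightarrow> real \<Rightarrow> bool"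
  where "has_time_average f l \<longleftrightarrow>
    (\<forall>T>0. set_integrable lebesgue {0..T} f) \<and>
    ((\<lambda>T. 1 / T * (LINT t:{0..T}|lebesgue. f t)) \<longlongrightarrow> l) at_top"

definition time_average :: "(real \<Rightarrow> real) \<Rightarrow> real"
  where "time_average f = (THE l. has_time_average f l)"

definition orbital_average :: "('m \<Rightarrow> real \<Rightarrow> 'm) \<Rightarrow> ('m \<Rightarrow> real) \<Rightarrow> 'm \<Rightarrow> real"
  where "orbital_average \<gamma> A m = time_average (\<lambda>t. A (\<gamma> m t))"

definition evolved :: "('m \<Rightarrow> real \<Rightarrow> 'm) \<Rightarrow> ('m \<Rightarrow> real) \<Rightarrow> real \<Rightarrow> 'm \<Rightarrow> real"
  where "evolved \<gamma> A t m = A (\<gamma> m t)"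

definition correlation_at ::
    "'m measure \<Rightarrow> ('m \<Rightarrow> real) \<Rightarrow> real \<Rightarrow> ('m \<Rightarrow> real \<Rightarrow> 'm) \<Rightarrow> ('m \<Rightarrow> real) \<Rightarrow> real \<Rightarrow> real"
  where "correlation_at dm H \<beta> \<gamma> A t = inner_beta dm H \<beta> (evolved \<gamma> A 0) (evolved \<gamma> A t)"

definition autocorrelation ::
    "'m measure \<Rightarrow> ('m \<Rightarrow> real) \<Rightarrow> real \<Rightarrow> ('m \<Rightarrow> real \<Rightarrow> 'm) \<Rightarrow> ('m \<Rightarrow> real) \<Rightarrow> real"
  where "autocorrelation dm H \<beta> \<gamma> A = time_average (correlation_at dm H \<beta> \<gamma> A)"

end

theory Submission
  imports Defs
begin

text \<open>
  Liouville's theorem and conservation of \<open>H\<close> make the flow preserve the finite measure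
  \<open>e\<^sup>-\<^sup>\<beta>\<^sup>H dm\<close>. Birkhoff's theorem then gives the orbital average \<open>L\<close> almost everywhere. The averages
  \<open>A\<^sub>T\<close> over \<open>[0, T]\<close> are bounded in \<open>L\<^sup>2\<close>, so they converge to \<open>L\<close> weakly in \<open>L\<^sup>2\<close>. By Fubini, the
  averaged correlation is \<open>\<langle>A, A\<^sub>T\<rangle>\<close>, which tends to \<open>\<langle>A, L\<rangle>\<close>; as \<open>L\<close> is invariant,
  \<open>\<langle>A, L\<rangle> = \<langle>A\<^sub>T, L\<rangle>\<close>, which tends to \<open>\<langle>L, L\<rangle>\<close>.

  Liouville's theorem is proved in arbitrary charts, without Darboux coordinates and without
  differentiating the flow in the initial point. In a chart with form \<open>W\<close> and Hamiltonian field \<open>X\<close>,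
  the Euler step \<open>\<psi>\<^sub>h(x) = x + h X(x)\<close> satisfies \<open>\<psi>\<^sub>h\<^sup>*W = W + o(h)\<close>, since the Lie derivative of a closed
  form along a Hamiltonian field vanishes. The top power turns this into a statement about Jacobian
  determinants, and integrals of Lipschitz functions along the flow have derivative \<open>0\<close> in time.
\<close>

section \<open>The maximal and the pointwise ergodic theorem\<close>

text \<open>The observable is measurable only for the completion of the Borel measure, while
  composing with the flow and applying Fubini call for Borel functions. So the ergodic part works
  with a Borel representative of \<open>A\<close> and transfers back through null sets: almost every
  orbit meets such a set only for a null set of times, which a Lebesgue integral in time does not
  see. For real times, Birkhoff's theorem is applied to the time-one map and the integrals over a
  unit window, both of \<open>f\<close> and of its absolute value; the latter controls the
  fractional part of \<open>T\<close>. The flow is given merely as a family of solution curves. Its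
  group law comes from uniqueness of solutions and its continuity from Gronwall's inequality.
  Invariance of the measure is proved for short times near a point of a chart; connectedness of the
  time axis extends it to all times, a countable cover to the whole manifold. Test functions are
  Lipschitz because a flow step and an Euler step differ by O(h^2), and a Lipschitz integrand
  preserves this order.\<close>

locale measure_preserving = finite_measure M for M :: "'a measure" +
  fixes T :: "'a \<Rightarrow> 'a"
  assumes T_measurable [measurable]: "T \<in> measurable M M"
    and T_distr: "distr M M T = M"
    and space_UNIV [simp]: "space M = UNIV"
begin

lemma T_integral: "(\<integral>x. f (T x) \<partial>M) = (\<integral>x. f x \<partial>M)"
  if [measurable]: "f \<in> borel_measurable M" for f :: "'a \<Rightarrow> real"
  using integral_distr[of T M M f] by (simp add: T_distr)

lemma T_integrable: "integrable M (\<lambda>x. f (T x))" if "integrable M f" for f :: "'a \<Rightarrow> real"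
  using integrable_distr[of T M M f] that by (simp add: T_distr)

definition birkhoff_sum :: "('a \<Rightarrow> real) \<Rightarrow> nat \<Rightarrow> 'a \<Rightarrow> real"
  where "birkhoff_sum f n x = (\<Sum>k<n. f ((T ^^ k) x))"

lemma birkhoff_sum_0 [simp]: "birkhoff_sum f 0 x = 0" by (simp add: birkhoff_sum_def)

lemma birkhoff_sum_Suc: "birkhoff_sum f (Suc n) x = f x + birkhoff_sum f n (T x)"
  unfolding birkhoff_sum_def sum.lessThan_Suc_shift by (simp add: funpow_swap1)

lemma birkhoff_sum_uminus: "birkhoff_sum (\<lambda>x. - f x) n x = - birkhoff_sum f n x"
  by (simp add: birkhoff_sum_def sum_negf)

lemma T_power_measurable [measurable]: "T ^^ k \<in> measurable M M"
  by (induction k) (auto simp: id_def)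

lemma birkhoff_sum_measurable [measurable]:
  "f \<in> borel_measurable M \<Longrightarrow> birkhoff_sum f n \<in> borel_measurable M"
  unfolding birkhoff_sum_def[abs_def]
  by (intro borel_measurable_sum measurable_compose[OF T_power_measurable])

text \<open>This is the maximum of \<open>birkhoff_sum f k x\<close> over k up to n, where k = 0
  contributes 0. The recursion makes the identity behind Garsia's argument hold by
  definition.\<close>

primrec birkhoff_max :: "('a \<Rightarrow> real) \<Rightarrow> nat \<Rightarrow> 'a \<Rightarrow> real"
  where
    "birkhoff_max f 0 x = 0"
  | "birkhoff_max f (Suc n) x = max 0 (f x + birkhoff_max f n (T x))"

lemma birkhoff_max_nonneg: "0 \<le> birkhoff_max f n x" by (cases n) auto

lemma birkhoff_max_mono: "birkhoff_max f n x \<le> birkhoff_max f (Suc n) x"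
proof (induction n arbitrary: x)
  case (Suc n)
  have "f x + birkhoff_max f n (T x) \<le> f x + birkhoff_max f (Suc n) (T x)"
    using Suc by simp
  then show ?case by (simp only: birkhoff_max.simps(2))
qed auto

lemma birkhoff_max_ge: "birkhoff_sum f n x \<le> birkhoff_max f n x"
proof (induction n arbitrary: x)
  case (Suc n)
  then show ?case by (simp add: birkhoff_sum_Suc add_left_mono le_max_iff_disj)
qed simp

lemma birkhoff_max_pos:
  "birkhoff_max f n x > 0 \<Longrightarrow> \<exists>k. birkhoff_sum f k x = birkhoff_max f n x"
proof (induction n arbitrary: x)
  case (Suc n)
  then have eq: "birkhoff_max f (Suc n) x = f x + birkhoff_max f n (T x)" by auto
  show ?case
  proof (cases "birkhoff_max f n (T x) > 0")
    case True
    then obtain k where "birkhoff_sum f k (T x) = birkhoff_max f n (T x)" using Suc by blast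
    then show ?thesis using eq by (intro exI[of _ "Suc k"]) (simp add: birkhoff_sum_Suc)
  next
    case False
    then have "birkhoff_max f n (T x) = 0" using birkhoff_max_nonneg[of f n "T x"] by linarith
    then show ?thesis using eq by (intro exI[of _ "Suc 0"]) (simp add: birkhoff_sum_Suc)
  qed
qed auto

lemma birkhoff_max_integrable: "integrable M f \<Longrightarrow> integrable M (birkhoff_max f n)"
proof (induction n)
  case (Suc n)
  then have "integrable M (\<lambda>x. max 0 (f x + birkhoff_max f n (T x)))"
    using T_integrable by (intro integrable_max) auto
  then show ?case by (simp add: fun_eq_iff[symmetric] cong: Bochner_Integration.integrable_cong)
qed (simp add: fun_eq_iff[symmetric] cong: Bochner_Integration.integrable_cong)

text \<open>Garsia's argument: where the maximum is positive, it equals \<open>f\<close> plus the preceding maximum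
  after one step.\<close>

lemma maximal_ergodic_finite:
  assumes f: "integrable M f"
  shows "0 \<le> (\<integral>x. f x * indicator {x. birkhoff_max f n x > 0} x \<partial>M)"
proof (cases n)
  case (Suc k)
  note [measurable] = borel_measurable_integrable[OF f]
  note int = birkhoff_max_integrable[OF f]
  note [measurable] = borel_measurable_integrable[OF int]
  have "0 = (\<integral>x. birkhoff_max f k x \<partial>M) - (\<integral>x. birkhoff_max f k (T x) \<partial>M)" by (simp add: T_integral)
  also have "\<dots> \<le> (\<integral>x. birkhoff_max f n x \<partial>M) - (\<integral>x. birkhoff_max f k (T x) \<partial>M)"
    unfolding Suc by (intro diff_right_mono integral_mono int birkhoff_max_mono)
  also have "\<dots> = (\<integral>x. birkhoff_max f n x - birkhoff_max f k (T x) \<partial>M)"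
    by (intro Bochner_Integration.integral_diff[symmetric] int T_integrable)
  also have "\<dots> \<le> (\<integral>x. f x * indicator {x. birkhoff_max f n x > 0} x \<partial>M)"
  proof (intro integral_mono Bochner_Integration.integrable_diff int T_integrable)
    show "integrable M (\<lambda>x. f x * indicator {x. birkhoff_max f n x > 0} x)"
      by (rule Bochner_Integration.integrable_bound[OF f]) (auto split: split_indicator)
    show "birkhoff_max f n x - birkhoff_max f k (T x) \<le> f x * indicator {x. birkhoff_max f n x > 0} x" for x
      using birkhoff_max_nonneg[of f k "T x"] unfolding Suc by (auto split: split_indicator)
  qed
  finally show ?thesis .
qed simp

text \<open>The sets where \<open>birkhoff_max f n\<close> is positive increase with n to the set in
  question, so the finite version passes to the limit by dominated convergence.\<close>

theorem maximal_ergodic: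
  assumes f: "integrable M f"
  shows "0 \<le> (\<integral>x. f x * indicator {x. \<exists>n. birkhoff_sum f n x > 0} x \<partial>M)"
proof -
  note [measurable] = borel_measurable_integrable[OF f]
    borel_measurable_integrable[OF birkhoff_max_integrable[OF f]]
  have ev: "(\<exists>n. birkhoff_sum f n x > 0) \<longleftrightarrow> (\<exists>N. \<forall>n\<ge>N. birkhoff_max f n x > 0)" for x
  proof
    assume "\<exists>n. birkhoff_sum f n x > 0"
    then obtain N where "birkhoff_max f N x > 0" using birkhoff_max_ge less_le_trans by blast
    moreover have "birkhoff_max f N x \<le> birkhoff_max f n x" if "n \<ge> N" for n
      using birkhoff_max_mono lift_Suc_mono_le[of "\<lambda>n. birkhoff_max f n x", OF _ that] by blast
    ultimately show "\<exists>N. \<forall>n\<ge>N. birkhoff_max f n x > 0" by (meson less_le_trans)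
  next
    assume "\<exists>N. \<forall>n\<ge>N. birkhoff_max f n x > 0"
    then show "\<exists>n. birkhoff_sum f n x > 0" using birkhoff_max_pos by (metis order_refl)
  qed
  have "(\<lambda>n. \<integral>x. f x * indicator {x. birkhoff_max f n x > 0} x \<partial>M) \<longlonglongrightarrow>
        (\<integral>x. f x * indicator {x. \<exists>n. birkhoff_sum f n x > 0} x \<partial>M)"
  proof (rule integral_dominated_convergence[where w="\<lambda>x. \<bar>f x\<bar>"])
    show "AE x in M. (\<lambda>n. f x * indicator {x. birkhoff_max f n x > 0} x) \<longlonglongrightarrow>
        f x * indicator {x. \<exists>n. birkhoff_sum f n x > 0} x"
    proof (intro AE_I2 tendsto_mult tendsto_const)
      fix x
      show "(\<lambda>n. indicator {x. birkhoff_max f n x > 0} x :: real) \<longlonglongrightarrow> indicator {x. \<exists>n. birkhoff_sum f n x > 0} x"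
      proof (cases "\<exists>n. birkhoff_sum f n x > 0")
        case True
        then obtain N where "\<forall>n\<ge>N. birkhoff_max f n x > 0" using ev by blast
        then show ?thesis using True
          by (intro tendsto_eventually eventually_sequentiallyI[of N]) auto
      next
        case False
        then have "\<not> birkhoff_max f n x > 0" for n using birkhoff_max_pos by metis
        then show ?thesis using False by simp
      qed
    qed
  qed (use f in \<open>auto split: split_indicator\<close>)
  then show ?thesis
    by (rule tendsto_lowerbound) (auto intro: always_eventually maximal_ergodic_finite[OF f])
qed

text \<open>The indicator of an invariant set is constant along orbits and factors out of the sum.
  This prepares the maximal theorem for \<open>f - c\<close> cut off to \<open>E\<close>.\<close>

lemma birkhoff_sum_invariant_set:
  assumes inv: "\<And>x. T x \<in> E \<longleftrightarrow> x \<in> E"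
  shows "birkhoff_sum (\<lambda>x. (f x - c) * indicator E x) n x = (birkhoff_sum f n x - c * n) * indicator E x"
proof (induction n arbitrary: x)
  case (Suc n)
  have "indicator E (T x) = (indicator E x :: real)" using inv by (simp add: indicator_def)
  then show ?case unfolding birkhoff_sum_Suc Suc by (simp add: algebra_simps)
qed simp

lemma maximal_ergodic_on_invariant_set:
  assumes f: "integrable M f" and E [measurable]: "E \<in> sets M"
    and inv: "\<And>x. T x \<in> E \<longleftrightarrow> x \<in> E"
    and sub: "\<And>x. x \<in> E \<Longrightarrow> \<exists>n. birkhoff_sum f n x > c * n"
  shows "c * measure M E \<le> (\<integral>x. f x * indicator E x \<partial>M)"
proof -
  let ?g = "\<lambda>x. (f x - c) * indicator E x"
  note [measurable] = borel_measurable_integrable[OF f]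
  have i1: "integrable M (\<lambda>x. f x * indicator E x)"
    by (rule Bochner_Integration.integrable_bound[OF f]) (auto split: split_indicator)
  have i2: "integrable M (\<lambda>x. c * indicator E x)"
    by (intro integrable_mult_right) (simp add: integrable_indicator_iff less_top[symmetric])
  have g: "integrable M ?g" using Bochner_Integration.integrable_diff[OF i1 i2] by (simp add: algebra_simps)
  \<comment> \<open>Off \<open>E\<close> all sums of \<open>?g\<close> vanish, and on
    \<open>E\<close> one of them is positive by \<open>sub\<close>; the set of the maximal theorem
    is \<open>E\<close> itself.\<close>
  have *: "{x. \<exists>n. birkhoff_sum ?g n x > 0} = E"
    unfolding birkhoff_sum_invariant_set[OF inv] using sub by (force split: split_indicator_asm)
  have "0 \<le> (\<integral>x. ?g x * indicator E x \<partial>M)" using maximal_ergodic[OF g] unfolding * .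
  also have "\<dots> = (\<integral>x. f x * indicator E x - c * indicator E x \<partial>M)"
    by (intro Bochner_Integration.integral_cong) (auto simp: algebra_simps split: split_indicator)
  also have "\<dots> = (\<integral>x. f x * indicator E x \<partial>M) - c * measure M E"
    using Bochner_Integration.integral_diff[OF i1 i2] sets.sets_into_space[OF E] by (simp add: Int_absorb2)
  finally show ?thesis by simp
qed

section \<open>Upper limits of Birkhoff averages and pointwise convergence\<close>

definition upper_average :: "('a \<Rightarrow> real) \<Rightarrow> 'a \<Rightarrow> ereal"
  where "upper_average f x = limsup (\<lambda>n. ereal (birkhoff_sum f n x / n))"

lemma upper_average_measurable [measurable]:
  "f \<in> borel_measurable M \<Longrightarrow> upper_average f \<in> borel_measurable M"
  unfolding upper_average_def[abs_def]
  by (intro borel_measurable_limsup borel_measurable_ereal borel_measurable_divide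
      birkhoff_sum_measurable borel_measurable_const)

text \<open>The sum of n terms from \<open>T x\<close> is the sum of n + 1 terms from
  \<open>x\<close> without \<open>f x\<close>. After division by n, the factor (n + 1) / n tends to
  1 and the missing term to 0. Invariance is what allows level sets of the upper average to serve as
  \<open>E\<close> above.\<close>

lemma upper_average_T: "upper_average f (T x) = upper_average f x"
proof -
  let ?u = "\<lambda>n. ereal (birkhoff_sum f n x / n)"
  have eq: "ereal (birkhoff_sum f n (T x) / n) = ereal (- (f x / n)) + ereal (real (Suc n) / real n) * ?u (Suc n)"
    if "n \<ge> 1" for n
    using that by (simp add: birkhoff_sum_Suc divide_simps)
  have t1: "(\<lambda>n. ereal (- (f x / real n))) \<longlonglongrightarrow> ereal (- 0)" by (intro tendsto_intros lim_const_over_n)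
  have t2: "(\<lambda>n. ereal (real (Suc n) / real n)) \<longlonglongrightarrow> ereal 1"
    by (intro tendsto_ereal LIMSEQ_Suc_n_over_n)
  have "upper_average f (T x) = limsup (\<lambda>n. ereal (- (f x / n)) + ereal (real (Suc n) / real n) * ?u (Suc n))"
    unfolding upper_average_def by (intro Limsup_eq eventually_sequentiallyI[of 1] eq)
  also have "\<dots> = ereal (- 0) + limsup (\<lambda>n. ereal (real (Suc n) / real n) * ?u (Suc n))"
    by (rule ereal_limsup_lim_add[OF t1]) auto
  also have "\<dots> = ereal (- 0) + ereal 1 * limsup (\<lambda>n. ?u (Suc n))"
    by (subst ereal_limsup_lim_mult[OF t2]) auto
  also have "\<dots> = upper_average f x"
    using limsup_shift[of ?u] by (simp add: upper_average_def one_ereal_def[symmetric] zero_ereal_def[symmetric])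
  finally show ?thesis .
qed

lemma upper_average_gtD:
  assumes "upper_average f x > ereal c" shows "\<exists>n. birkhoff_sum f n x > c * n"
proof (rule ccontr)
  assume "\<not> ?thesis"
  then have "eventually (\<lambda>n. ereal (birkhoff_sum f n x / n) \<le> ereal c) sequentially"
    by (intro eventually_sequentiallyI[of 1]) (simp add: not_less field_simps)
  then have "upper_average f x \<le> ereal c" unfolding upper_average_def by (rule Limsup_bounded)
  then show False using assms by simp
qed

lemma upper_average_set_bound:
  assumes f: "integrable M f" and E: "E \<in> sets M"
    and inv: "\<And>x. T x \<in> E \<longleftrightarrow> x \<in> E" and gt: "\<And>x. x \<in> E \<Longrightarrow> upper_average f x > ereal c"
  shows "c * measure M E \<le> (\<integral>x. f x * indicator E x \<partial>M)"
  using maximal_ergodic_on_invariant_set[OF f E inv upper_average_gtD[OF gt]] by blast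

lemma upper_average_AE_finite:
  assumes f: "integrable M f"
  shows "AE x in M. upper_average f x \<noteq> \<infinity>"
proof -
  note [measurable] = borel_measurable_integrable[OF f]
  define E where "E = {x \<in> space M. upper_average f x = \<infinity>}"
  have E [measurable]: "E \<in> sets M" unfolding E_def by measurable
  let ?I = "\<integral>x. f x * indicator E x \<partial>M"
  have bound: "c * measure M E \<le> ?I" for c
    by (rule upper_average_set_bound[OF f E]) (simp_all add: E_def upper_average_T)
  have "measure M E = 0"
  proof (rule ccontr)
    assume "measure M E \<noteq> 0"
    \<comment> \<open>This value of \<open>c\<close> turns the bound into
      \<open>?I + 1 \<le> ?I\<close>.\<close>
    then show False using bound[of "(?I + 1) / measure M E"] by simp
  qed
  then have "E \<in> null_sets M" using E by (simp add: null_setsI emeasure_eq_measure)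
  then show ?thesis by (rule AE_I') (auto simp: E_def)
qed

text \<open>The upper average of \<open>- f\<close> is minus the lower average of \<open>f\<close>,
  so on the exceptional set \<open>E\<close> the averages oscillate across [a, b]. The bounds for
  \<open>f\<close> and for \<open>- f\<close> give b |E| \<le> integral of \<open>f\<close> over
  \<open>E\<close> \<le> a |E|, which forces |E| = 0.\<close>

lemma upper_average_gap:
  assumes f: "integrable M f" and ab: "a < b"
  shows "AE x in M. \<not> (upper_average f x > ereal b \<and> upper_average (\<lambda>x. - f x) x > ereal (- a))"
proof -
  note [measurable] = borel_measurable_integrable[OF f]
  define E where "E = {x \<in> space M. upper_average f x > ereal b \<and> upper_average (\<lambda>x. - f x) x > ereal (- a)}"
  have E [measurable]: "E \<in> sets M" unfolding E_def by measurable
  have "b * measure M E \<le> (\<integral>x. f x * indicator E x \<partial>M)"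
    by (rule upper_average_set_bound[OF f E]) (simp_all add: E_def upper_average_T)
  moreover have "- a * measure M E \<le> (\<integral>x. - f x * indicator E x \<partial>M)"
    by (rule upper_average_set_bound[OF _ E]) (simp_all add: f E_def upper_average_T)
  ultimately have "(b - a) * measure M E \<le> 0" by (simp add: algebra_simps)
  then have "measure M E = 0" using ab by (simp add: mult_le_0_iff measure_le_0_iff)
  then have "E \<in> null_sets M" using E by (simp add: null_setsI emeasure_eq_measure)
  then show ?thesis by (rule AE_I') (auto simp: E_def)
qed

text \<open>If the upper limit exceeded the lower one, two rationals would fit in between. Only
  countably many rational gaps have to be excluded, so one null set suffices.\<close>

theorem birkhoff:
  assumes f: "integrable M f"
  shows "AE x in M. convergent (\<lambda>n. birkhoff_sum f n x / n)"
proof -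
  have "AE x in M. \<forall>a::rat. \<forall>b::rat. a < b \<longrightarrow>
      \<not> (upper_average f x > ereal (of_rat b) \<and> upper_average (\<lambda>x. - f x) x > ereal (- of_rat a))"
    unfolding AE_all_countable using upper_average_gap[OF f] by (simp add: of_rat_less)
  then show ?thesis
    using upper_average_AE_finite[OF f] upper_average_AE_finite[OF integrable_minus[OF f]]
  proof eventually_elim
    case (elim x)
    let ?u = "\<lambda>n. ereal (birkhoff_sum f n x / n)"
    have lim: "upper_average (\<lambda>x. - f x) x = - liminf ?u"
      unfolding upper_average_def by (simp add: birkhoff_sum_uminus ereal_Limsup_uminus[symmetric])
    have le: "limsup ?u \<le> liminf ?u"
    proof (rule ccontr)
      assume "\<not> ?thesis"
      then obtain c where c: "liminf ?u < ereal c" "ereal c < limsup ?u"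
        using ereal_dense2 by (meson not_le)
      obtain d where d: "c < d" "ereal d < limsup ?u" using ereal_dense2[OF c(2)] by auto
      obtain q where q: "c < of_rat q" "of_rat q < d" using of_rat_dense[OF d(1)] by blast
      obtain r where r: "of_rat q < (of_rat r :: real)" "of_rat r < d" using of_rat_dense[OF q(2)] by blast
      have "q < r" using r by (simp add: of_rat_less)
      moreover have "upper_average f x > ereal (of_rat r)"
        unfolding upper_average_def using r(2) d(2) by (meson ereal_less_eq(3) less_eq_real_def le_less_trans less_trans)
      moreover have "upper_average (\<lambda>x. - f x) x > ereal (- of_rat q)"
        unfolding lim using c(1) q(1)
        by (metis ereal_less_uminus_reorder ereal_uminus_uminus less_ereal.simps(1) less_trans uminus_ereal.simps(1))
      ultimately show False using elim(1) by blast
    qed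
    have eq: "limsup ?u = liminf ?u" using le Liminf_le_Limsup[of sequentially ?u] by simp
    have "limsup ?u \<noteq> \<infinity>" "limsup ?u \<noteq> - \<infinity>"
      using elim(2,3) eq unfolding lim by (auto simp: upper_average_def)
    then obtain l where "limsup ?u = ereal l" by (cases "limsup ?u") auto
    then have "?u \<longlonglongrightarrow> ereal l" using eq by (subst tendsto_iff_Liminf_eq_Limsup) auto
    then show ?case by (auto simp: convergent_def)
  qed
qed

end

section \<open>Time averages along measure-preserving flows\<close>

lemma abs_mult_le_sum_squares: "\<bar>a * b\<bar> \<le> a\<^sup>2 + b\<^sup>2" for a b :: real
  using sum_squares_bound[of "\<bar>a\<bar>" "\<bar>b\<bar>"] mult_nonneg_nonneg[OF abs_ge_zero abs_ge_zero, of a b]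
  unfolding abs_mult power2_abs by linarith

lemma integrable_mult_of_square_integrable:
  fixes f g :: "'a \<Rightarrow> real"
  assumes [measurable]: "f \<in> borel_measurable M" "g \<in> borel_measurable M"
    and "integrable M (\<lambda>x. (f x)\<^sup>2)" "integrable M (\<lambda>x. (g x)\<^sup>2)"
  shows "integrable M (\<lambda>x. f x * g x)"
proof (rule Bochner_Integration.integrable_bound)
  show "integrable M (\<lambda>x. (f x)\<^sup>2 + (g x)\<^sup>2)" using assms by simp
  show "AE x in M. norm (f x * g x) \<le> norm ((f x)\<^sup>2 + (g x)\<^sup>2)"
    by (simp add: abs_mult_le_sum_squares)
qed simp

text \<open>Split \<open>\<bar>g h\<bar>\<close> according to whether \<open>\<bar>h\<bar> \<le> K \<bar>g\<bar>\<close>: it is at most \<open>min \<bar>g h\<bar> (K g\<^sup>2) + h\<^sup>2 / K\<close>, where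
  the first summand is dominated by \<open>K g\<^sup>2\<close>.\<close>

lemma square_bounded_tendsto_weakly:
  fixes g :: "'a \<Rightarrow> real"
  assumes [measurable]: "g \<in> borel_measurable M" "\<And>n. h n \<in> borel_measurable M"
    and g: "integrable M (\<lambda>x. (g x)\<^sup>2)" and h: "\<And>n. integrable M (\<lambda>x. (h n x)\<^sup>2)"
    and C: "\<And>n. (\<integral>x. (h n x)\<^sup>2 \<partial>M) \<le> C" and ae: "AE x in M. (\<lambda>n. h n x) \<longlonglongrightarrow> 0"
  shows "(\<lambda>n. \<integral>x. g x * h n x \<partial>M) \<longlonglongrightarrow> 0"
proof (rule LIMSEQ_I)
  fix e :: real assume e: "e > 0"
  have C0: "C \<ge> 0" using C[of 0] by (rule order_trans[rotated]) simp
  \<comment> \<open>Makes the tail \<open>C / K\<close> smaller than \<open>e / 2\<close>; the 1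
    keeps \<open>K\<close> positive when \<open>C\<close> is 0.\<close>
  define K where "K = 2 * (C + 1) / e"
  have K: "K > 0" "C / K < e / 2" using e C0 by (auto simp: K_def field_simps)
  have gh: "integrable M (\<lambda>x. g x * h n x)" for n by (intro integrable_mult_of_square_integrable g h) auto
  let ?m = "\<lambda>n x. min \<bar>g x * h n x\<bar> (K * (g x)\<^sup>2)"
  have m: "integrable M (?m n)" for n
    using gh g by (intro integrable_min integrable_abs integrable_mult_right) auto
  have "(\<lambda>n. \<integral>x. ?m n x \<partial>M) \<longlonglongrightarrow> (\<integral>x. 0 \<partial>M)"
  proof (rule integral_dominated_convergence[where w="\<lambda>x. K * (g x)\<^sup>2"])
    show "AE x in M. (\<lambda>n. ?m n x) \<longlonglongrightarrow> 0"
      using ae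
    proof eventually_elim
      case (elim x)
      have "(\<lambda>n. \<bar>g x * h n x\<bar>) \<longlonglongrightarrow> 0"
        using tendsto_rabs[OF tendsto_mult[OF tendsto_const elim, of "g x"]] by simp
      then show ?case
        by (rule tendsto_sandwich[OF _ _ tendsto_const, rotated 2]) (use K in \<open>auto intro!: always_eventually\<close>)
    qed
  qed (use g K in auto)
  then have "\<forall>\<^sub>F n in sequentially. (\<integral>x. ?m n x \<partial>M) < e / 2"
    using e by (intro order_tendstoD(2)) auto
  then obtain N where N: "\<And>n. n \<ge> N \<Longrightarrow> (\<integral>x. ?m n x \<partial>M) < e / 2" by (auto simp: eventually_sequentially)
  show "\<exists>no. \<forall>n\<ge>no. norm ((\<integral>x. g x * h n x \<partial>M) - 0) < e"
  proof (intro exI[of _ N] allI impI)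
    fix n assume n: "n \<ge> N"
    have pt: "\<bar>a * b\<bar> \<le> min \<bar>a * b\<bar> (K * a\<^sup>2) + b\<^sup>2 / K" for a b :: real
    proof (cases "\<bar>b\<bar> \<le> K * \<bar>a\<bar>")
      case True
      have "\<bar>a * b\<bar> \<le> K * a\<^sup>2"
        using mult_left_mono[OF True, of "\<bar>a\<bar>"] by (simp add: abs_mult power2_eq_square ac_simps)
      then show ?thesis using K by simp
    next
      case False
      have "K * \<bar>a * b\<bar> \<le> b\<^sup>2"
        using mult_right_mono[of "K * \<bar>a\<bar>" "\<bar>b\<bar>" "\<bar>b\<bar>"] False by (simp add: abs_mult power2_eq_square ac_simps)
      then have "\<bar>a * b\<bar> \<le> b\<^sup>2 / K" using K by (simp add: field_simps)
      moreover have "0 \<le> K * a\<^sup>2" using K by simp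
      ultimately show ?thesis by (auto simp: min_def)
    qed
    have "\<bar>\<integral>x. g x * h n x \<partial>M\<bar> \<le> (\<integral>x. \<bar>g x * h n x\<bar> \<partial>M)" by (rule integral_abs_bound)
    also have "\<dots> \<le> (\<integral>x. ?m n x + (h n x)\<^sup>2 / K \<partial>M)"
      using pt gh h m by (intro integral_mono integrable_abs Bochner_Integration.integrable_add) auto
    also have "\<dots> = (\<integral>x. ?m n x \<partial>M) + (\<integral>x. (h n x)\<^sup>2 \<partial>M) / K"
      using m h by simp
    also have "\<dots> < e / 2 + e / 2"
    proof -
      have "(\<integral>x. (h n x)\<^sup>2 \<partial>M) / K \<le> C / K" using C K by (simp add: divide_right_mono)
      then show ?thesis using N[OF n] K(2) by linarith
    qed
    finally show "norm ((\<integral>x. g x * h n x \<partial>M) - 0) < e" by simp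
  qed
qed

section \<open>Flows in continuous time: Fubini along orbits and the ergodic theorem\<close>

locale measure_flow = finite_measure M for M :: "'a measure" +
  fixes \<phi> :: "real \<Rightarrow> 'a \<Rightarrow> 'a"
  assumes flow_measurable [measurable]: "(\<lambda>(t, x). \<phi> t x) \<in> measurable (lborel \<Otimes>\<^sub>M M) M"
    and flow_0 [simp]: "\<phi> 0 x = x"
    and flow_add: "\<phi> (s + t) x = \<phi> s (\<phi> t x)"
    and flow_distr: "distr M M (\<phi> t) = M"
    and space_eq_UNIV [simp]: "space M = UNIV"
begin

lemma flow_at_measurable [measurable]: "\<phi> t \<in> measurable M M"
  using measurable_compose[OF measurable_Pair1'[of t lborel M] flow_measurable] by simp

sublocale one: measure_preserving M "\<phi> t" for t by unfold_locales (auto simp: flow_distr)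

lemma flow_power: "(\<phi> 1 ^^ n) x = \<phi> (real n) x" by (induction n) (simp_all add: flow_add[symmetric])

sublocale pr: pair_sigma_finite lborel M by unfold_locales

text \<open>The uniform bound \<open>C\<close> on the L^1 norms makes the function integrable on
  [0, T] times the space, and everything else is Fubini. Windows of natural length in the second
  statement give one null set that serves all real \<open>T\<close>.\<close>

lemma
  fixes g :: "real \<Rightarrow> 'a \<Rightarrow> real"
  assumes g [measurable]: "(\<lambda>(t, x). g t x) \<in> borel_measurable (lborel \<Otimes>\<^sub>M M)"
    and int: "\<And>t. integrable M (g t)" and C: "\<And>t. (\<integral>x. \<bar>g t x\<bar> \<partial>M) \<le> C"
  shows flow_integrable_pair: "integrable (lborel \<Otimes>\<^sub>M M) (\<lambda>(t, x). indicator {0..T} t * g t x)" (is ?A)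
    and flow_integrable_AE: "AE x in M. \<forall>n. set_integrable lborel {0..real n} (\<lambda>t. g t x)" (is ?B)
    and flow_integrable_space: "integrable M (\<lambda>x. LINT t:{0..T}|lborel. g t x)" (is ?C)
    and flow_integrable_time: "set_integrable lborel {0..T} (\<lambda>t. \<integral>x. g t x \<partial>M)" (is ?D)
    and flow_fubini: "(\<integral>x. (LINT t:{0..T}|lborel. g t x) \<partial>M) = (LINT t:{0..T}|lborel. (\<integral>x. g t x \<partial>M))" (is ?E)
proof -
  have *: "integrable (lborel \<Otimes>\<^sub>M M) (\<lambda>(t, x). indicator {0..T} t * g t x)" for T
  proof (rule pr.Fubini_integrable)
    show "integrable lborel (\<lambda>t. \<integral>x. norm (case (t, x) of (t, x) \<Rightarrow> indicator {0..T} t * g t x) \<partial>M)"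
    proof (rule Bochner_Integration.integrable_bound)
      show "integrable lborel (\<lambda>t. indicator {0..T} t * C)"
        by (intro integrable_mult_left) (auto simp: integrable_indicator_iff emeasure_lborel_Icc_eq)
      have "(\<integral>x. norm (g t x) \<partial>M) \<le> \<bar>C\<bar>" for t using C[of t] by simp
      then show "AE t in lborel. norm (\<integral>x. norm (case (t, x) of (t, x) \<Rightarrow> indicator {0..T} t * g t x) \<partial>M)
           \<le> norm (indicator {0..T} t * C)" by (auto split: split_indicator)
    qed measurable
  qed (auto intro: int)
  show ?A by (rule *)
  show ?B
    unfolding AE_all_countable set_integrable_def using pr.AE_integrable_snd[OF *] by simp
  show ?C
    unfolding set_lebesgue_integral_def using pr.integrable_snd[OF *] by simp
  show ?D
    unfolding set_integrable_def using pr.integrable_fst[OF *] by simp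
  show ?E
    unfolding set_lebesgue_integral_def using pr.Fubini_integral[OF *] by simp
qed

definition window_average :: "real \<Rightarrow> ('a \<Rightarrow> real) \<Rightarrow> 'a \<Rightarrow> real"
  where "window_average T f x = (LINT t:{0..T}|lborel. f (\<phi> t x)) / T"

lemma flow_compose_measurable [measurable]:
  "f \<in> borel_measurable M \<Longrightarrow> (\<lambda>(t, x). f (\<phi> t x)) \<in> borel_measurable (lborel \<Otimes>\<^sub>M M)"
  using measurable_compose[OF flow_measurable, of f borel] by (simp add: split_beta)

lemma window_average_measurable [measurable]:
  assumes [measurable]: "f \<in> borel_measurable M"
  shows "window_average T f \<in> borel_measurable M"
proof -
  have [measurable]: "(\<lambda>(x, t). f (\<phi> t x)) \<in> borel_measurable (M \<Otimes>\<^sub>M lborel)"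
    using measurable_compose[OF measurable_pair_swap' flow_compose_measurable[OF assms]] by (simp add: split_beta)
  show ?thesis
    unfolding window_average_def[abs_def] set_lebesgue_integral_def by measurable
qed

context
  fixes f :: "'a \<Rightarrow> real"
  assumes f: "integrable M f"
begin

lemma orbit_fubini_premises:
  "(\<lambda>(t, x). f (\<phi> t x)) \<in> borel_measurable (lborel \<Otimes>\<^sub>M M)"
  "integrable M (\<lambda>x. f (\<phi> t x))" "(\<integral>x. \<bar>f (\<phi> t x)\<bar> \<partial>M) \<le> (\<integral>x. \<bar>f x\<bar> \<partial>M)"
  using f one.T_integrable[OF f] one.T_integral[of "\<lambda>x. \<bar>f x\<bar>"] by auto

lemmas orbit_integrable_AE = flow_integrable_AE[OF orbit_fubini_premises]
lemmas orbit_integral_integrable = flow_integrable_space[OF orbit_fubini_premises]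

end

lemma orbit_integrable_upto:
  fixes f :: "'a \<Rightarrow> real"
  assumes "\<And>n. set_integrable lborel {0..real n} (\<lambda>t. f (\<phi> t x))"
  shows "set_integrable lborel {0..T} (\<lambda>t. f (\<phi> t x))"
proof -
  obtain n where "T \<le> real n" using real_arch_simple by blast
  then show ?thesis by (intro set_integrable_subset[OF assms[of n]]) auto
qed

text \<open>The substitution t -> s + t moves the window to [s, s + T]. Written as a difference of
  integrals from 0, the result telescopes over successive windows.\<close>

lemma orbit_integral_shift:
  fixes f :: "'a \<Rightarrow> real"
  assumes int: "\<And>n. set_integrable lborel {0..real n} (\<lambda>t. f (\<phi> t x))" and s: "s \<ge> 0" and T: "T \<ge> 0"
  shows "(LINT t:{0..T}|lborel. f (\<phi> t (\<phi> s x))) = integral {0..s + T} (\<lambda>t. f (\<phi> t x)) - integral {0..s} (\<lambda>t. f (\<phi> t x))"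
proof -
  have "set_integrable lborel {s..s + T} (\<lambda>t. f (\<phi> t x))"
    by (rule set_integrable_subset[OF orbit_integrable_upto[OF int, of "s + T"]]) (use s in auto)
  then have "integrable lborel (\<lambda>t. indicator {s..s + T} (s + 1 * t) *\<^sub>R f (\<phi> (s + 1 * t) x))"
    unfolding set_integrable_def by (rule lborel_integrable_real_affine) simp
  moreover have "indicator {s..s + T} (s + 1 * t) = (indicator {0..T} t :: real)" for t
    by (auto split: split_indicator)
  ultimately have "set_integrable lborel {0..T} (\<lambda>t. f (\<phi> t (\<phi> s x)))"
    unfolding set_integrable_def by (simp add: flow_add[symmetric] add.commute)
  then have "(LINT t:{0..T}|lborel. f (\<phi> t (\<phi> s x))) = integral {0..T} (\<lambda>t. f (\<phi> (t + s) x))"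
    using set_borel_integral_eq_integral(2) by (simp add: flow_add)
  also have "\<dots> = integral {s..s + T} (\<lambda>t. f (\<phi> t x))"
    using integral_shift_Icc_real[of 0 T "\<lambda>t. f (\<phi> t x)" s] by (simp add: comp_def add.commute)
  finally show ?thesis
    using Henstock_Kurzweil_Integration.integral_combine[OF s, of "s + T" "\<lambda>t. f (\<phi> t x)"] T
      set_borel_integral_eq_integral(1)[OF orbit_integrable_upto[OF int, of "s + T"]] by simp
qed

text \<open>The bridge between discrete and continuous time: consecutive unit windows add up to one
  window of length n.\<close>

lemma orbit_integral_eq_birkhoff_sum:
  fixes f :: "'a \<Rightarrow> real"
  assumes int: "\<And>n. set_integrable lborel {0..real n} (\<lambda>t. f (\<phi> t x))"
  shows "one.birkhoff_sum 1 (\<lambda>x. LINT t:{0..1}|lborel. f (\<phi> t x)) n x = integral {0..real n} (\<lambda>t. f (\<phi> t x))"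
proof (induction n)
  case (Suc n)
  then show ?case
    using orbit_integral_shift[OF int, of "real n" 1]
    by (simp add: one.birkhoff_sum_def flow_power add.commute)
qed simp

text \<open>Between the integer part k of \<open>T\<close> and \<open>T\<close> itself, the integral
  changes by at most the integral of \<bar>f\<bar> over [k, k + 1]. This is o(k), because the
  averages of \<bar>f\<bar> converge along the integers.\<close>

lemma orbit_average_tendsto:
  fixes f :: "'a \<Rightarrow> real"
  assumes int: "\<And>n. set_integrable lborel {0..real n} (\<lambda>t. f (\<phi> t x))"
    and a: "convergent (\<lambda>n. one.birkhoff_sum 1 (\<lambda>x. LINT t:{0..1}|lborel. f (\<phi> t x)) n x / n)"
    and b: "convergent (\<lambda>n. one.birkhoff_sum 1 (\<lambda>x. LINT t:{0..1}|lborel. \<bar>f (\<phi> t x)\<bar>) n x / n)"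
  shows "\<exists>l. ((\<lambda>T. window_average T f x) \<longlongrightarrow> l) at_top"
proof -
  let ?g = "\<lambda>t. f (\<phi> t x)"
  define I where "I T = integral {0..T} ?g" for T
  define B where "B T = integral {0..T} (\<lambda>t. \<bar>?g t\<bar>)" for T
  have int': "\<And>n. set_integrable lborel {0..real n} (\<lambda>t. \<bar>?g t\<bar>)"
    using set_integrable_abs[OF int] .
  obtain l where "(\<lambda>n. I (real n) / n) \<longlonglongrightarrow> l"
    using a unfolding orbit_integral_eq_birkhoff_sum[OF int] by (auto simp: convergent_def I_def)
  obtain l' where l': "(\<lambda>n. B (real n) / n) \<longlonglongrightarrow> l'"
    using b unfolding orbit_integral_eq_birkhoff_sum[where f="\<lambda>y. \<bar>f y\<bar>", OF int']
    by (auto simp: convergent_def B_def)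
  \<comment> \<open>The error bound for the fractional part of \<open>T\<close>. As
    \<open>B n / n\<close> converges, its normalised increments tend to 0.\<close>
  define d where "d n = (B (real (Suc n)) - B (real n)) / real n" for n
  have "(\<lambda>n. B (real (Suc n)) / real (Suc n) * (real (Suc n) / real n) - B (real n) / real n) \<longlonglongrightarrow> l' * 1 - l'"
    by (intro tendsto_intros LIMSEQ_Suc[OF l'] l' LIMSEQ_Suc_n_over_n)
  then have d: "d \<longlonglongrightarrow> 0" by (simp add: d_def[abs_def] diff_divide_distrib del: of_nat_Suc)
  have ig: "?g integrable_on {0..T}" "(\<lambda>t. \<bar>?g t\<bar>) integrable_on {0..T}" "set_integrable lborel {0..T} ?g" for T
    using orbit_integrable_upto[OF int, of T] set_borel_integral_eq_integral(1) set_integrable_abs by blast+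
  let ?n = "\<lambda>T::real. nat \<lfloor>T\<rfloor>"
  have n: "filterlim ?n sequentially at_top"
    by (rule filterlim_compose[OF filterlim_nat_sequentially filterlim_floor_sequentially])
  \<comment> \<open>The factor k / T, which tends to 1, is inserted so that the difference is
    exactly the integral over [k, T] divided by \<open>T\<close>.\<close>
  have bound: "norm (I T / T - I (real (?n T)) / real (?n T) * (real (?n T) / T)) \<le> d (?n T)" if T: "T \<ge> 1" for T
  proof -
    define k where "k = ?n T"
    have k: "real k \<le> T" "T \<le> real (Suc k)" "real k > 0" using T unfolding k_def by linarith+
    have sub: "?g integrable_on {real k..T}" "(\<lambda>t. \<bar>?g t\<bar>) integrable_on {real k..T}"
      using ig(1,2)[of T] k by (auto intro: integrable_subinterval_real)
    have "I T - I (real k) = integral {real k..T} ?g"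
      using Henstock_Kurzweil_Integration.integral_combine[OF _ k(1) ig(1)] by (simp add: I_def algebra_simps)
    then have "norm (I T - I (real k)) \<le> integral {real k..T} (\<lambda>t. \<bar>?g t\<bar>)"
      using integral_norm_bound_integral[OF sub] by simp
    also have "\<dots> \<le> integral {real k..real (Suc k)} (\<lambda>t. \<bar>?g t\<bar>)"
      using k ig(2)[of "real (Suc k)"]
      by (intro integral_subset_le sub) (auto intro: integrable_subinterval_real)
    also have "\<dots> = B (real (Suc k)) - B (real k)"
      using Henstock_Kurzweil_Integration.integral_combine[OF _ _ ig(2), of "real k" "real (Suc k)"]
      by (simp add: B_def algebra_simps)
    finally have le: "\<bar>I T - I (real k)\<bar> \<le> B (real (Suc k)) - B (real k)" by simp
    have "I T / T - I (real k) / real k * (real k / T) = (I T - I (real k)) / T"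
      using k by (simp add: field_simps)
    then have "norm (I T / T - I (real k) / real k * (real k / T)) = \<bar>I T - I (real k)\<bar> / T"
      using T by simp
    also have "\<dots> \<le> (B (real (Suc k)) - B (real k)) / real k"
      using le k T by (intro frac_le) auto
    finally show ?thesis unfolding d_def k_def .
  qed
  have "((\<lambda>T. I T / T - I (real (?n T)) / real (?n T) * (real (?n T) / T)) \<longlongrightarrow> 0) at_top"
    by (rule Lim_null_comparison[OF _ filterlim_compose[OF d n]])
       (rule eventually_at_top_linorderI[of 1], rule bound)
  moreover have "((\<lambda>T. I (real (?n T)) / real (?n T) * (real (?n T) / T)) \<longlongrightarrow> l * 1) at_top"
  proof (intro tendsto_mult filterlim_compose[OF \<open>(\<lambda>n. I (real n) / n) \<longlonglongrightarrow> l\<close> n])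
    show "((\<lambda>T. real (?n T) / T) \<longlongrightarrow> 1) at_top"
    proof (rule tendsto_sandwich[OF _ _ _ tendsto_const])
      have "x - 1 \<le> real (?n x)" "real (?n x) \<le> x" if "x \<ge> 1" for x :: real using that by linarith+
      then show "\<forall>\<^sub>F x in at_top. 1 - 1 / x \<le> real (?n x) / x" "\<forall>\<^sub>F x in at_top. real (?n x) / x \<le> 1"
        by (auto intro!: eventually_at_top_linorderI[of 1] simp: field_simps)
      show "((\<lambda>T::real. 1 - 1 / T) \<longlongrightarrow> 1) at_top"
        using tendsto_diff[OF tendsto_const tendsto_divide_0[OF tendsto_const filterlim_at_top_imp_at_infinity[OF filterlim_ident]], of 1 1]
        by simp
    qed
  qed
  ultimately have "((\<lambda>T. I T / T) \<longlongrightarrow> 0 + l * 1) at_top"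
    using tendsto_add by fastforce
  moreover have "window_average T f x = I T / T" for T
    unfolding window_average_def I_def using set_borel_integral_eq_integral(2)[OF ig(3)] by simp
  ultimately show ?thesis by auto
qed

theorem flow_birkhoff:
  fixes f :: "'a \<Rightarrow> real"
  assumes f: "integrable M f"
  shows "AE x in M. \<exists>l. ((\<lambda>T. window_average T f x) \<longlongrightarrow> l) at_top"
  using orbit_integrable_AE[OF f] one.birkhoff[OF orbit_integral_integrable[OF f], of 1 1]
    one.birkhoff[OF orbit_integral_integrable[OF integrable_abs[OF f]], of 1 1]
  by eventually_elim (rule orbit_average_tendsto, auto)

text \<open>Jensen's inequality for the square: with \<open>c\<close> the mean of \<open>g\<close>,
  the integral of (g - c)^2 is nonnegative.\<close>

lemma set_integral_square_le:
  fixes g :: "real \<Rightarrow> real"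
  assumes T: "T > 0" and g: "set_integrable lborel {0..T} g" and g2: "set_integrable lborel {0..T} (\<lambda>t. (g t)\<^sup>2)"
  shows "((LINT t:{0..T}|lborel. g t) / T)\<^sup>2 \<le> (LINT t:{0..T}|lborel. (g t)\<^sup>2) / T"
proof -
  define c where "c = (LINT t:{0..T}|lborel. g t) / T"
  have c: "set_integrable lborel {0..T} (\<lambda>t. c\<^sup>2 :: real)"
    by (simp add: set_integrable_def integrable_indicator_iff emeasure_lborel_Icc_eq)
  have gc: "set_integrable lborel {0..T} (\<lambda>t. 2 * c * g t)" using g by simp
  have "0 \<le> (LINT t:{0..T}|lborel. (g t - c)\<^sup>2)"
    unfolding set_lebesgue_integral_def by (intro integral_nonneg_AE) auto
  also have "\<dots> = (LINT t:{0..T}|lborel. (g t)\<^sup>2 - 2 * c * g t + c\<^sup>2)"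
    by (simp add: power2_diff algebra_simps)
  also have "\<dots> = (LINT t:{0..T}|lborel. (g t)\<^sup>2) - 2 * c * (LINT t:{0..T}|lborel. g t) + c\<^sup>2 * T"
    using T by (simp add: set_integral_add set_integral_diff g2 gc c)
      (simp add: set_lebesgue_integral_def)
  also have "\<dots> = (LINT t:{0..T}|lborel. (g t)\<^sup>2) - c\<^sup>2 * T"
    using T by (simp add: c_def power2_eq_square)
  finally show ?thesis using T unfolding c_def[symmetric] by (simp add: field_simps)
qed

section \<open>Averages of square-integrable functions along the flow\<close>

context
  fixes f :: "'a \<Rightarrow> real"
  assumes fm [measurable]: "f \<in> borel_measurable M" and f2: "integrable M (\<lambda>x. (f x)\<^sup>2)"
begin

lemma square_integrable_integrable: "integrable M f"
  using integrable_mult_of_square_integrable[of f M "\<lambda>_. 1"] f2 by simp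

lemma orbit_product_fubini_premises:
  assumes [measurable]: "g \<in> borel_measurable M" and g2: "integrable M (\<lambda>x. (g x)\<^sup>2)"
  shows "(\<lambda>(t, x). g x * f (\<phi> t x)) \<in> borel_measurable (lborel \<Otimes>\<^sub>M M)" (is ?A)
    and "integrable M (\<lambda>x. g x * f (\<phi> t x))" (is ?B)
    and "(\<integral>x. \<bar>g x * f (\<phi> t x)\<bar> \<partial>M) \<le> (\<integral>x. (g x)\<^sup>2 \<partial>M) + (\<integral>x. (f x)\<^sup>2 \<partial>M)" (is ?C)
proof -
  show ?A by simp
  have ft: "integrable M (\<lambda>x. (f (\<phi> t x))\<^sup>2)" using one.T_integrable[OF f2] by simp
  show ?B by (rule integrable_mult_of_square_integrable) (use ft g2 in auto)
  have "(\<integral>x. \<bar>g x * f (\<phi> t x)\<bar> \<partial>M) \<le> (\<integral>x. (g x)\<^sup>2 + (f (\<phi> t x))\<^sup>2 \<partial>M)"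
    by (intro integral_mono integrable_abs Bochner_Integration.integrable_add g2 ft \<open>?B\<close> abs_mult_le_sum_squares)
  also have "\<dots> = (\<integral>x. (g x)\<^sup>2 \<partial>M) + (\<integral>x. (f (\<phi> t x))\<^sup>2 \<partial>M)" by (simp add: g2 ft)
  finally show ?C using one.T_integral[of "\<lambda>x. (f x)\<^sup>2"] by simp
qed

lemma window_average_inner:
  assumes g: "g \<in> borel_measurable M" and g2: "integrable M (\<lambda>x. (g x)\<^sup>2)"
  shows "(\<integral>x. g x * window_average T f x \<partial>M) = (LINT t:{0..T}|lborel. (\<integral>x. g x * f (\<phi> t x) \<partial>M)) / T"
  using flow_fubini[OF orbit_product_fubini_premises[OF g g2], of T]
  by (simp add: window_average_def)

text \<open>Jensen's inequality on almost every orbit, then Fubini and invariance of the measure.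
  The bound does not depend on \<open>T\<close>.\<close>

lemma window_average_square:
  assumes T: "T > 0"
  shows "integrable M (\<lambda>x. (window_average T f x)\<^sup>2)"
    and "(\<integral>x. (window_average T f x)\<^sup>2 \<partial>M) \<le> (\<integral>x. (f x)\<^sup>2 \<partial>M)"
proof -
  let ?w = "\<lambda>x. (LINT t:{0..T}|lborel. (f (\<phi> t x))\<^sup>2) / T"
  have le: "AE x in M. (window_average T f x)\<^sup>2 \<le> ?w x"
    using orbit_integrable_AE[OF f2] orbit_integrable_AE[OF square_integrable_integrable]
  proof eventually_elim
    case (elim x)
    obtain n where "T \<le> real n" using real_arch_simple by blast
    then have sub: "{0..T} \<subseteq> {0..real n}" by auto
    show ?case
      unfolding window_average_def
      using elim by (intro set_integral_square_le T) (auto intro: set_integrable_subset[OF _ _ sub])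
  qed
  have w: "integrable M ?w"
    using orbit_integral_integrable[OF f2] by simp
  show i: "integrable M (\<lambda>x. (window_average T f x)\<^sup>2)"
  proof (rule Bochner_Integration.integrable_bound[OF w])
    show "AE x in M. norm ((window_average T f x)\<^sup>2) \<le> norm (?w x)"
      using le by eventually_elim (metis real_norm_def abs_of_nonneg zero_le_power2 abs_ge_self order_trans)
  qed simp
  have "(\<integral>x. (window_average T f x)\<^sup>2 \<partial>M) \<le> (\<integral>x. ?w x \<partial>M)" by (rule integral_mono_AE[OF i w le])
  also have "\<dots> = (LINT t:{0..T}|lborel. (\<integral>x. (f (\<phi> t x))\<^sup>2 \<partial>M)) / T"
    using flow_fubini[OF orbit_fubini_premises[OF f2], of T] by simp
  also have "\<dots> = (\<integral>x. (f x)\<^sup>2 \<partial>M)"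
    using T one.T_integral[of "\<lambda>x. (f x)\<^sup>2"] by (simp add: set_lebesgue_integral_def)
  finally show "(\<integral>x. (window_average T f x)\<^sup>2 \<partial>M) \<le> (\<integral>x. (f x)\<^sup>2 \<partial>M)" .
qed

text \<open>Integer windows make this a limit of a sequence of measurable functions, hence
  measurable; it agrees with the limit over real windows wherever that exists. \<open>Suc\<close>
  skips the window of length 0.\<close>

definition flow_limit :: "'a \<Rightarrow> real"
  where "flow_limit x = lim (\<lambda>n. window_average (real (Suc n)) f x)"

lemma flow_limit_measurable [measurable]: "flow_limit \<in> borel_measurable M"
  unfolding flow_limit_def[abs_def] by (intro borel_measurable_lim_metric window_average_measurable fm)

lemma flow_limit_tendsto:
  assumes "((\<lambda>T. window_average T f x) \<longlongrightarrow> l) at_top"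
  shows "flow_limit x = l"
  unfolding flow_limit_def
  by (intro limI filterlim_compose[OF assms] filterlim_compose[OF filterlim_real_sequentially] filterlim_Suc)

lemma window_average_AE_tendsto: "AE x in M. ((\<lambda>T. window_average T f x) \<longlongrightarrow> flow_limit x) at_top"
  using flow_birkhoff[OF square_integrable_integrable] by eventually_elim (use flow_limit_tendsto in blast)

text \<open>Fatou's lemma, applied to the uniform L^2 bound for the window averages.\<close>

lemma flow_limit_square:
  "integrable M (\<lambda>x. (flow_limit x)\<^sup>2)" "(\<integral>x. (flow_limit x)\<^sup>2 \<partial>M) \<le> (\<integral>x. (f x)\<^sup>2 \<partial>M)"
proof -
  let ?w = "\<lambda>n. window_average (real (Suc n)) f"
  let ?C = "\<integral>x. (f x)\<^sup>2 \<partial>M"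
  have "AE x in M. (\<lambda>n. ?w n x) \<longlonglongrightarrow> flow_limit x"
    using window_average_AE_tendsto by eventually_elim
      (rule filterlim_compose, assumption, intro filterlim_compose[OF filterlim_real_sequentially] filterlim_Suc)
  then have "AE x in M. ennreal ((flow_limit x)\<^sup>2) = liminf (\<lambda>n. ennreal ((?w n x)\<^sup>2))"
  proof eventually_elim
    case (elim x)
    then have "(\<lambda>n. ennreal ((?w n x)\<^sup>2)) \<longlonglongrightarrow> ennreal ((flow_limit x)\<^sup>2)" by (intro tendsto_intros)
    then show ?case using lim_imp_Liminf by (metis trivial_limit_sequentially)
  qed
  then have "(\<integral>\<^sup>+x. ennreal ((flow_limit x)\<^sup>2) \<partial>M) = (\<integral>\<^sup>+x. liminf (\<lambda>n. ennreal ((?w n x)\<^sup>2)) \<partial>M)"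
    by (rule nn_integral_cong_AE)
  also have "\<dots> \<le> liminf (\<lambda>n. \<integral>\<^sup>+x. ennreal ((?w n x)\<^sup>2) \<partial>M)" by (rule nn_integral_liminf) simp
  also have "\<dots> \<le> ennreal ?C"
  proof (rule Liminf_le)
    show "\<forall>\<^sub>F n in sequentially. (\<integral>\<^sup>+x. ennreal ((?w n x)\<^sup>2) \<partial>M) \<le> ennreal ?C"
      using window_average_square by (subst nn_integral_eq_integral) (auto intro!: ennreal_leI)
  qed simp
  finally have le: "(\<integral>\<^sup>+x. ennreal ((flow_limit x)\<^sup>2) \<partial>M) \<le> ennreal ?C" .
  then show i: "integrable M (\<lambda>x. (flow_limit x)\<^sup>2)"
    by (intro integrableI_bounded) (auto simp: less_top[symmetric] top_unique)
  show "(\<integral>x. (flow_limit x)\<^sup>2 \<partial>M) \<le> ?C"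
    using le by (subst (asm) nn_integral_eq_integral[OF i]) auto
qed

text \<open>The difference of window average and limit is bounded in L^2 and tends to 0 almost
  everywhere, so its pairing with \<open>g\<close> tends to 0. The real parameter is handled by
  testing all sequences that tend to infinity.\<close>

lemma window_average_tendsto_weakly:
  assumes [measurable]: "g \<in> borel_measurable M" and g2: "integrable M (\<lambda>x. (g x)\<^sup>2)"
  shows "((\<lambda>T. \<integral>x. g x * window_average T f x \<partial>M) \<longlongrightarrow> (\<integral>x. g x * flow_limit x \<partial>M)) at_top"
proof (rule tendsto_at_topI_sequentially)
  fix X :: "nat \<Rightarrow> real" assume X: "filterlim X at_top sequentially"
  let ?C = "\<integral>x. (f x)\<^sup>2 \<partial>M"
  \<comment> \<open>The L^2 bound requires a positive window length for every index; eventually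
    \<open>?Y\<close> is \<open>X\<close>.\<close>
  let ?Y = "\<lambda>n. max 1 (X n)"
  let ?h = "\<lambda>n x. window_average (?Y n) f x - flow_limit x"
  have wi: "integrable M (\<lambda>x. (window_average (?Y n) f x)\<^sup>2)"
    "(\<integral>x. (window_average (?Y n) f x)\<^sup>2 \<partial>M) \<le> ?C" for n
    using window_average_square[of "?Y n"] by auto
  have ev: "\<forall>\<^sub>F n in sequentially. ?Y n = X n"
    using filterlim_at_top[THEN iffD1, OF X, rule_format, of 1] by (auto elim: eventually_mono)
  have Y: "filterlim ?Y at_top sequentially"
    using filterlim_cong[OF refl refl ev] X by blast
  \<comment> \<open>This inequality is the source of the constant 4 below: both squares on the right
    have integral at most \<open>?C\<close>.\<close>
  have le: "(?h n x)\<^sup>2 \<le> 2 * (window_average (?Y n) f x)\<^sup>2 + 2 * (flow_limit x)\<^sup>2" for n x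
    using sum_squares_bound[of "window_average (?Y n) f x" "- flow_limit x"] by (simp add: power2_diff)
  have i2: "integrable M (\<lambda>x. 2 * (window_average (?Y n) f x)\<^sup>2 + 2 * (flow_limit x)\<^sup>2)" for n
    using wi flow_limit_square by simp
  have h2: "integrable M (\<lambda>x. (?h n x)\<^sup>2)" for n
    by (rule Bochner_Integration.integrable_bound[OF i2[of n]]) (use le in auto)
  have "(\<lambda>n. \<integral>x. g x * ?h n x \<partial>M) \<longlonglongrightarrow> 0"
  proof (rule square_bounded_tendsto_weakly[where C="4 * ?C"])
    fix n
    have "(\<integral>x. (?h n x)\<^sup>2 \<partial>M) \<le> (\<integral>x. 2 * (window_average (?Y n) f x)\<^sup>2 + 2 * (flow_limit x)\<^sup>2 \<partial>M)"
      by (intro integral_mono h2 i2 le)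
    also have "\<dots> = 2 * (\<integral>x. (window_average (?Y n) f x)\<^sup>2 \<partial>M) + 2 * (\<integral>x. (flow_limit x)\<^sup>2 \<partial>M)"
      using wi flow_limit_square by simp
    also have "\<dots> \<le> 4 * ?C" using wi(2)[of n] flow_limit_square(2) by simp
    finally show "(\<integral>x. (?h n x)\<^sup>2 \<partial>M) \<le> 4 * ?C" .
  next
    show "AE x in M. (\<lambda>n. ?h n x) \<longlonglongrightarrow> 0"
      using window_average_AE_tendsto
    proof eventually_elim
      case (elim x)
      show ?case using filterlim_compose[OF elim Y] by (rule LIM_zero)
    qed
  qed (use g2 h2 in auto)
  moreover have "(\<integral>x. g x * ?h n x \<partial>M) = (\<integral>x. g x * window_average (?Y n) f x \<partial>M) - (\<integral>x. g x * flow_limit x \<partial>M)" for n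
    unfolding right_diff_distrib
    by (intro Bochner_Integration.integral_diff integrable_mult_of_square_integrable g2 wi flow_limit_square) auto
  ultimately have "(\<lambda>n. (\<integral>x. g x * window_average (?Y n) f x \<partial>M)) \<longlonglongrightarrow> (\<integral>x. g x * flow_limit x \<partial>M)"
    by (simp add: LIM_zero_iff)
  then show "(\<lambda>n. (\<integral>x. g x * window_average (X n) f x \<partial>M)) \<longlonglongrightarrow> (\<integral>x. g x * flow_limit x \<partial>M)"
    by (rule Lim_transform_eventually) (use ev in \<open>auto elim: eventually_mono\<close>)
qed

text \<open>Starting the window at time \<open>s\<close> instead of 0 changes the integral by a
  bounded piece at the front, which disappears in the average.\<close>

lemma flow_limit_invariant:
  assumes s: "s \<ge> 0"
  shows "AE x in M. flow_limit (\<phi> s x) = flow_limit x"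
  using window_average_AE_tendsto orbit_integrable_AE[OF square_integrable_integrable]
proof eventually_elim
  case (elim x)
  have int: "\<And>n. set_integrable lborel {0..real n} (\<lambda>t. f (\<phi> t x))" using elim(2) by blast
  let ?I = "\<lambda>T. integral {0..T} (\<lambda>t. f (\<phi> t x))"
  have w: "window_average T f x = ?I T / T" for T
    unfolding window_average_def
    using set_borel_integral_eq_integral(2)[OF orbit_integrable_upto[OF int]] by simp
  have inv: "((\<lambda>T::real. c / T) \<longlongrightarrow> 0) at_top" for c
    by (rule tendsto_divide_0[OF tendsto_const filterlim_at_top_imp_at_infinity[OF filterlim_ident]])
  have shift: "filterlim (\<lambda>T. s + T) at_top at_top"
    by (rule filterlim_tendsto_add_at_top[OF tendsto_const filterlim_ident])
  \<comment> \<open>The factor 1 + s / T converts division by s + T into division by T, and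
    \<open>?I s\<close> is the part of the orbit before time \<open>s\<close>.\<close>
  have "((\<lambda>T. window_average (s + T) f x * (1 + s / T) - ?I s / T) \<longlongrightarrow> flow_limit x * (1 + 0) - 0) at_top"
    by (intro tendsto_intros inv filterlim_compose[OF elim(1) shift])
  moreover have "\<forall>\<^sub>F T in at_top. window_average (s + T) f x * (1 + s / T) - ?I s / T = window_average T f (\<phi> s x)"
  proof (rule eventually_at_top_linorderI[of 1])
    fix T :: real assume T: "1 \<le> T"
    then have "1 + s / T = (s + T) / T" by (simp add: field_simps)
    moreover have "s + T \<noteq> 0" using s T by linarith
    ultimately show "window_average (s + T) f x * (1 + s / T) - ?I s / T = window_average T f (\<phi> s x)"
      using orbit_integral_shift[OF int s, of T] T
      unfolding w by (simp add: window_average_def diff_divide_distrib)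
  qed
  ultimately have "((\<lambda>T. window_average T f (\<phi> s x)) \<longlongrightarrow> flow_limit x) at_top"
    using Lim_transform_eventually by fastforce
  then show ?case by (rule flow_limit_tendsto)
qed

lemma flow_limit_inner: "(\<integral>x. f x * flow_limit x \<partial>M) = (\<integral>x. (flow_limit x)\<^sup>2 \<partial>M)"
proof -
  have *: "(\<integral>x. flow_limit x * f (\<phi> t x) \<partial>M) = (\<integral>x. f x * flow_limit x \<partial>M)" if "t \<ge> 0" for t
  proof -
    have "(\<integral>x. flow_limit x * f (\<phi> t x) \<partial>M) = (\<integral>x. flow_limit (\<phi> t x) * f (\<phi> t x) \<partial>M)"
      by (rule integral_cong_AE) (use flow_limit_invariant[OF that] in \<open>auto elim: eventually_mono\<close>)
    also have "\<dots> = (\<integral>x. flow_limit x * f x \<partial>M)"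
      using one.T_integral[of "\<lambda>x. flow_limit x * f x" t] by simp
    finally show ?thesis by (simp add: mult.commute)
  qed
  have eq: "(\<integral>x. flow_limit x * window_average T f x \<partial>M) = (\<integral>x. f x * flow_limit x \<partial>M)" if "T > 0" for T
  proof -
    have "(LINT t:{0..T}|lborel. (\<integral>x. flow_limit x * f (\<phi> t x) \<partial>M)) = (LINT t:{0..T}|lborel. (\<integral>x. f x * flow_limit x \<partial>M))"
      by (rule set_lebesgue_integral_cong) (use * in auto)
    then show ?thesis
      using that unfolding window_average_inner[OF flow_limit_measurable flow_limit_square(1)]
      by (simp add: set_lebesgue_integral_def)
  qed
  have "((\<lambda>T::real. \<integral>x. f x * flow_limit x \<partial>M) \<longlongrightarrow> (\<integral>x. flow_limit x * flow_limit x \<partial>M)) at_top"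
    using window_average_tendsto_weakly[OF flow_limit_measurable flow_limit_square(1)]
    by (rule Lim_transform_eventually) (intro eventually_at_top_linorderI[of 1], simp add: eq)
  then show ?thesis
    using tendsto_unique[OF _ _ tendsto_const] by (simp add: tendsto_const_iff power2_eq_square)
qed

theorem correlation_time_average:
  "((\<lambda>T. (LINT t:{0..T}|lborel. (\<integral>x. f x * f (\<phi> t x) \<partial>M)) / T) \<longlongrightarrow> (\<integral>x. (flow_limit x)\<^sup>2 \<partial>M)) at_top"
  using window_average_tendsto_weakly[OF fm f2] unfolding window_average_inner[OF fm f2] flow_limit_inner .

lemmas correlation_integrable = flow_integrable_time[OF orbit_product_fubini_premises[OF fm f2]]

end

end

section \<open>The top power under congruence, and change of variables\<close>

text \<open>The congruence rule of the Pfaffian. Expanding the entries gives a sum over all maps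
  \<open>f\<close> of the index set into itself. For fixed \<open>f\<close>, the signed sum over
  permutations is the determinant of the rows of \<open>B\<close> selected by \<open>f\<close>: it
  vanishes if a row repeats, and otherwise is the sign of \<open>f\<close> times
  \<open>det B\<close>.\<close>

lemma top_power_congruence:
  fixes A B :: "real ^ ('r::finite + 'r) ^ ('r + 'r)"
  shows "top_power (transpose B ** A ** B) = det B * top_power A"
proof -
  let ?P = "{p. p permutes (UNIV :: ('r + 'r) set)}"
  let ?w = "\<lambda>f. \<Prod>i\<in>(UNIV :: 'r set). A $ f (Inl i) $ f (Inr i)"
  let ?b = "\<lambda>f p. \<Prod>j\<in>(UNIV :: ('r + 'r) set). B $ f j $ p j"
  have entry: "(transpose B ** A ** B) $ a $ b = (\<Sum>kl\<in>UNIV. A $ fst kl $ snd kl * (B $ fst kl $ a * B $ snd kl $ b))" for a b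
  proof -
    have "(transpose B ** A ** B) $ a $ b = (\<Sum>l\<in>UNIV. \<Sum>k\<in>UNIV. A $ k $ l * (B $ k $ a * B $ l $ b))"
      unfolding matrix_matrix_mult_def transpose_def vec_lambda_beta sum_distrib_right
      by (intro sum.cong refl) (simp only: mult_ac)
    also have "\<dots> = (\<Sum>k\<in>UNIV. \<Sum>l\<in>UNIV. A $ k $ l * (B $ k $ a * B $ l $ b))" by (rule sum.swap)
    finally show ?thesis by (simp add: sum.cartesian_product split_beta)
  qed
  have "(\<Prod>i\<in>UNIV. (transpose B ** A ** B) $ p (Inl i) $ p (Inr i)) = (\<Sum>f\<in>UNIV. ?w f * ?b f p)" for p :: "'r + 'r \<Rightarrow> 'r + 'r"
  proof -
    let ?h = "\<lambda>g :: 'r \<Rightarrow> ('r + 'r) \<times> ('r + 'r). \<Prod>i\<in>UNIV. A $ fst (g i) $ snd (g i) * (B $ fst (g i) $ p (Inl i) * B $ snd (g i) $ p (Inr i))"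
    have "(\<Prod>i\<in>UNIV. (transpose B ** A ** B) $ p (Inl i) $ p (Inr i)) = (\<Sum>g\<in>UNIV. ?h g)"
      unfolding entry by (subst prod_sum_PiE) (simp_all add: PiE_UNIV_domain)
    \<comment> \<open>A choice of a pair of indices for each \<open>i\<close> is the same as one map
      on the disjoint sum: the first components give its values on \<open>Inl\<close>, the second
      ones those on \<open>Inr\<close>.\<close>
    also have "\<dots> = (\<Sum>f\<in>UNIV. ?h (\<lambda>i. (f (Inl i), f (Inr i))))"
    proof (rule sum.reindex_bij_betw[symmetric])
      show "bij_betw (\<lambda>(f :: 'r + 'r \<Rightarrow> 'r + 'r) i. (f (Inl i), f (Inr i))) UNIV UNIV"
        by (rule bij_betw_byWitness[where f' = "\<lambda>g. case_sum (fst \<circ> g) (snd \<circ> g)"]) (auto split: sum.split simp: fun_eq_iff)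
    qed
    also have "\<dots> = (\<Sum>f\<in>UNIV. ?w f * ?b f p)"
    proof (rule sum.cong[OF refl])
      fix f :: "'r + 'r \<Rightarrow> 'r + 'r"
      have "?b f p = (\<Prod>i\<in>UNIV. B $ f (Inl i) $ p (Inl i)) * (\<Prod>i\<in>UNIV. B $ f (Inr i) $ p (Inr i))"
        by (simp add: UNIV_Plus_UNIV[symmetric] prod.Plus del: UNIV_Plus_UNIV)
      then show "?h (\<lambda>i. (f (Inl i), f (Inr i))) = ?w f * ?b f p" by (simp add: prod.distrib)
    qed
    finally show ?thesis .
  qed
  then have "(\<Sum>p\<in>?P. of_int (sign p) * (\<Prod>i\<in>UNIV. (transpose B ** A ** B) $ p (Inl i) $ p (Inr i)))
      = (\<Sum>p\<in>?P. \<Sum>f\<in>UNIV. ?w f * (of_int (sign p) * ?b f p))"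
    by (simp add: sum_distrib_left mult.left_commute)
  also have "\<dots> = (\<Sum>f\<in>UNIV. ?w f * (\<Sum>p\<in>?P. of_int (sign p) * ?b f p))"
    by (subst sum.swap) (simp add: sum_distrib_left)
  also have "\<dots> = (\<Sum>f\<in>UNIV. ?w f * det (\<chi> j. B $ f j))" by (simp add: det_def)
  also have "\<dots> = (\<Sum>f\<in>?P. ?w f * det (\<chi> j. B $ f j))"
  proof (rule sum.mono_neutral_right)
    show "\<forall>f\<in>UNIV - ?P. ?w f * det (\<chi> j. B $ f j) = 0"
    proof
      fix f :: "'r + 'r \<Rightarrow> 'r + 'r" assume "f \<in> UNIV - ?P"
      then have "\<not> inj f"
        using bij_imp_permutes[of f UNIV] finite_UNIV_inj_surj[of f] by (auto simp: bij_def)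
      then obtain i j where "i \<noteq> j" "f i = f j" by (auto simp: inj_def)
      then have "det (\<chi> j. B $ f j) = 0" by (intro det_identical_rows[of i j]) (auto simp: row_def)
      then show "?w f * det (\<chi> j. B $ f j) = 0" by simp
    qed
  qed auto
  also have "\<dots> = (\<Sum>f\<in>?P. det B * (of_int (sign f) * ?w f))"
    by (intro sum.cong refl) (simp add: det_permute_rows)
  finally show ?thesis by (simp add: top_power_def sum_distrib_left[symmetric])
qed

text \<open>The library proves the change of variables formula for well-ordered index types only. This copy
  of a finite type carries such an order.\<close>

typedef 'a ordered_index = "UNIV :: 'a set" by simp

lemma bij_Rep_ordered_index: "bij Rep_ordered_index"
  by (rule bij_betw_byWitness[where f' = Abs_ordered_index])
     (auto simp: Abs_ordered_index_inverse Rep_ordered_index_inverse)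

instance ordered_index :: (finite) finite
proof
  show "finite (UNIV :: 'a ordered_index set)"
    by (rule iffD2[OF bij_betw_finite[OF bij_Rep_ordered_index] finite])
qed

definition index_rank :: "'a::finite ordered_index \<Rightarrow> nat"
  where "index_rank = (SOME f. inj f)"

lemma inj_index_rank: "inj index_rank"
  unfolding index_rank_def using finite_imp_inj_to_nat_seg[OF finite, of "UNIV :: 'a ordered_index set"]
  by (intro someI_ex[of inj]) blast

instantiation ordered_index :: (finite) wellorder
begin

definition "x \<le> y \<longleftrightarrow> index_rank x \<le> index_rank y"
definition "x < y \<longleftrightarrow> index_rank x < index_rank y"

instance
proof
  fix x y z :: "'a ordered_index"
  show "(x < y) = (x \<le> y \<and> \<not> y \<le> x)"
    unfolding less_eq_ordered_index_def less_ordered_index_def by linarith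
  show "x \<le> x" unfolding less_eq_ordered_index_def by (rule order_refl)
  show "x \<le> y \<Longrightarrow> y \<le> z \<Longrightarrow> x \<le> z" unfolding less_eq_ordered_index_def by (rule order_trans)
  show "x \<le> y \<Longrightarrow> y \<le> x \<Longrightarrow> x = y"
    unfolding less_eq_ordered_index_def by (intro injD[OF inj_index_rank] order_antisym)
  show "x \<le> y \<or> y \<le> x" unfolding less_eq_ordered_index_def by (rule linear)
next
  fix P :: "'a ordered_index \<Rightarrow> bool" and a :: "'a ordered_index"
  assume "\<And>x. (\<And>y. y < x \<Longrightarrow> P y) \<Longrightarrow> P x"
  then show "P a"
    unfolding less_ordered_index_def by (rule measure_induct_rule)
qed

end

definition reindex :: "'b ^ 'n::finite \<Rightarrow> 'b ^ 'n ordered_index"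
  where "reindex x = (\<chi> i. x $ Rep_ordered_index i)"

definition unindex :: "'b ^ 'n::finite ordered_index \<Rightarrow> 'b ^ 'n"
  where "unindex x = (\<chi> i. x $ Abs_ordered_index i)"

lemma unindex_reindex [simp]: "unindex (reindex x) = x"
  by (simp add: vec_eq_iff reindex_def unindex_def Abs_ordered_index_inverse)

lemma reindex_unindex [simp]: "reindex (unindex x) = x"
  by (simp add: vec_eq_iff reindex_def unindex_def Rep_ordered_index_inverse)

lemma bounded_linear_reindex: "bounded_linear (reindex :: real ^ 'n::finite \<Rightarrow> _)"
  by (intro linear_conv_bounded_linear[THEN iffD1] linearI) (simp_all add: reindex_def vec_eq_iff)

lemma bounded_linear_unindex: "bounded_linear (unindex :: _ \<Rightarrow> real ^ 'n::finite)"
  by (intro linear_conv_bounded_linear[THEN iffD1] linearI) (simp_all add: unindex_def vec_eq_iff)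

text \<open>Conjugation by the relabelling is a bijection between the permutations of the two index
  types that keeps signs.\<close>

lemma det_reindex:
  fixes A :: "real ^ 'n::finite ^ 'n"
  shows "det (\<chi> i j. A $ Rep_ordered_index i $ Rep_ordered_index j) = det A"
proof -
  let ?R = "Rep_ordered_index :: 'n ordered_index \<Rightarrow> 'n"
  let ?m = "map_permutation UNIV ?R"
  have inj: "inj ?R" using bij_Rep_ordered_index by (rule bij_is_inj)
  have bij: "bij_betw ?m {p. p permutes UNIV} {p. p permutes UNIV}"
  proof (rule bij_betw_byWitness[where f' = "map_permutation UNIV Abs_ordered_index"])
    have bij': "bij (Abs_ordered_index :: 'n \<Rightarrow> _)"
      by (rule bij_betw_byWitness[where f' = Rep_ordered_index])
         (auto simp: Abs_ordered_index_inverse Rep_ordered_index_inverse)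
    show "\<forall>p\<in>{p. p permutes UNIV}. map_permutation UNIV Abs_ordered_index (?m p) = p"
      by (auto intro!: map_permutation_compose_inv[OF bij_Rep_ordered_index] simp: Rep_ordered_index_inverse)
    show "\<forall>p\<in>{p. p permutes UNIV}. ?m (map_permutation UNIV Abs_ordered_index p) = p"
      by (auto intro!: map_permutation_compose_inv[OF bij'] simp: Abs_ordered_index_inverse)
    show "?m ` {p. p permutes UNIV} \<subseteq> {p. p permutes UNIV}"
      using map_permutation_permutes[OF bij_Rep_ordered_index] by blast
    show "map_permutation UNIV Abs_ordered_index ` {p. p permutes UNIV} \<subseteq> {p :: 'n ordered_index \<Rightarrow> _. p permutes UNIV}"
      using map_permutation_permutes[OF bij'] by blast
  qed
  have "det A = (\<Sum>p | p permutes UNIV. of_int (sign (?m p)) * (\<Prod>i\<in>UNIV. A $ i $ ?m p i))"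
    unfolding det_def by (rule sum.reindex_bij_betw[OF bij, symmetric])
  also have "\<dots> = (\<Sum>p | p permutes UNIV. of_int (sign p) * (\<Prod>i\<in>UNIV. A $ ?R i $ ?R (p i)))"
  proof (rule sum.cong[OF refl])
    fix p :: "'n ordered_index \<Rightarrow> 'n ordered_index" assume p: "p \<in> {p. p permutes UNIV}"
    have "(\<Prod>i\<in>UNIV. A $ i $ ?m p i) = (\<Prod>i\<in>UNIV. A $ ?R i $ ?m p (?R i))"
      by (rule prod.reindex_bij_betw[OF bij_Rep_ordered_index, symmetric])
    then show "of_int (sign (?m p)) * (\<Prod>i\<in>UNIV. A $ i $ ?m p i) = of_int (sign p) * (\<Prod>i\<in>UNIV. A $ ?R i $ ?R (p i))"
      using p by (simp add: map_permutation_apply[OF inj] sign_map_permutation[OF inj])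
  qed
  finally show ?thesis by (simp add: det_def)
qed

lemma all_reindex: "(\<forall>i. P i) \<longleftrightarrow> (\<forall>i. P (Rep_ordered_index i))"
  by (auto intro: Rep_ordered_index_induct[OF UNIV_I])

lemma Basis_cart_eq: "(Basis :: (real ^ 'n) set) = range (\<lambda>i. axis i 1)"
  by (auto simp: Basis_vec_def)

lemma sum_Basis_cart: "(\<Sum>b\<in>Basis. f b) = (\<Sum>i\<in>UNIV. f (axis i (1::real)))"
  unfolding Basis_cart_eq by (subst sum.reindex) (auto simp: inj_on_def axis_eq_axis)

lemma prod_Basis_cart: "(\<Prod>b\<in>Basis. x \<bullet> b) = (\<Prod>i\<in>UNIV. x $ i)" for x :: "real ^ 'n"
proof -
  have *: "inj_on (\<lambda>i. axis i (1::real)) (UNIV :: 'n set)" by (auto simp: inj_on_def axis_eq_axis)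
  have **: "(Basis :: (real ^ 'n) set) = range (\<lambda>i. axis i 1)" by (auto simp: Basis_vec_def)
  show ?thesis unfolding ** prod.reindex[OF *] by (simp add: inner_axis)
qed

text \<open>Relabelling coordinates maps boxes to boxes with the same product of side lengths, and
  boxes determine Lebesgue measure.\<close>

lemma lborel_unindex: "distr lborel lborel (unindex :: _ \<Rightarrow> real ^ 'n::finite) = lborel"
proof (rule lborel_eqI[symmetric])
  fix l u :: "real ^ 'n"
  assume *: "\<And>b. b \<in> Basis \<Longrightarrow> l \<bullet> b \<le> u \<bullet> b"
  have le: "l $ i \<le> u $ i" for i using *[of "axis i 1"] by (auto simp: Basis_vec_def inner_axis)
  have [measurable]: "(unindex :: _ \<Rightarrow> real ^ 'n) \<in> borel_measurable borel"
    by (intro borel_measurable_continuous_onI linear_continuous_on bounded_linear_unindex)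
  have "emeasure (distr lborel lborel unindex) (box l u) = emeasure lborel (unindex -` box l u)"
    by (subst emeasure_distr) auto
  also have "unindex -` box l u = box (reindex l) (reindex u)"
  proof -
    have "x \<in> unindex -` box l u \<longleftrightarrow> x \<in> box (reindex l) (reindex u)" for x :: "real ^ 'n ordered_index"
      using all_reindex[of "\<lambda>i. l $ i < x $ Abs_ordered_index i \<and> x $ Abs_ordered_index i < u $ i"]
      by (simp add: mem_box_cart reindex_def unindex_def Rep_ordered_index_inverse)
    then show ?thesis by blast
  qed
  also have "emeasure lborel (box (reindex l) (reindex u)) = (\<Prod>i\<in>UNIV. (reindex u - reindex l) $ i)"
    unfolding prod_Basis_cart[symmetric]
    by (rule emeasure_lborel_box) (use le in \<open>auto simp: Basis_vec_def inner_axis reindex_def\<close>)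
  also have "(\<Prod>i\<in>UNIV. (reindex u - reindex l) $ i) = (\<Prod>i\<in>UNIV. (u - l) $ i)"
    using prod.reindex_bij_betw[OF bij_Rep_ordered_index, of "\<lambda>i. (u - l) $ i"] by (simp add: reindex_def)
  also have "\<dots> = (\<Prod>b\<in>Basis. (u - l) \<bullet> b)" by (rule prod_Basis_cart[symmetric])
  finally show "emeasure (distr lborel lborel unindex) (box l u) = ennreal (\<Prod>b\<in>Basis. (u - l) \<bullet> b)" .
qed simp

lemma set_integrable_compact:
  fixes f :: "'a::euclidean_space \<Rightarrow> real"
  assumes "compact S" "continuous_on S f"
  shows "set_integrable lborel S f"
  using borel_integrable_compact[OF assms] unfolding set_integrable_def
  by (simp add: indicator_scaleR_eq_if)

lemma change_of_variables_ordered: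
  fixes g :: "real ^ 'n::{finite, wellorder} \<Rightarrow> real ^ 'n::_" and h :: "real ^ 'n::_ \<Rightarrow> real"
  assumes S: "compact S" and der: "\<And>x. x \<in> S \<Longrightarrow> (g has_derivative g' x) (at x)"
    and inj: "inj_on g S" and h: "continuous_on (g ` S) h"
    and det: "continuous_on S (\<lambda>x. det (matrix (g' x)))"
  shows "(LINT x:g ` S|lborel. h x) = (LINT x:S|lborel. \<bar>det (matrix (g' x))\<bar> * h (g x))"
proof -
  \<comment> \<open>The formula applied below is about vector-valued integrands, so the scalar one
    travels as a vector of dimension 1.\<close>
  let ?h = "\<lambda>x. vec (h x) :: real ^ 1" and ?d = "\<lambda>x. \<bar>det (matrix (g' x))\<bar>"
  have g: "continuous_on S g"
    using der by (meson continuous_at_imp_continuous_on has_derivative_continuous)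
  have i1: "set_integrable lborel (g ` S) h"
    by (intro set_integrable_compact compact_continuous_image g S h)
  have i2: "set_integrable lborel S (\<lambda>x. ?d x * h (g x))"
    by (intro set_integrable_compact S continuous_intros det continuous_on_compose2[OF h g]) auto
  have v: "((\<lambda>x. vec (f x) :: real ^ 1) has_integral vec b) T" if "(f has_integral b) T" for f b and T :: "(real ^ 'n::_) set"
    using that by (subst has_integral_componentwise_iff) (auto simp: Basis_vec_def inner_axis)
  have e: "c *\<^sub>R (vec x :: real ^ 1) = vec (c * x)" for c x by (simp add: vec_eq_iff)
  have a: "?h absolutely_integrable_on g ` S"
  proof (subst absolutely_integrable_on_iff_component)
    show "g ` S \<in> sets lebesgue"
      using compact_continuous_image[OF g S] by (auto intro: lmeasurable_compact fmeasurableD)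
    show "\<forall>i. (\<lambda>x. ?h x $ i) absolutely_integrable_on g ` S"
      using i1 integrable_completion[of "\<lambda>x. indicator (g ` S) x *\<^sub>R h x" lborel]
      by (simp add: set_integrable_def borel_measurable_integrable)
  qed
  have "integral S (\<lambda>x. ?d x *\<^sub>R ?h (g x)) = integral (g ` S) ?h"
    using has_absolute_integral_change_of_variables[OF _ has_derivative_at_withinI[OF der] inj, of ?h "integral (g ` S) ?h"] a S
    by (auto intro: lmeasurable_compact fmeasurableD)
  also have "integral S (\<lambda>x. ?d x *\<^sub>R ?h (g x)) = vec (integral S (\<lambda>x. ?d x * h (g x)))"
    using v[OF integrable_integral[OF set_borel_integral_eq_integral(1)[OF i2]]]
    by (intro integral_unique) (simp add: e)
  also have "integral (g ` S) ?h = vec (integral (g ` S) h)"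
    using v[OF integrable_integral[OF set_borel_integral_eq_integral(1)[OF i1]]]
    by (intro integral_unique) simp
  finally have "integral S (\<lambda>x. ?d x * h (g x)) = integral (g ` S) h" by (simp add: vec_eq_iff)
  then show ?thesis
    using set_borel_integral_eq_integral(2)[OF i1] set_borel_integral_eq_integral(2)[OF i2] by simp
qed

lemma matrix_reindex:
  fixes f :: "real ^ 'n::finite \<Rightarrow> real ^ 'n"
  shows "matrix (\<lambda>v. reindex (f (unindex v))) = (\<chi> i j. matrix f $ Rep_ordered_index i $ Rep_ordered_index j)"
proof -
  have u: "unindex (axis j 1) = (axis (Rep_ordered_index j) 1 :: real ^ 'n)" for j :: "'n ordered_index"
    by (auto simp: vec_eq_iff unindex_def axis_def Abs_ordered_index_inverse Rep_ordered_index_inverse)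
  show ?thesis by (simp add: matrix_def reindex_def u)
qed

text \<open>Conjugating \<open>g\<close> with the relabelling changes neither the integrals nor the
  Jacobian determinant, so the formula carries over from the ordered copy of the index type.\<close>

lemma change_of_variables_continuous:
  fixes g :: "real ^ 'n::finite \<Rightarrow> real ^ 'n" and h :: "real ^ 'n \<Rightarrow> real"
  assumes S: "compact S" and der: "\<And>x. x \<in> S \<Longrightarrow> (g has_derivative g' x) (at x)"
    and inj: "inj_on g S" and h: "continuous_on (g ` S) h"
    and det: "continuous_on S (\<lambda>x. det (matrix (g' x)))"
  shows "(LINT x:g ` S|lborel. h x) = (LINT x:S|lborel. \<bar>det (matrix (g' x))\<bar> * h (g x))"
proof -
  let ?u = "unindex :: _ \<Rightarrow> real ^ 'n" and ?r = "reindex :: real ^ 'n \<Rightarrow> _"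
  let ?G = "\<lambda>y. ?r (g (?u y))" and ?G' = "\<lambda>y v. ?r (g' (?u y) (?u v))"
  have g: "continuous_on S g"
    using der by (meson continuous_at_imp_continuous_on has_derivative_continuous)
  have cu: "continuous_on T ?u" for T by (intro linear_continuous_on bounded_linear_unindex)
  have cr: "continuous_on T ?r" for T by (intro linear_continuous_on bounded_linear_reindex)
  have [measurable]: "?u \<in> borel_measurable borel" by (intro borel_measurable_continuous_onI cu)
  have transfer: "(LINT x:T|lborel. f x) = (LINT y:?r ` T|lborel. f (?u y))" if "compact T" "continuous_on T f" for T and f :: "_ \<Rightarrow> real"
  proof -
    have "(\<lambda>x. indicator T x *\<^sub>R f x) \<in> borel_measurable lborel"
      using set_integrable_compact[OF that] unfolding set_integrable_def by blast
    then have "(LINT x:T|distr lborel lborel ?u. f x) = (LINT y|lborel. indicator T (?u y) *\<^sub>R f (?u y))"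
      unfolding set_lebesgue_integral_def by (subst integral_distr) auto
    moreover have "indicator T (?u y) = (indicator (?r ` T) y :: real)" for y
      by (auto simp: indicator_def image_iff intro: bexI[of _ "?u y"])
    ultimately show ?thesis unfolding lborel_unindex by (simp add: set_lebesgue_integral_def)
  qed
  have img: "?r ` g ` S = ?G ` ?r ` S" by (auto simp: image_image)
  have "(LINT x:g ` S|lborel. h x) = (LINT y:?G ` ?r ` S|lborel. h (?u y))"
    using transfer[OF compact_continuous_image[OF g S] h] unfolding img .
  also have "\<dots> = (LINT y:?r ` S|lborel. \<bar>det (matrix (?G' y))\<bar> * h (?u (?G y)))"
  proof (rule change_of_variables_ordered)
    show "compact (?r ` S)" by (intro compact_continuous_image cr S)
    show "(?G has_derivative ?G' y) (at y)" if "y \<in> ?r ` S" for y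
    proof -
      have "?u y \<in> S" using that by auto
      from der[OF this] have "((\<lambda>y. g (?u y)) has_derivative (\<lambda>v. g' (?u y) (?u v))) (at y)"
        by (rule has_derivative_compose[rotated]) (rule bounded_linear.has_derivative[OF bounded_linear_unindex has_derivative_ident])
      then show ?thesis by (rule bounded_linear.has_derivative[OF bounded_linear_reindex])
    qed
    show "inj_on ?G (?r ` S)"
      using inj by (auto simp: inj_on_def) (metis unindex_reindex)
    show "continuous_on (?G ` ?r ` S) (\<lambda>y. h (?u y))" by (rule continuous_on_compose2[OF h cu]) auto
    show "continuous_on (?r ` S) (\<lambda>y. det (matrix (?G' y)))"
      unfolding matrix_reindex det_reindex by (rule continuous_on_compose2[OF det cu]) auto
  qed
  also have "\<dots> = (LINT y:?r ` S|lborel. \<bar>det (matrix (g' (?u y)))\<bar> * h (g (?u y)))"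
    unfolding matrix_reindex det_reindex by simp
  also have "\<dots> = (LINT x:S|lborel. \<bar>det (matrix (g' x))\<bar> * h (g x))"
    by (intro transfer[symmetric] S continuous_on_mult continuous_on_rabs det continuous_on_compose2[OF h g] order_refl)
  finally show ?thesis .
qed

section \<open>Differentiation along Euler steps\<close>

text \<open>Level 1 of \<open>Ck_on\<close>. Continuity is asked for each fixed direction; expanding
  in a basis upgrades it to joint continuity in point and direction.\<close>

definition C1_on :: "'a::euclidean_space set \<Rightarrow> ('a \<Rightarrow> 'b::real_normed_vector) \<Rightarrow> bool"
  where "C1_on S f \<longleftrightarrow> (\<forall>x\<in>S. f differentiable (at x)) \<and>
    (\<forall>v. continuous_on S (\<lambda>x. frechet_derivative f (at x) v))"

lemma C1_onI:
  assumes "\<And>x. x \<in> S \<Longrightarrow> (f has_derivative f' x) (at x)" "\<And>v. continuous_on S (\<lambda>x. f' x v)"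
  shows "C1_on S f"
proof -
  have "frechet_derivative f (at x) = f' x" if "x \<in> S" for x
    using frechet_derivative_at[OF assms(1)[OF that]] by simp
  then have "continuous_on S (\<lambda>x. frechet_derivative f (at x) v)" for v
    using assms(2)[of v] by (simp cong: continuous_on_cong)
  then show ?thesis
    using assms(1) by (auto simp: C1_on_def differentiable_def)
qed

lemma C1_on_has_derivative:
  "C1_on S f \<Longrightarrow> x \<in> S \<Longrightarrow> (f has_derivative frechet_derivative f (at x)) (at x)"
  by (simp add: C1_on_def frechet_derivative_works[symmetric])

lemma C1_on_deriv_continuous: "C1_on S f \<Longrightarrow> continuous_on S (\<lambda>x. frechet_derivative f (at x) v)"
  by (simp add: C1_on_def)

lemma C1_on_continuous: "C1_on S f \<Longrightarrow> continuous_on S f"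
  by (meson C1_on_has_derivative continuous_at_imp_continuous_on has_derivative_continuous)

lemma C1_on_const: "C1_on S (\<lambda>_. c)" by (rule C1_onI[of _ _ "\<lambda>_ _. 0"]) auto

lemma C1_on_add:
  assumes f: "C1_on S f" and g: "C1_on S g" shows "C1_on S (\<lambda>x. f x + g x)"
  by (rule C1_onI, rule has_derivative_add[OF C1_on_has_derivative[OF f] C1_on_has_derivative[OF g]])
     (auto intro!: continuous_intros C1_on_deriv_continuous f g)

lemma C1_on_mult:
  fixes f g :: "'a::euclidean_space \<Rightarrow> real"
  assumes f: "C1_on S f" and g: "C1_on S g" shows "C1_on S (\<lambda>x. f x * g x)"
  by (rule C1_onI, rule has_derivative_mult[OF C1_on_has_derivative[OF f] C1_on_has_derivative[OF g]])
     (auto intro!: continuous_intros C1_on_deriv_continuous[OF f] C1_on_deriv_continuous[OF g] C1_on_continuous[OF f] C1_on_continuous[OF g])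

lemma C1_on_sum:
  assumes "\<And>i. i \<in> I \<Longrightarrow> C1_on S (f i)" shows "C1_on S (\<lambda>x. \<Sum>i\<in>I. f i x)"
  using assms by (induction I rule: infinite_finite_induct) (auto intro: C1_on_const C1_on_add)

lemma C1_on_prod:
  fixes f :: "'i \<Rightarrow> 'a::euclidean_space \<Rightarrow> real"
  assumes "\<And>i. i \<in> I \<Longrightarrow> C1_on S (f i)" shows "C1_on S (\<lambda>x. \<Prod>i\<in>I. f i x)"
  using assms by (induction I rule: infinite_finite_induct) (auto intro: C1_on_const C1_on_mult)

lemma C1_on_inverse:
  fixes f :: "'a::euclidean_space \<Rightarrow> real"
  assumes f: "C1_on S f" and nz: "\<And>x. x \<in> S \<Longrightarrow> f x \<noteq> 0" shows "C1_on S (\<lambda>x. inverse (f x))"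
  by (rule C1_onI, rule Deriv.has_derivative_inverse[OF nz C1_on_has_derivative[OF f]])
     (auto intro!: continuous_intros C1_on_deriv_continuous[OF f] C1_on_continuous[OF f] nz)

lemma C1_on_det:
  fixes A :: "'a::euclidean_space \<Rightarrow> real ^ 'n::finite ^ 'n"
  assumes "\<And>i j. C1_on S (\<lambda>x. A x $ i $ j)" shows "C1_on S (\<lambda>x. det (A x))"
  unfolding det_def by (intro C1_on_sum C1_on_mult C1_on_prod C1_on_const assms)

lemma C1_on_vec:
  fixes f :: "'a::euclidean_space \<Rightarrow> real ^ 'n::finite"
  assumes f: "\<And>i. C1_on S (\<lambda>x. f x $ i)" shows "C1_on S f"
proof (rule C1_onI)
  fix x assume "x \<in> S"
  have "((\<lambda>x. \<chi> i. f x $ i) has_derivative (\<lambda>v. \<chi> i. frechet_derivative (\<lambda>x. f x $ i) (at x) v)) (at x)"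
    by (subst has_derivative_componentwise_within)
       (auto simp: Basis_vec_def inner_axis intro: C1_on_has_derivative[OF f \<open>x \<in> S\<close>, simplified])
  then show "(f has_derivative (\<lambda>v. \<chi> i. frechet_derivative (\<lambda>x. f x $ i) (at x) v)) (at x)" by simp
qed (auto intro!: continuous_on_vec_lambda C1_on_deriv_continuous f)

lemma C1_on_component:
  fixes f :: "'a::euclidean_space \<Rightarrow> 'b::real_normed_vector ^ 'n::finite"
  assumes f: "C1_on S f" shows "C1_on S (\<lambda>x. f x $ i)"
  by (rule C1_onI, rule bounded_linear.has_derivative[OF bounded_linear_vec_nth C1_on_has_derivative[OF f]])
     (auto intro!: continuous_intros C1_on_deriv_continuous f)

lemma smooth_on_C1: "smooth_on S f \<Longrightarrow> C1_on S f"
  unfolding smooth_on_def C1_on_def by (drule spec[of _ "Suc 0"]) simp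

lemma smooth_on_deriv: "smooth_on S f \<Longrightarrow> smooth_on S (\<lambda>x. frechet_derivative f (at x) v)"
  unfolding smooth_on_def by (metis Ck_on.simps(2))

lemma frechet_expand:
  fixes f :: "'a::euclidean_space \<Rightarrow> 'b::real_normed_vector"
  assumes "C1_on S f" "x \<in> S"
  shows "frechet_derivative f (at x) v = (\<Sum>b\<in>Basis. (v \<bullet> b) *\<^sub>R frechet_derivative f (at x) b)"
proof -
  interpret bounded_linear "frechet_derivative f (at x)"
    using C1_on_has_derivative[OF assms] by (rule has_derivative_bounded_linear)
  have "frechet_derivative f (at x) v = frechet_derivative f (at x) (\<Sum>b\<in>Basis. (v \<bullet> b) *\<^sub>R b)"
    by (simp add: euclidean_representation)
  then show ?thesis by (simp add: sum scaleR)
qed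

lemma C1_on_deriv_jointly_continuous:
  assumes f: "C1_on S f" and g: "continuous_on T g" and v: "continuous_on T v" and sub: "g ` T \<subseteq> S"
  shows "continuous_on T (\<lambda>t. frechet_derivative f (at (g t)) (v t))"
proof -
  have "continuous_on T (\<lambda>t. \<Sum>b\<in>Basis. (v t \<bullet> b) *\<^sub>R frechet_derivative f (at (g t)) b)"
    by (intro continuous_intros v continuous_on_compose2[OF C1_on_deriv_continuous[OF f] g sub])
  then show ?thesis
    by (rule continuous_on_eq) (use sub in \<open>auto intro: frechet_expand[OF f, symmetric]\<close>)
qed

lemma C1_on_deriv_bound:
  fixes f :: "'a::euclidean_space \<Rightarrow> 'b::real_normed_vector"
  assumes f: "C1_on S f" and K: "compact K" "K \<subseteq> S"
  obtains L where "L > 0" "\<And>x v. x \<in> K \<Longrightarrow> norm (frechet_derivative f (at x) v) \<le> L * norm v"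
proof -
  have "\<forall>b. \<exists>c. \<forall>x\<in>K. norm (frechet_derivative f (at x) b) \<le> c"
    using compact_imp_bounded[OF compact_continuous_image[OF continuous_on_subset[OF C1_on_deriv_continuous[OF f] K(2)] K(1)]]
    by (auto simp: bounded_iff)
  then obtain c where c: "\<And>x b. x \<in> K \<Longrightarrow> norm (frechet_derivative f (at x) b) \<le> c b" by metis
  let ?L = "\<Sum>b\<in>(Basis :: 'a set). \<bar>c b\<bar>"
  show thesis
  proof
    fix x v assume x: "x \<in> K"
    have "norm (frechet_derivative f (at x) v) \<le> (\<Sum>b\<in>Basis. norm ((v \<bullet> b) *\<^sub>R frechet_derivative f (at x) b))"
      by (subst frechet_expand[OF f subsetD[OF K(2) x]]) (rule norm_sum)
    also have "\<dots> \<le> (\<Sum>b\<in>Basis. norm v * \<bar>c b\<bar>)"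
    proof (rule sum_mono)
      fix b :: 'a assume "b \<in> Basis"
      then have "\<bar>v \<bullet> b\<bar> \<le> norm v" by (rule Basis_le_norm)
      moreover have "norm (frechet_derivative f (at x) b) \<le> \<bar>c b\<bar>" using c[OF x, of b] by linarith
      ultimately show "norm ((v \<bullet> b) *\<^sub>R frechet_derivative f (at x) b) \<le> norm v * \<bar>c b\<bar>"
        by (auto intro: mult_mono)
    qed
    also have "\<dots> = ?L * norm v" by (simp add: sum_distrib_left mult.commute)
    also have "\<dots> \<le> (?L + 1) * norm v" by (intro mult_right_mono) auto
    finally show "norm (frechet_derivative f (at x) v) \<le> (?L + 1) * norm v" .
  qed (auto intro: add_nonneg_pos sum_nonneg)
qed

section \<open>Symmetry of second derivatives\<close>

lemma has_real_derivative_along_line: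
  fixes f :: "'a::real_normed_vector \<Rightarrow> real"
  assumes f: "(f has_derivative f') (at (x + a *\<^sub>R v))"
  shows "((\<lambda>a. f (x + a *\<^sub>R v)) has_real_derivative f' v) (at a)"
proof -
  have "((\<lambda>a. f (x + a *\<^sub>R v)) has_derivative (\<lambda>h. f' (h *\<^sub>R v))) (at a)"
    by (rule has_derivative_compose[where g=f and f="\<lambda>a. x + a *\<^sub>R v", OF _ f]) (auto intro!: derivative_eq_intros)
  then show ?thesis
    using linear_cmul[OF has_derivative_linear[OF f]]
    by (simp add: has_field_derivative_def mult.commute[of _ "f' _"] fun_eq_iff)
qed

text \<open>The mean value theorem twice: for the increment of \<open>f\<close> in direction
  \<open>w\<close> as a function of the step along \<open>v\<close>, then for the derivative along
  \<open>v\<close> as a function of the step along \<open>w\<close>.\<close>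

lemma second_difference_mean_value:
  fixes f :: "'a::real_normed_vector \<Rightarrow> real"
  assumes s: "s > 0" and S: "\<And>a b. 0 \<le> a \<Longrightarrow> a \<le> s \<Longrightarrow> 0 \<le> b \<Longrightarrow> b \<le> s \<Longrightarrow> x + a *\<^sub>R v + b *\<^sub>R w \<in> S"
    and f: "\<And>y. y \<in> S \<Longrightarrow> (f has_derivative f' y) (at y)"
    and g: "\<And>y. y \<in> S \<Longrightarrow> ((\<lambda>z. f' z v) has_derivative f'' y) (at y)"
  obtains a b where "0 < a" "a < s" "0 < b" "b < s"
    "f (x + s *\<^sub>R v + s *\<^sub>R w) - f (x + s *\<^sub>R v) - f (x + s *\<^sub>R w) + f x = s\<^sup>2 * f'' (x + a *\<^sub>R v + b *\<^sub>R w) w"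
proof -
  have df: "((\<lambda>a. f (x + a *\<^sub>R v + b *\<^sub>R w)) has_real_derivative f' (x + a *\<^sub>R v + b *\<^sub>R w) v) (at a)"
    if "x + a *\<^sub>R v + b *\<^sub>R w \<in> S" for a b
    using has_real_derivative_along_line[of f "f' (x + a *\<^sub>R v + b *\<^sub>R w)" "x + b *\<^sub>R w" a v] f[OF that]
    by (simp add: add_ac)
  have dg: "((\<lambda>b. f' (x + a *\<^sub>R v + b *\<^sub>R w) v) has_real_derivative f'' (x + a *\<^sub>R v + b *\<^sub>R w) w) (at b)"
    if "x + a *\<^sub>R v + b *\<^sub>R w \<in> S" for a b by (rule has_real_derivative_along_line[OF g[OF that]])
  have "\<exists>a>0. a < s \<and> (f (x + s *\<^sub>R v + s *\<^sub>R w) - f (x + s *\<^sub>R v + 0 *\<^sub>R w)) - (f (x + 0 *\<^sub>R v + s *\<^sub>R w) - f (x + 0 *\<^sub>R v + 0 *\<^sub>R w))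
      = (s - 0) * (f' (x + a *\<^sub>R v + s *\<^sub>R w) v - f' (x + a *\<^sub>R v + 0 *\<^sub>R w) v)"
    using s by (intro MVT2 DERIV_diff df S) auto
  then obtain a where a: "0 < a" "a < s"
    "(f (x + s *\<^sub>R v + s *\<^sub>R w) - f (x + s *\<^sub>R v)) - (f (x + s *\<^sub>R w) - f x)
      = s * (f' (x + a *\<^sub>R v + s *\<^sub>R w) v - f' (x + a *\<^sub>R v + 0 *\<^sub>R w) v)" by auto
  have "\<exists>b>0. b < s \<and> f' (x + a *\<^sub>R v + s *\<^sub>R w) v - f' (x + a *\<^sub>R v + 0 *\<^sub>R w) v = (s - 0) * f'' (x + a *\<^sub>R v + b *\<^sub>R w) w"
    using s a by (intro MVT2 dg S) auto
  then obtain b where "0 < b" "b < s"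
    "f' (x + a *\<^sub>R v + s *\<^sub>R w) v - f' (x + a *\<^sub>R v + 0 *\<^sub>R w) v = s * f'' (x + a *\<^sub>R v + b *\<^sub>R w) w" by auto
  then show thesis using a by (intro that[of a b]) (auto simp: power2_eq_square)
qed

text \<open>The second difference is symmetric in \<open>v\<close> and \<open>w\<close>, so the two
  mixed derivatives agree at points arbitrarily close to \<open>x\<close>; continuity then rules out
  that they differ at \<open>x\<close>. Applied to the Hamiltonian in a chart.\<close>

lemma second_derivative_symmetric:
  fixes f :: "'a::euclidean_space \<Rightarrow> real"
  assumes S: "open S" "x \<in> S" and f: "\<And>y. y \<in> S \<Longrightarrow> (f has_derivative f' y) (at y)"
    and g: "\<And>v. C1_on S (\<lambda>y. f' y v)"
  shows "frechet_derivative (\<lambda>y. f' y v) (at x) w = frechet_derivative (\<lambda>y. f' y w) (at x) v" (is "?F v w x = ?F w v x")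
proof (rule ccontr)
  assume ne: "\<not> ?thesis"
  define e where "e = \<bar>?F v w x - ?F w v x\<bar> / 2"
  have e: "e > 0" using ne by (simp add: e_def)
  have near: "\<exists>d>0. \<forall>y. dist y x < d \<longrightarrow> y \<in> S \<and> \<bar>?F v w y - ?F v w x\<bar> < e" for v w
  proof -
    obtain d1 where "d1 > 0" "ball x d1 \<subseteq> S" using S openE by blast
    moreover obtain d2 where "d2 > 0" "\<And>y. y \<in> S \<Longrightarrow> dist y x < d2 \<Longrightarrow> dist (?F v w y) (?F v w x) < e"
      using C1_on_deriv_continuous[OF g] S(2) e unfolding continuous_on_iff by metis
    ultimately show ?thesis
      by (intro exI[of _ "min d1 d2"]) (auto simp: dist_real_def subset_iff dist_commute)
  qed
  obtain d1 d2 where d: "d1 > 0" "d2 > 0"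
    "\<And>y. dist y x < d1 \<Longrightarrow> y \<in> S \<and> \<bar>?F v w y - ?F v w x\<bar> < e"
    "\<And>y. dist y x < d2 \<Longrightarrow> y \<in> S \<and> \<bar>?F w v y - ?F w v x\<bar> < e"
    using near by metis
  \<comment> \<open>Small enough for the parallelogram with sides s v and s w to stay within both
    radii; the 1 covers the case that both vectors are 0.\<close>
  define s where "s = min d1 d2 / (norm v + norm w + 1)"
  have pos: "norm v + norm w + 1 > 0" by (simp add: add_nonneg_pos)
  have s: "s > 0" using d pos by (simp add: s_def)
  have close: "dist (x + a *\<^sub>R v + b *\<^sub>R w) x < min d1 d2" if "0 \<le> a" "a \<le> s" "0 \<le> b" "b \<le> s" for a b
  proof -
    have "dist (x + a *\<^sub>R v + b *\<^sub>R w) x \<le> a * norm v + b * norm w"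
      using norm_triangle_ineq[of "a *\<^sub>R v" "b *\<^sub>R w"] that by (simp add: dist_norm add.assoc)
    also have "\<dots> \<le> s * norm v + s * norm w" using that by (intro add_mono mult_right_mono) auto
    also have "\<dots> < s * (norm v + norm w + 1)" using s by (simp add: algebra_simps)
    also have "\<dots> = min d1 d2" using pos by (simp add: s_def)
    finally show ?thesis .
  qed
  have close': "dist (x + a *\<^sub>R w + b *\<^sub>R v) x < min d1 d2" if "0 \<le> a" "a \<le> s" "0 \<le> b" "b \<le> s" for a b
    using close[of b a] that by (simp add: add.assoc add.commute[of "a *\<^sub>R w"])
  obtain a b where ab: "0 < a" "a < s" "0 < b" "b < s"
    "f (x + s *\<^sub>R v + s *\<^sub>R w) - f (x + s *\<^sub>R v) - f (x + s *\<^sub>R w) + f x = s\<^sup>2 * ?F v w (x + a *\<^sub>R v + b *\<^sub>R w)"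
    using second_difference_mean_value[OF s _ f C1_on_has_derivative[OF g], of x v w] close d by (metis min_less_iff_conj)
  obtain a' b' where ab': "0 < a'" "a' < s" "0 < b'" "b' < s"
    "f (x + s *\<^sub>R w + s *\<^sub>R v) - f (x + s *\<^sub>R w) - f (x + s *\<^sub>R v) + f x = s\<^sup>2 * ?F w v (x + a' *\<^sub>R w + b' *\<^sub>R v)"
    using second_difference_mean_value[OF s _ f C1_on_has_derivative[OF g], of x w v] close' d by (metis min_less_iff_conj)
  have sw: "x + s *\<^sub>R w + s *\<^sub>R v = x + s *\<^sub>R v + s *\<^sub>R w" by (simp add: algebra_simps)
  have "s\<^sup>2 * ?F v w (x + a *\<^sub>R v + b *\<^sub>R w) = s\<^sup>2 * ?F w v (x + a' *\<^sub>R w + b' *\<^sub>R v)"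
    using ab(5) ab'(5) unfolding sw by linarith
  then have "?F v w (x + a *\<^sub>R v + b *\<^sub>R w) = ?F w v (x + a' *\<^sub>R w + b' *\<^sub>R v)" using s by simp
  moreover have "\<bar>?F v w (x + a *\<^sub>R v + b *\<^sub>R w) - ?F v w x\<bar> < e" using close[of a b] ab d by simp
  moreover have "\<bar>?F w v (x + a' *\<^sub>R w + b' *\<^sub>R v) - ?F w v x\<bar> < e" using close'[of a' b'] ab' d by simp
  ultimately have "\<bar>?F v w x - ?F w v x\<bar> < e + e" by linarith
  then show False by (simp add: e_def)
qed

text \<open>\<open>q h x = a x + h * b x + o(h)\<close> as \<open>h\<close> tends to \<open>0\<close>, uniformly for \<open>x \<in> D\<close>, with bounded
  \<open>a\<close> and \<open>b\<close>.\<close>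

definition expands_on :: "'a set \<Rightarrow> (real \<Rightarrow> 'a \<Rightarrow> real) \<Rightarrow> ('a \<Rightarrow> real) \<Rightarrow> ('a \<Rightarrow> real) \<Rightarrow> bool"
  where "expands_on D q a b \<longleftrightarrow> bounded (a ` D) \<and> bounded (b ` D) \<and>
    uniform_limit D (\<lambda>h x. (q h x - a x) / h) b (at 0)"

lemma expands_on_affine:
  "bounded (a ` D) \<Longrightarrow> bounded (b ` D) \<Longrightarrow> expands_on D (\<lambda>h x. a x + h * b x) a b"
  unfolding expands_on_def by (auto simp: uniform_limit_iff eventually_at intro!: exI[of _ 1])

lemma expands_on_uniform_limit:
  assumes "expands_on D q a b" shows "uniform_limit D q a (at 0)"
proof -
  have "uniform_limit D (\<lambda>h x. h) (\<lambda>x. 0 :: real) (at 0)"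
    by (auto simp: uniform_limit_iff eventually_at)
  then have "uniform_limit D (\<lambda>h x. h * ((q h x - a x) / h)) (\<lambda>x. 0 * b x) (at 0)"
    using assms unfolding expands_on_def by (intro uniform_lim_mult) (auto simp: image_constant_conv)
  then have "uniform_limit D (\<lambda>h x. h * ((q h x - a x) / h) + a x) (\<lambda>x. 0 * b x + a x) (at 0)"
    by (rule uniform_limit_add) (rule uniform_limit_const)
  moreover have "\<forall>\<^sub>F h in at 0. \<forall>x\<in>D. h * ((q h x - a x) / h) + a x = q h x"
    by (auto simp: eventually_at intro!: exI[of _ 1])
  ultimately show ?thesis by (subst (asm) uniform_limit_cong) auto
qed

lemma expands_on_add:
  assumes "expands_on D q a b" "expands_on D q' a' b'"
  shows "expands_on D (\<lambda>h x. q h x + q' h x) (\<lambda>x. a x + a' x) (\<lambda>x. b x + b' x)"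
proof -
  have "uniform_limit D (\<lambda>h x. (q h x - a x) / h + (q' h x - a' x) / h) (\<lambda>x. b x + b' x) (at 0)"
    using assms unfolding expands_on_def by (intro uniform_limit_add) auto
  moreover have "(q h x - a x) / h + (q' h x - a' x) / h = (q h x + q' h x - (a x + a' x)) / h" for h x
    by (simp add: diff_divide_distrib add_divide_distrib)
  ultimately show ?thesis
    using assms unfolding expands_on_def by (auto intro!: bounded_plus_comp)
qed

text \<open>The product rule, from qq' - aa' = (q - a) q' + a (q' - a'). Products of uniform limits
  converge uniformly if the limits are bounded, which is why \<open>expands_on\<close> records
  boundedness.\<close>

lemma expands_on_mult:
  assumes q: "expands_on D q a b" and q': "expands_on D q' a' b'"
  shows "expands_on D (\<lambda>h x. q h x * q' h x) (\<lambda>x. a x * a' x) (\<lambda>x. b x * a' x + a x * b' x)"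
proof -
  note [simp] = q[unfolded expands_on_def] q'[unfolded expands_on_def]
  have bm: "bounded ((\<lambda>x. f x * g x) ` D)" if fg: "bounded (f ` D)" "bounded (g ` D)" for f g :: "_ \<Rightarrow> real"
  proof -
    obtain K L where "\<forall>x\<in>D. norm (f x) \<le> K" "\<forall>x\<in>D. norm (g x) \<le> L"
      using fg unfolding bounded_iff by (meson imageI)
    then have "\<forall>x\<in>D. norm (f x * g x) \<le> K * L"
      unfolding norm_mult by (meson mult_mono norm_ge_zero order_trans)
    then show ?thesis by (auto simp: bounded_iff)
  qed
  have "uniform_limit D (\<lambda>h x. (q h x - a x) / h * q' h x + a x * ((q' h x - a' x) / h)) (\<lambda>x. b x * a' x + a x * b' x) (at 0)"
    by (intro uniform_limit_add uniform_lim_mult uniform_limit_const expands_on_uniform_limit[OF q']) auto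
  moreover have "(q h x - a x) / h * q' h x + a x * ((q' h x - a' x) / h) = (q h x * q' h x - a x * a' x) / h" for h x
    by (simp add: diff_divide_distrib algebra_simps)
  ultimately show ?thesis
    unfolding expands_on_def by (auto intro!: bm bounded_plus_comp)
qed

lemma expands_on_const: "bounded (a ` D) \<Longrightarrow> expands_on D (\<lambda>h. a) a (\<lambda>_. 0)"
  using expands_on_affine[of a D "\<lambda>_. 0"] by (auto simp: image_constant_conv)

lemma expands_on_sum:
  assumes "\<And>i. i \<in> I \<Longrightarrow> expands_on D (q i) (a i) (b i)"
  shows "expands_on D (\<lambda>h x. \<Sum>i\<in>I. q i h x) (\<lambda>x. \<Sum>i\<in>I. a i x) (\<lambda>x. \<Sum>i\<in>I. b i x)"
  using assms
proof (induction I rule: infinite_finite_induct)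
  case (insert i I)
  then show ?case using expands_on_add[of D "q i" "a i" "b i"] by simp
qed (auto intro: expands_on_const simp: image_constant_conv)

lemma expands_on_prod_stationary:
  assumes "\<And>i. i \<in> I \<Longrightarrow> expands_on D (q i) (a i) (\<lambda>_. 0)"
  shows "expands_on D (\<lambda>h x. \<Prod>i\<in>I. q i h x) (\<lambda>x. \<Prod>i\<in>I. a i x) (\<lambda>_. 0)"
  using assms
proof (induction I rule: infinite_finite_induct)
  case (insert i I)
  then show ?case
    using expands_on_mult[of D "q i" "a i" "\<lambda>_. 0" "\<lambda>h x. \<Prod>i\<in>I. q i h x" "\<lambda>x. \<Prod>i\<in>I. a i x" "\<lambda>_. 0"]
    by simp
qed (auto intro: expands_on_const simp: image_constant_conv)

lemma compact_translates_subset: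
  fixes X :: "'a::euclidean_space \<Rightarrow> 'a"
  assumes S: "open S" and D: "compact D" "D \<subseteq> S" and X: "continuous_on D X"
  obtains d where "d > 0" "\<And>s x. \<bar>s\<bar> \<le> d \<Longrightarrow> x \<in> D \<Longrightarrow> x + s *\<^sub>R X x \<in> S"
proof -
  obtain B where B: "\<And>x. x \<in> D \<Longrightarrow> norm (X x) \<le> B" "B > 0"
    using compact_imp_bounded[OF compact_continuous_image[OF X D(1)]] by (auto simp: bounded_pos)
  obtain e where e: "e > 0" "(\<Union>x\<in>D. cball x e) \<subseteq> S"
    using compact_subset_open_imp_cball_epsilon_subset[OF D(1) S D(2)] by blast
  show thesis
  proof
    show "e / B > 0" using e B by simp
    fix s x assume s: "\<bar>s\<bar> \<le> e / B" and x: "x \<in> D"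
    have "\<bar>s\<bar> * norm (X x) \<le> e / B * B" using s B(1)[OF x] B(2) e by (intro mult_mono) auto
    then have "x + s *\<^sub>R X x \<in> cball x e" using B(2) by (simp add: dist_norm)
    then show "x + s *\<^sub>R X x \<in> S" using e x by blast
  qed
qed

text \<open>The derivative along the step, as a function of step length and point, is uniformly
  continuous on a compact set; the mean value theorem then bounds the remainder uniformly in
  \<open>x\<close>.\<close>

lemma expands_on_translate:
  fixes f :: "'a::euclidean_space \<Rightarrow> real"
  assumes S: "open S" and D: "compact D" "D \<subseteq> S" and X: "continuous_on S X" and f: "C1_on S f"
  shows "expands_on D (\<lambda>h x. f (x + h *\<^sub>R X x)) f (\<lambda>x. frechet_derivative f (at x) (X x))"
proof -
  note XD = continuous_on_subset[OF X D(2)]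
  obtain d where d: "d > 0" "\<And>s x. \<bar>s\<bar> \<le> d \<Longrightarrow> x \<in> D \<Longrightarrow> x + s *\<^sub>R X x \<in> S"
    using compact_translates_subset[OF S D XD] by blast
  define G where "G = (\<lambda>(s, x). frechet_derivative f (at (x + s *\<^sub>R X x)) (X x))"
  have XT: "continuous_on ({-d..d} \<times> D) (\<lambda>t. X (snd t))"
    by (rule continuous_on_compose2[OF XD continuous_on_snd[OF continuous_on_id]]) auto
  have "continuous_on ({-d..d} \<times> D) G"
    unfolding G_def split_beta
    by (rule C1_on_deriv_jointly_continuous[OF f]) (use d XT in \<open>auto intro!: continuous_intros\<close>)
  then have uc: "uniformly_continuous_on ({-d..d} \<times> D) G"
    by (intro compact_uniformly_continuous compact_Times D(1)) auto
  have bd: "bounded (f ` D)"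
    using f D by (meson C1_on_continuous compact_continuous_image compact_imp_bounded continuous_on_subset)
  have bd': "bounded ((\<lambda>x. frechet_derivative f (at x) (X x)) ` D)"
    by (intro compact_imp_bounded compact_continuous_image D C1_on_deriv_jointly_continuous[OF f] XD)
       (use D in \<open>auto intro!: continuous_intros\<close>)
  have "uniform_limit D (\<lambda>h x. (f (x + h *\<^sub>R X x) - f x) / h) (\<lambda>x. frechet_derivative f (at x) (X x)) (at 0)"
    unfolding uniform_limit_iff
  proof (intro allI impI)
    fix e :: real assume e: "e > 0"
    obtain c where c: "c > 0" "\<And>s x y t. (s, x) \<in> {-d..d} \<times> D \<Longrightarrow> (t, y) \<in> {-d..d} \<times> D \<Longrightarrow>
        dist (s, x) (t, y) < c \<Longrightarrow> dist (G (s, x)) (G (t, y)) < e / 2"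
      using uc e unfolding uniformly_continuous_on_def by (metis half_gt_zero)
    have "dist ((f (x + h *\<^sub>R X x) - f x) / h) (frechet_derivative f (at x) (X x)) < e"
      if h: "h \<noteq> 0" "\<bar>h\<bar> < min c d" and x: "x \<in> D" for h x
    proof -
      \<comment> \<open>With the linear part subtracted, the derivative of \<open>?q\<close> is at
        most \<open>e / 2\<close>, and the mean value bound is a bound for the remainder.\<close>
      let ?q = "\<lambda>s. f (x + s *\<^sub>R X x) - s * G (0, x)"
      have dq: "(?q has_real_derivative G (s, x) - G (0, x)) (at s within {-\<bar>h\<bar>..\<bar>h\<bar>})" if "s \<in> {-\<bar>h\<bar>..\<bar>h\<bar>}" for s
      proof -
        have s: "x + s *\<^sub>R X x \<in> S" using d(2)[OF _ x, of s] that h by auto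
        have "((\<lambda>s. f (x + s *\<^sub>R X x)) has_real_derivative G (s, x)) (at s)"
          unfolding G_def prod.case by (rule has_real_derivative_along_line[OF C1_on_has_derivative[OF f s]])
        then have "(?q has_real_derivative G (s, x) - G (0, x)) (at s)"
          by (auto intro!: derivative_eq_intros)
        then show ?thesis by (rule has_field_derivative_at_within)
      qed
      have "norm (?q h - ?q 0) \<le> e / 2 * norm (h - 0)"
      proof (rule field_differentiable_bound[OF _ dq])
        fix s assume s: "s \<in> {-\<bar>h\<bar>..\<bar>h\<bar>}"
        have "dist (G (s, x)) (G (0, x)) < e / 2"
          by (rule c(2)) (use s h x d in \<open>auto simp: dist_Pair_Pair\<close>)
        then show "norm (G (s, x) - G (0, x)) \<le> e / 2" by (simp add: dist_norm)
      qed auto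
      then have "\<bar>f (x + h *\<^sub>R X x) - f x - h * G (0, x)\<bar> \<le> e / 2 * \<bar>h\<bar>" by (simp add: algebra_simps)
      moreover have "f (x + h *\<^sub>R X x) - f x - h * G (0, x) = h * ((f (x + h *\<^sub>R X x) - f x) / h - G (0, x))"
        using h by (simp add: field_simps)
      ultimately have "\<bar>(f (x + h *\<^sub>R X x) - f x) / h - G (0, x)\<bar> \<le> e / 2"
        using h by (simp add: abs_mult mult.commute)
      then show ?thesis using e by (simp add: dist_real_def G_def)
    qed
    then show "\<forall>\<^sub>F h in at 0. \<forall>x\<in>D. dist ((f (x + h *\<^sub>R X x) - f x) / h) (frechet_derivative f (at x) (X x)) < e"
      using c(1) d(1) by (auto simp: eventually_at dist_real_def intro!: exI[of _ "min c d"])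
  qed
  then show ?thesis using bd bd' by (simp add: expands_on_def)
qed

text \<open>The sums in the last assumption are the entries of the Lie derivative of the form \<open>W\<close> along \<open>X\<close>. If they
  vanish, pulling \<open>W\<close> back along an Euler step changes it by \<open>o(h)\<close> only.\<close>

lemma top_power_euler_step:
  fixes X :: "real ^ ('r::finite + 'r) \<Rightarrow> real ^ ('r + 'r)" and W :: "real ^ ('r + 'r) \<Rightarrow> real ^ ('r + 'r) ^ ('r + 'r)"
  assumes S: "open S" and D: "compact D" "D \<subseteq> S" and X: "C1_on S X" and W: "\<And>i j. C1_on S (\<lambda>x. W x $ i $ j)"
    and J: "J = (\<lambda>x. matrix (frechet_derivative X (at x)))"
    and L: "\<And>x i j. x \<in> S \<Longrightarrow>
      (\<Sum>k\<in>UNIV. J x $ k $ i * W x $ k $ j) + (\<Sum>k\<in>UNIV. W x $ i $ k * J x $ k $ j) +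
      frechet_derivative (\<lambda>x. W x $ i $ j) (at x) (X x) = 0"
  shows "uniform_limit D
    (\<lambda>h x. (det (mat 1 + h *\<^sub>R J x) * top_power (W (x + h *\<^sub>R X x)) - top_power (W x)) / h) (\<lambda>_. 0) (at 0)"
proof -
  have bJ: "bounded ((\<lambda>x. J x $ k $ l) ` D)" for k l
    unfolding J matrix_def by (intro compact_imp_bounded compact_continuous_image D)
       (auto intro!: continuous_intros continuous_on_subset[OF C1_on_deriv_continuous[OF X] D(2)])
  \<comment> \<open>The pullback of \<open>W\<close> under the Euler step, whose Jacobian matrix is
    \<open>mat 1 + h *\<^sub>R J x\<close>.\<close>
  define Q where "Q h x = transpose (mat 1 + h *\<^sub>R J x) ** W (x + h *\<^sub>R X x) ** (mat 1 + h *\<^sub>R J x)" for h x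
  have "expands_on D (\<lambda>h x. Q h x $ i $ j) (\<lambda>x. W x $ i $ j) (\<lambda>_. 0)" for i j
  proof -
    let ?I = "mat 1 :: real ^ ('r + 'r) ^ ('r + 'r)"
    let ?W' = "\<lambda>k l x. frechet_derivative (\<lambda>x. W x $ k $ l) (at x) (X x)"
    let ?q = "\<lambda>l k h x. (?I $ k $ i + h * J x $ k $ i) * W (x + h *\<^sub>R X x) $ k $ l * (?I $ l $ j + h * J x $ l $ j)"
    \<comment> \<open>The coefficient of h by the product rule. The Kronecker deltas in
      \<open>?I\<close> collapse the double sum of these terms to the entry of the Lie
      derivative.\<close>
    let ?b = "\<lambda>l k x. (J x $ k $ i * W x $ k $ l + ?I $ k $ i * ?W' k l x) * ?I $ l $ j
       + ?I $ k $ i * W x $ k $ l * J x $ l $ j"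
    have e: "expands_on D (\<lambda>h x. ?I $ k $ l + h * J x $ k $ l) (\<lambda>x. ?I $ k $ l) (\<lambda>x. J x $ k $ l)" for k l
      by (intro expands_on_affine bJ) (auto simp: image_constant_conv)
    have dl: "(\<Sum>k\<in>UNIV. ?I $ k $ i * g k) = g i" for g and i :: "'r + 'r"
      by (simp add: mat_def if_distrib[of "\<lambda>c. c * _"] cong: if_cong)
    have dr: "(\<Sum>k\<in>UNIV. g k * ?I $ k $ i) = g i" for g and i :: "'r + 'r"
      using dl[of i g] by (simp add: mult.commute)
    have "expands_on D (\<lambda>h x. \<Sum>l\<in>UNIV. \<Sum>k\<in>UNIV. ?q l k h x)
        (\<lambda>x. \<Sum>l\<in>UNIV. \<Sum>k\<in>UNIV. ?I $ k $ i * W x $ k $ l * ?I $ l $ j) (\<lambda>x. \<Sum>l\<in>UNIV. \<Sum>k\<in>UNIV. ?b l k x)"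
      by (intro expands_on_sum expands_on_mult e expands_on_translate[OF S D C1_on_continuous[OF X] W])
    moreover have "Q h x $ i $ j = (\<Sum>l\<in>UNIV. \<Sum>k\<in>UNIV. ?q l k h x)" for h x
      unfolding Q_def matrix_matrix_mult_def transpose_def by (simp add: sum_distrib_right)
    moreover have "(\<Sum>l\<in>UNIV. \<Sum>k\<in>UNIV. ?I $ k $ i * W x $ k $ l * ?I $ l $ j) = W x $ i $ j" for x
      unfolding sum_distrib_right[symmetric] dl dr ..
    moreover have "(\<Sum>l\<in>UNIV. \<Sum>k\<in>UNIV. ?b l k x) = 0" if "x \<in> D" for x
    proof -
      have "(\<Sum>l\<in>UNIV. \<Sum>k\<in>UNIV. ?b l k x) = (\<Sum>l\<in>UNIV. (\<Sum>k\<in>UNIV. J x $ k $ i * W x $ k $ l) * ?I $ l $ j)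
          + (\<Sum>l\<in>UNIV. (\<Sum>k\<in>UNIV. ?I $ k $ i * ?W' k l x) * ?I $ l $ j)
          + (\<Sum>l\<in>UNIV. (\<Sum>k\<in>UNIV. ?I $ k $ i * W x $ k $ l) * J x $ l $ j)"
        by (simp only: sum.distrib sum_distrib_right distrib_right)
      also have "\<dots> = (\<Sum>k\<in>UNIV. J x $ k $ i * W x $ k $ j) + ?W' i j x + (\<Sum>l\<in>UNIV. W x $ i $ l * J x $ l $ j)"
        unfolding dl dr ..
      finally show ?thesis using L[of x i j] that D by auto
    qed
    ultimately show ?thesis
      unfolding expands_on_def by (simp cong: uniform_limit_cong' image_cong)
  qed
  then have "expands_on D (\<lambda>h x. top_power (Q h x)) (\<lambda>x. top_power (W x)) (\<lambda>_. 0)"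
  proof -
    assume e: "\<And>i j. expands_on D (\<lambda>h x. Q h x $ i $ j) (\<lambda>x. W x $ i $ j) (\<lambda>_. 0)"
    have c: "expands_on D (\<lambda>_ _. c) (\<lambda>_. c) (\<lambda>_. 0)" for c :: real
      by (rule expands_on_const) (auto simp: image_constant_conv)
    have cm: "expands_on D (\<lambda>h x. c * q h x) (\<lambda>x. c * a x) (\<lambda>_. 0)" if "expands_on D q a (\<lambda>_. 0)" for q a and c :: real
      using expands_on_mult[OF c that] by simp
    have su: "expands_on D (\<lambda>h x. \<Sum>p\<in>P. q p h x) (\<lambda>x. \<Sum>p\<in>P. a p x) (\<lambda>_. 0)"
      if "\<And>p. expands_on D (q p) (a p) (\<lambda>_. 0)" for q a and P :: "(('r + 'r) \<Rightarrow> ('r + 'r)) set"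
      using expands_on_sum[of P D q a "\<lambda>_ _. 0"] that by simp
    have "expands_on D (\<lambda>h x. inverse (2 ^ CARD('r) * fact CARD('r)) * (\<Sum>p | p permutes (UNIV :: ('r + 'r) set).
        of_int (sign p) * (\<Prod>i\<in>(UNIV :: 'r set). Q h x $ p (Inl i) $ p (Inr i))))
        (\<lambda>x. inverse (2 ^ CARD('r) * fact CARD('r)) * (\<Sum>p | p permutes (UNIV :: ('r + 'r) set).
        of_int (sign p) * (\<Prod>i\<in>(UNIV :: 'r set). W x $ p (Inl i) $ p (Inr i)))) (\<lambda>_. 0)"
      by (rule cm, rule su, rule cm, rule expands_on_prod_stationary, rule e)
    then show ?thesis by (simp add: top_power_def divide_inverse mult.commute)
  qed
  \<comment> \<open>The congruence rule pulls the Jacobian determinant of the Euler step out of the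
    top power of \<open>Q\<close>.\<close>
  then show ?thesis
    unfolding expands_on_def Q_def top_power_congruence by simp
qed

section \<open>Invariance of the density under a local flow\<close>

lemma has_real_derivative_inner_self:
  fixes w :: "real \<Rightarrow> 'a::real_inner"
  assumes "(w has_vector_derivative d) (at s)"
  shows "((\<lambda>s. w s \<bullet> w s) has_real_derivative 2 * (d \<bullet> w s)) (at s)"
proof -
  have w: "(w has_derivative (\<lambda>h. h *\<^sub>R d)) (at s)" using assms by (simp add: has_vector_derivative_def)
  have "(\<lambda>h :: real. w s \<bullet> (h *\<^sub>R d) + (h *\<^sub>R d) \<bullet> w s) = (*) (2 * (d \<bullet> w s))"
    by (simp add: fun_eq_iff inner_commute)
  then show ?thesis using has_derivative_inner[OF w w] by (simp add: has_field_derivative_def)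
qed

lemma set_integral_abs_le:
  fixes f g :: "'a \<Rightarrow> real"
  assumes f: "set_integrable M S f" and g: "set_integrable M S g" and le: "\<And>x. x \<in> S \<Longrightarrow> \<bar>f x\<bar> \<le> g x"
  shows "\<bar>LINT x:S|M. f x\<bar> \<le> (LINT x:S|M. g x)"
proof -
  have "\<bar>LINT x:S|M. f x\<bar> \<le> (LINT x:S|M. \<bar>f x\<bar>)"
    using set_integral_norm_bound[OF f] by simp
  also have "\<dots> \<le> (LINT x:S|M. g x)" by (intro set_integral_mono set_integrable_abs f g le)
  finally show ?thesis .
qed

text \<open>By the Lipschitz bound, the squared distance times exp (- 2 L s) does not increase. The
  square is differentiable even where the curves meet.\<close>

lemma gronwall_forward:
  fixes u v :: "real \<Rightarrow> 'a::real_inner"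
  assumes T: "T \<ge> 0"
    and u: "\<And>s. 0 \<le> s \<Longrightarrow> s \<le> T \<Longrightarrow> (u has_vector_derivative u' s) (at s)"
    and v: "\<And>s. 0 \<le> s \<Longrightarrow> s \<le> T \<Longrightarrow> (v has_vector_derivative v' s) (at s)"
    and L: "\<And>s. 0 \<le> s \<Longrightarrow> s \<le> T \<Longrightarrow> norm (u' s - v' s) \<le> L * norm (u s - v s)"
  shows "norm (u T - v T) \<le> exp (L * T) * norm (u 0 - v 0)"
proof -
  let ?w = "\<lambda>s. ((u s - v s) \<bullet> (u s - v s)) * exp (- (2 * L * s))"
  have "?w T \<le> ?w 0"
  proof (rule DERIV_nonpos_imp_nonincreasing[OF T])
    fix s assume s: "0 \<le> s" "s \<le> T"
    let ?d = "(2 * ((u' s - v' s) \<bullet> (u s - v s)) - 2 * L * ((u s - v s) \<bullet> (u s - v s))) * exp (- (2 * L * s))"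
    have "((\<lambda>s. u s - v s) has_vector_derivative u' s - v' s) (at s)"
      by (intro derivative_intros u v s)
    then have "((\<lambda>s. (u s - v s) \<bullet> (u s - v s)) has_real_derivative 2 * ((u' s - v' s) \<bullet> (u s - v s))) (at s)"
      by (rule has_real_derivative_inner_self)
    moreover have "((\<lambda>s. exp (- (2 * L * s))) has_real_derivative exp (- (2 * L * s)) * (- (2 * L))) (at s)"
      by (auto intro!: derivative_eq_intros)
    ultimately have "(?w has_real_derivative 2 * ((u' s - v' s) \<bullet> (u s - v s)) * exp (- (2 * L * s))
        + exp (- (2 * L * s)) * (- (2 * L)) * ((u s - v s) \<bullet> (u s - v s))) (at s)"
      by (rule DERIV_mult)
    then have "(?w has_real_derivative ?d) (at s)"
      by (rule DERIV_cong) (simp add: left_diff_distrib)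
    moreover have "(u' s - v' s) \<bullet> (u s - v s) \<le> L * ((u s - v s) \<bullet> (u s - v s))"
    proof -
      have "(u' s - v' s) \<bullet> (u s - v s) \<le> norm (u' s - v' s) * norm (u s - v s)" by (rule norm_cauchy_schwarz)
      also have "\<dots> \<le> L * norm (u s - v s) * norm (u s - v s)" by (intro mult_right_mono L s) auto
      finally show ?thesis by (simp add: power2_norm_eq_inner[symmetric] power2_eq_square)
    qed
    ultimately show "\<exists>y. (?w has_real_derivative y) (at s) \<and> y \<le> 0"
      by (intro exI[of _ ?d]) (auto intro!: mult_nonpos_nonneg)
  qed
  then have "(norm (u T - v T))\<^sup>2 * exp (- (2 * L * T)) \<le> (norm (u 0 - v 0))\<^sup>2"
    by (simp add: power2_norm_eq_inner)
  then have "(norm (u T - v T))\<^sup>2 \<le> (norm (u 0 - v 0))\<^sup>2 * exp (2 * L * T)"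
    by (simp add: exp_minus field_simps)
  also have "\<dots> = (exp (L * T) * norm (u 0 - v 0))\<^sup>2"
    by (simp add: power_mult_distrib exp_double[symmetric] mult.assoc mult.commute)
  finally show ?thesis by (rule power2_le_imp_le) simp
qed

lemma gronwall:
  fixes u v :: "real \<Rightarrow> 'a::real_inner"
  assumes u: "\<And>s. s \<in> closed_segment t0 t \<Longrightarrow> (u has_vector_derivative u' s) (at s)"
    and v: "\<And>s. s \<in> closed_segment t0 t \<Longrightarrow> (v has_vector_derivative v' s) (at s)"
    and L: "\<And>s. s \<in> closed_segment t0 t \<Longrightarrow> norm (u' s - v' s) \<le> L * norm (u s - v s)"
  shows "norm (u t - v t) \<le> exp (L * \<bar>t - t0\<bar>) * norm (u t0 - v t0)"
proof -
  \<comment> \<open>The sign that reverses time when \<open>t\<close> lies before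
    \<open>t0\<close>.\<close>
  define \<sigma> :: real where "\<sigma> = (if t \<ge> t0 then 1 else -1)"
  have seg: "t0 + \<sigma> * s \<in> closed_segment t0 t" if "0 \<le> s" "s \<le> \<bar>t - t0\<bar>" for s
    using that by (auto simp: closed_segment_eq_real_ivl \<sigma>_def)
  have chain: "((\<lambda>s. f (t0 + \<sigma> * s)) has_vector_derivative \<sigma> *\<^sub>R f') (at s)"
    if "(f has_vector_derivative f') (at (t0 + \<sigma> * s))" for f :: "real \<Rightarrow> 'a" and f' s
  proof -
    have "((\<lambda>s. t0 + \<sigma> * s) has_vector_derivative \<sigma>) (at s)" by (auto intro!: derivative_eq_intros)
    from vector_diff_chain_at[OF this that] show ?thesis by (simp add: comp_def)
  qed
  have "norm (u (t0 + \<sigma> * \<bar>t - t0\<bar>) - v (t0 + \<sigma> * \<bar>t - t0\<bar>)) \<le> exp (L * \<bar>t - t0\<bar>) * norm (u (t0 + \<sigma> * 0) - v (t0 + \<sigma> * 0))"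
  proof (rule gronwall_forward)
    fix s assume s: "0 \<le> s" "s \<le> \<bar>t - t0\<bar>"
    show "((\<lambda>s. u (t0 + \<sigma> * s)) has_vector_derivative \<sigma> *\<^sub>R u' (t0 + \<sigma> * s)) (at s)"
      "((\<lambda>s. v (t0 + \<sigma> * s)) has_vector_derivative \<sigma> *\<^sub>R v' (t0 + \<sigma> * s)) (at s)"
      using seg[OF s] u v chain by blast+
    have "norm (\<sigma> *\<^sub>R u' (t0 + \<sigma> * s) - \<sigma> *\<^sub>R v' (t0 + \<sigma> * s)) = norm (u' (t0 + \<sigma> * s) - v' (t0 + \<sigma> * s))"
      by (simp add: \<sigma>_def norm_minus_commute)
    then show "norm (\<sigma> *\<^sub>R u' (t0 + \<sigma> * s) - \<sigma> *\<^sub>R v' (t0 + \<sigma> * s)) \<le> L * norm (u (t0 + \<sigma> * s) - v (t0 + \<sigma> * s))"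
      using L[OF seg[OF s]] by simp
  qed simp
  moreover have "t0 + \<sigma> * \<bar>t - t0\<bar> = t" by (simp add: \<sigma>_def)
  ultimately show ?thesis by simp
qed

lemma C1_on_convex_lipschitz:
  fixes X :: "'a::euclidean_space \<Rightarrow> 'b::real_normed_vector"
  assumes X: "C1_on S X" and K: "compact K" "convex K" "K \<subseteq> S"
  obtains L where "L > 0" "\<And>x y. x \<in> K \<Longrightarrow> y \<in> K \<Longrightarrow> norm (X x - X y) \<le> L * norm (x - y)"
proof -
  obtain L where L: "L > 0" "\<And>x v. x \<in> K \<Longrightarrow> norm (frechet_derivative X (at x) v) \<le> L * norm v"
    using C1_on_deriv_bound[OF X K(1,3)] by blast
  have "norm (X x - X y) \<le> L * norm (x - y)" if "x \<in> K" "y \<in> K" for x y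
  proof (rule differentiable_bound[OF K(2) _ _ that])
    show "(X has_derivative frechet_derivative X (at x)) (at x within K)" if "x \<in> K" for x
      using C1_on_has_derivative[OF X] that K by (blast intro: has_derivative_at_withinI)
    show "onorm (frechet_derivative X (at x)) \<le> L" if "x \<in> K" for x
      using L that by (intro onorm_le) auto
  qed
  with L(1) show thesis by (rule that)
qed

lemma continuous_on_det:
  fixes A :: "'a::topological_space \<Rightarrow> real ^ 'n::finite ^ 'n"
  assumes "\<And>i j. continuous_on S (\<lambda>x. A x $ i $ j)"
  shows "continuous_on S (\<lambda>x. det (A x))"
  unfolding det_def by (intro continuous_on_sum continuous_on_mult continuous_on_const continuous_on_prod assms)

lemma continuous_on_top_power:
  fixes A :: "'a::topological_space \<Rightarrow> real ^ ('r::finite + 'r) ^ ('r + 'r)"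
  assumes "\<And>i j. continuous_on S (\<lambda>x. A x $ i $ j)"
  shows "continuous_on S (\<lambda>x. top_power (A x))"
  unfolding top_power_def divide_inverse
  by (intro continuous_on_sum continuous_on_mult continuous_on_const continuous_on_prod assms)

text \<open>The last assumption is the vanishing of the Lie derivative of \<open>W\<close> along
  \<open>X\<close>, in coordinates. It is the form in which closedness and Hamilton's equations
  enter the integral estimates.\<close>

locale invariant_form =
  fixes S :: "(real ^ ('r::finite + 'r)) set"
    and X :: "real ^ ('r + 'r) \<Rightarrow> real ^ ('r + 'r)"
    and W :: "real ^ ('r + 'r) \<Rightarrow> real ^ ('r + 'r) ^ ('r + 'r)"
  assumes open_S: "open S" and X_C1: "C1_on S X" and W_C1: "\<And>i j. C1_on S (\<lambda>x. W x $ i $ j)"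
    and lie_derivative_0: "\<And>x i j. x \<in> S \<Longrightarrow>
      (\<Sum>k\<in>UNIV. matrix (frechet_derivative X (at x)) $ k $ i * W x $ k $ j) +
      (\<Sum>k\<in>UNIV. W x $ i $ k * matrix (frechet_derivative X (at x)) $ k $ j) +
      frechet_derivative (\<lambda>x. W x $ i $ j) (at x) (X x) = 0"
begin

definition density :: "real ^ ('r + 'r) \<Rightarrow> real"
  where "density x = \<bar>top_power (W x)\<bar>"

lemma density_continuous: "continuous_on S density"
  unfolding density_def[abs_def] by (intro continuous_intros continuous_on_top_power C1_on_continuous W_C1)

lemma density_nonneg [simp]: "density x \<ge> 0" by (simp add: density_def)

text \<open>Change of variables along the Euler step produces a Jacobian factor that compensates the
  change of density up to o(h). The bound \<open>d\<close> is chosen before \<open>F\<close>. The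
  gap between the radii prevents boundary terms: the image of the large ball still covers the
  support of \<open>F\<close>.\<close>

lemma euler_step_integral:
  assumes ab: "0 < a" "a < b" and sub: "cball x0 b \<subseteq> S" and e: "e > 0"
  obtains d where "d > 0"
    "\<And>h F K. \<bar>h\<bar> < d \<Longrightarrow> continuous_on UNIV F \<Longrightarrow> (\<And>x. x \<notin> cball x0 a \<Longrightarrow> F x = 0) \<Longrightarrow> (\<And>x. \<bar>F x\<bar> \<le> K) \<Longrightarrow>
      \<bar>(LINT x:cball x0 b|lborel. F (x + h *\<^sub>R X x) * density x) - (LINT x:cball x0 b|lborel. F x * density x)\<bar> \<le> e * \<bar>h\<bar> * K"
proof -
  let ?D = "cball x0 b"
  define J where "J = (\<lambda>x. matrix (frechet_derivative X (at x)))"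
  obtain L where L: "L > 0" "\<And>x y. x \<in> ?D \<Longrightarrow> y \<in> ?D \<Longrightarrow> norm (X x - X y) \<le> L * norm (x - y)"
    using C1_on_convex_lipschitz[OF X_C1 compact_cball convex_cball sub] by blast
  have XD: "continuous_on ?D X" using C1_on_continuous[OF X_C1] sub by (rule continuous_on_subset)
  obtain B where B: "B > 0" "\<And>x. x \<in> ?D \<Longrightarrow> norm (X x) \<le> B"
    using compact_imp_bounded[OF compact_continuous_image[OF XD compact_cball]] by (auto simp: bounded_pos)
  obtain d1 where d1: "d1 > 0" "\<And>s x. \<bar>s\<bar> \<le> d1 \<Longrightarrow> x \<in> ?D \<Longrightarrow> x + s *\<^sub>R X x \<in> S"
    using compact_translates_subset[OF open_S compact_cball sub XD] by blast
  define vol where "vol = measure lborel ?D"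
  define e' where "e' = e / (vol + 1)"
  have vol: "vol \<ge> 0" by (simp add: vol_def)
  then have e': "e' > 0" "e' * vol \<le> e" using e by (simp_all add: e'_def field_simps)
  have "uniform_limit ?D (\<lambda>h x. (det (mat 1 + h *\<^sub>R J x) * top_power (W (x + h *\<^sub>R X x)) - top_power (W x)) / h) (\<lambda>_. 0) (at 0)"
    by (rule top_power_euler_step[OF open_S compact_cball sub X_C1 W_C1 J_def])
       (use lie_derivative_0 in \<open>simp add: J_def\<close>)
  then obtain d2 where d2: "d2 > 0" "\<And>h x. h \<noteq> 0 \<Longrightarrow> \<bar>h\<bar> < d2 \<Longrightarrow> x \<in> ?D \<Longrightarrow>
      \<bar>det (mat 1 + h *\<^sub>R J x) * top_power (W (x + h *\<^sub>R X x)) - top_power (W x)\<bar> < e' * \<bar>h\<bar>"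
    using e'(1) unfolding uniform_limit_iff eventually_at by (auto simp: dist_real_def pos_divide_less_eq)
  \<comment> \<open>In this order: the Euler step stays in \<open>S\<close>, the expansion is
    accurate up to \<open>e'\<close>, the step is injective, and its image covers the small
    ball.\<close>
  define d where "d = min (min d1 d2) (min (1 / L) ((b - a) / B))"
  show thesis
  proof
    show "d > 0" using d1 d2 L B ab by (simp add: d_def)
    fix h and F :: "real ^ ('r + 'r) \<Rightarrow> real" and K
    assume h: "\<bar>h\<bar> < d" and F: "continuous_on UNIV F" and supp: "\<And>x. x \<notin> cball x0 a \<Longrightarrow> F x = 0"
      and K: "\<And>x. \<bar>F x\<bar> \<le> K"
    have hs: "\<bar>h\<bar> \<le> d1" "\<bar>h\<bar> < d2" "\<bar>h\<bar> * L < 1" "\<bar>h\<bar> * B \<le> b - a"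
      using h L B by (auto simp: d_def field_simps)
    let ?\<psi> = "\<lambda>x. x + h *\<^sub>R X x" and ?\<psi>' = "\<lambda>x v. v + h *\<^sub>R frechet_derivative X (at x) v"
    have in_S: "?\<psi> x \<in> S" if "x \<in> ?D" for x using d1(2)[OF hs(1) that] .
    have der: "(?\<psi> has_derivative ?\<psi>' x) (at x)" if "x \<in> ?D" for x
      using that sub by (intro derivative_intros C1_on_has_derivative[OF X_C1]) auto
    have mat: "matrix (?\<psi>' x) = mat 1 + h *\<^sub>R J x" for x
      by (simp add: matrix_def J_def mat_def axis_def vec_eq_iff)
    have inj: "inj_on ?\<psi> ?D"
    proof (rule inj_onI)
      fix x y assume xy: "x \<in> ?D" "y \<in> ?D" "?\<psi> x = ?\<psi> y"
      then have "x - y = h *\<^sub>R (X y - X x)" by (simp add: algebra_simps)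
      then have "norm (x - y) = \<bar>h\<bar> * norm (X x - X y)" by (simp add: norm_minus_commute)
      also have "\<dots> \<le> \<bar>h\<bar> * (L * norm (x - y))" using L(2)[OF xy(1,2)] by (intro mult_left_mono) auto
      finally have "(1 - \<bar>h\<bar> * L) * norm (x - y) \<le> 0" by (simp add: algebra_simps)
      then show "x = y" using hs(3) by (simp add: mult_le_0_iff)
    qed
    have cpsi: "continuous_on ?D ?\<psi>" by (intro continuous_intros XD)
    \<comment> \<open>Brouwer's theorem yields surjectivity: for \<open>x\<close> in the small ball,
      the map sending \<open>z\<close> to \<open>x + (z - ?\<psi> z)\<close> takes the large ball
      into itself, and a fixed point is a preimage of \<open>x\<close>.\<close>
    have img: "y \<in> ?\<psi> ` ?D" if "y \<in> cball x0 a" for y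
    proof -
      have "\<exists>x\<in>?D. ?\<psi> x = y"
      proof (rule brouwer_surjective[of ?D ?\<psi> "cball x0 a"])
        fix x z assume "x \<in> cball x0 a" "z \<in> ?D"
        have "dist x0 (x + (z - ?\<psi> z)) \<le> dist x0 x + \<bar>h\<bar> * norm (X z)"
          using norm_triangle_ineq[of "x0 - x" "h *\<^sub>R X z"] by (simp add: dist_norm algebra_simps)
        also have "\<dots> \<le> a + \<bar>h\<bar> * B"
          using \<open>x \<in> cball x0 a\<close> B(2)[OF \<open>z \<in> ?D\<close>] by (intro add_mono mult_left_mono) auto
        finally show "x + (z - ?\<psi> z) \<in> ?D" using hs(4) by simp
      qed (use that cpsi ab in auto)
      then show ?thesis by auto
    qed
    have pS: "continuous_on ?D density" "continuous_on (?\<psi> ` ?D) density"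
      using density_continuous sub in_S by (auto elim!: continuous_on_subset)
    have Fc: "continuous_on T F" for T using F by (rule continuous_on_subset) simp
    have JD: "continuous_on ?D (\<lambda>x. det (mat 1 + h *\<^sub>R J x))"
      unfolding J_def matrix_def mat_def
      by (intro continuous_on_det) (auto intro!: continuous_intros continuous_on_subset[OF C1_on_deriv_continuous[OF X_C1] sub])
    have "(LINT x:?D|lborel. F x * density x) = (LINT x:?\<psi> ` ?D|lborel. F x * density x)"
      unfolding set_lebesgue_integral_def
    proof (rule Bochner_Integration.integral_cong[OF refl])
      fix y show "indicator ?D y *\<^sub>R (F y * density y) = indicator (?\<psi> ` ?D) y *\<^sub>R (F y * density y)"
        using supp[of y] img[of y] ab by (cases "y \<in> cball x0 a") (auto simp: indicator_def)
    qed
    also have "\<dots> = (LINT x:?D|lborel. \<bar>det (matrix (?\<psi>' x))\<bar> * (F (?\<psi> x) * density (?\<psi> x)))"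
      unfolding mat[symmetric] by (rule change_of_variables_continuous[OF compact_cball der inj])
         (auto intro!: continuous_intros Fc pS simp: mat JD)
    finally have cov: "(LINT x:?D|lborel. F x * density x) = (LINT x:?D|lborel. F (?\<psi> x) * \<bar>det (mat 1 + h *\<^sub>R J x) * top_power (W (?\<psi> x))\<bar>)"
      by (simp add: mat abs_mult density_def ac_simps)
    have i1: "set_integrable lborel ?D (\<lambda>x. F (?\<psi> x) * density x)"
      by (intro set_integrable_compact compact_cball continuous_intros pS continuous_on_compose2[OF Fc cpsi]) auto
    have i2: "set_integrable lborel ?D (\<lambda>x. F (?\<psi> x) * \<bar>det (mat 1 + h *\<^sub>R J x) * top_power (W (?\<psi> x))\<bar>)"
      unfolding abs_mult density_def[symmetric]
      by (intro set_integrable_compact compact_cball continuous_on_mult continuous_on_rabs JD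
          continuous_on_compose2[OF pS(2) cpsi] continuous_on_compose2[OF Fc cpsi]) auto
    have "\<bar>(LINT x:?D|lborel. F (?\<psi> x) * density x) - (LINT x:?D|lborel. F x * density x)\<bar>
        = \<bar>LINT x:?D|lborel. F (?\<psi> x) * density x - F (?\<psi> x) * \<bar>det (mat 1 + h *\<^sub>R J x) * top_power (W (?\<psi> x))\<bar>\<bar>"
      unfolding cov by (simp add: set_integral_diff(2)[OF i1 i2])
    also have "\<dots> \<le> (LINT x:?D|lborel. K * (e' * \<bar>h\<bar>))"
    proof (rule set_integral_abs_le)
      show "set_integrable lborel ?D (\<lambda>x. F (?\<psi> x) * density x - F (?\<psi> x) * \<bar>det (mat 1 + h *\<^sub>R J x) * top_power (W (?\<psi> x))\<bar>)"
        by (rule set_integral_diff(1)[OF i1 i2])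
      show "set_integrable lborel ?D (\<lambda>x. K * (e' * \<bar>h\<bar>))"
        by (intro set_integrable_compact compact_cball continuous_on_const)
      fix x assume x: "x \<in> ?D"
      have "\<bar>density x - \<bar>det (mat 1 + h *\<^sub>R J x) * top_power (W (?\<psi> x))\<bar>\<bar> \<le> e' * \<bar>h\<bar>"
      proof (cases "h = 0")
        case False
        then show ?thesis using d2(2)[OF False hs(2) x] unfolding density_def by linarith
      qed (simp add: density_def)
      then show "\<bar>F (?\<psi> x) * density x - F (?\<psi> x) * \<bar>det (mat 1 + h *\<^sub>R J x) * top_power (W (?\<psi> x))\<bar>\<bar> \<le> K * (e' * \<bar>h\<bar>)"
        unfolding right_diff_distrib[symmetric] abs_mult[of "F _"] using order_trans[OF abs_ge_zero K]
        by (intro mult_mono K) auto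
    qed
    also have "\<dots> = e' * vol * \<bar>h\<bar> * K" by (simp add: set_lebesgue_integral_def vol_def mult.commute)
    also have "\<dots> \<le> e * \<bar>h\<bar> * K"
      using e' order_trans[OF abs_ge_zero K] by (intro mult_right_mono) auto
    finally show "\<bar>(LINT x:?D|lborel. F (?\<psi> x) * density x) - (LINT x:?D|lborel. F x * density x)\<bar> \<le> e * \<bar>h\<bar> * K" .
  qed
qed

end

text \<open>The nested radii: test functions live in R, integrals run over 2 R, starting points come
  from 3 R, and orbits remain in 4 R, where the field is bounded and Lipschitz. Up to time
  \<open>\<epsilon>\<close> no point moves further than R / 2. The group law is asked only while the
  intermediate point is again an admissible start.\<close>

locale local_flow = invariant_form S X W
  for S :: "(real ^ ('r::finite + 'r)) set" and X W +
  fixes \<Phi> :: "real \<Rightarrow> real ^ ('r + 'r) \<Rightarrow> real ^ ('r + 'r)"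
    and x0 :: "real ^ ('r + 'r)" and R \<epsilon> B :: real
  assumes R: "R > 0" and sub: "cball x0 (4 * R) \<subseteq> S" and \<epsilon>: "\<epsilon> > 0" and B: "B * \<epsilon> \<le> R / 2"
    and XB: "\<And>x. x \<in> cball x0 (4 * R) \<Longrightarrow> norm (X x) \<le> B"
    and deriv: "\<And>x t. x \<in> cball x0 (3 * R) \<Longrightarrow> \<bar>t\<bar> \<le> \<epsilon> \<Longrightarrow> ((\<lambda>t. \<Phi> t x) has_vector_derivative X (\<Phi> t x)) (at t)"
    and disp: "\<And>x t. x \<in> cball x0 (3 * R) \<Longrightarrow> \<bar>t\<bar> \<le> \<epsilon> \<Longrightarrow> dist (\<Phi> t x) x \<le> B * \<bar>t\<bar>"
    and zero: "\<And>x. x \<in> cball x0 (3 * R) \<Longrightarrow> \<Phi> 0 x = x"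
    and group: "\<And>x t h. x \<in> cball x0 (3 * R) \<Longrightarrow> \<Phi> h x \<in> cball x0 (3 * R) \<Longrightarrow> \<bar>t\<bar> \<le> \<epsilon> \<Longrightarrow> \<bar>h\<bar> \<le> \<epsilon> \<Longrightarrow>
        \<bar>t + h\<bar> \<le> \<epsilon> \<Longrightarrow> \<Phi> (t + h) x = \<Phi> t (\<Phi> h x)"
begin

lemma B_nonneg: "B \<ge> 0"
  using order_trans[OF norm_ge_zero XB[of x0]] R by simp

lemma flow_displacement: "dist (\<Phi> t x) x \<le> R / 2" if "x \<in> cball x0 (3 * R)" "\<bar>t\<bar> \<le> \<epsilon>"
  using disp[OF that] mult_left_mono[OF that(2) B_nonneg] B by linarith

lemma flow_in_cball: "\<Phi> t x \<in> cball x0 (b + R / 2)" if "x \<in> cball x0 b" "b \<le> 3 * R" "\<bar>t\<bar> \<le> \<epsilon>"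
  using flow_displacement[of x t] that dist_triangle[of x0 "\<Phi> t x" x] by (simp add: dist_commute)

text \<open>Gronwall's inequality with a Lipschitz constant of the field on the largest ball. The
  bound is uniform in time and stands in for differentiability in the initial point.\<close>

lemma flow_lipschitz:
  obtains M where "M \<ge> 0" "\<And>x y t. x \<in> cball x0 (3 * R) \<Longrightarrow> y \<in> cball x0 (3 * R) \<Longrightarrow> \<bar>t\<bar> \<le> \<epsilon> \<Longrightarrow>
    norm (\<Phi> t x - \<Phi> t y) \<le> M * norm (x - y)"
proof -
  obtain L where L: "L > 0" "\<And>x y. x \<in> cball x0 (4 * R) \<Longrightarrow> y \<in> cball x0 (4 * R) \<Longrightarrow> norm (X x - X y) \<le> L * norm (x - y)"
    using C1_on_convex_lipschitz[OF X_C1 compact_cball convex_cball sub] by blast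
  show thesis
  proof
    fix x y t assume xy: "x \<in> cball x0 (3 * R)" "y \<in> cball x0 (3 * R)" and t: "\<bar>t\<bar> \<le> \<epsilon>"
    have in4: "\<Phi> t x \<in> cball x0 (4 * R)" if "x \<in> cball x0 (3 * R)" "\<bar>t\<bar> \<le> \<epsilon>" for x t
      using flow_in_cball[OF that(1) order_refl that(2)] R by auto
    have seg: "\<bar>s\<bar> \<le> \<epsilon>" if "s \<in> closed_segment 0 t" for s
      using that t by (auto simp: closed_segment_eq_real_ivl split: if_splits)
    have "norm (\<Phi> t x - \<Phi> t y) \<le> exp (L * \<bar>t - 0\<bar>) * norm (\<Phi> 0 x - \<Phi> 0 y)"
      by (rule gronwall[where u="\<lambda>t. \<Phi> t x" and v="\<lambda>t. \<Phi> t y" and u'="\<lambda>t. X (\<Phi> t x)" and v'="\<lambda>t. X (\<Phi> t y)"])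
        (intro deriv L in4 xy seg, assumption)+
    also have "\<dots> \<le> exp (L * \<epsilon>) * norm (x - y)"
      using t L(1) unfolding zero[OF xy(1)] zero[OF xy(2)] by (intro mult_right_mono) auto
    finally show "norm (\<Phi> t x - \<Phi> t y) \<le> exp (L * \<epsilon>) * norm (x - y)" .
  qed simp
qed

lemma flow_continuous:
  assumes t: "\<bar>t\<bar> \<le> \<epsilon>" shows "continuous_on (cball x0 (3 * R)) (\<Phi> t)"
proof -
  obtain M where "M \<ge> 0" "\<And>x y t. x \<in> cball x0 (3 * R) \<Longrightarrow> y \<in> cball x0 (3 * R) \<Longrightarrow> \<bar>t\<bar> \<le> \<epsilon> \<Longrightarrow>
    norm (\<Phi> t x - \<Phi> t y) \<le> M * norm (x - y)" using flow_lipschitz by blast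
  then show ?thesis
    using t by (intro lipschitz_on_continuous_on[of M] lipschitz_onI) (auto simp: dist_norm)
qed

text \<open>The time derivative of the integral vanishes: up to \<open>o(h)\<close>, advancing by time \<open>h\<close> amounts to an
  Euler step, as the integrand at time \<open>t\<close> is Lipschitz.\<close>

lemma flow_integral_invariant:
  assumes FK: "\<And>x y. \<bar>F x - F y\<bar> \<le> K * norm (x - y)" and FC: "\<And>x. \<bar>F x\<bar> \<le> C"
    and supp: "\<And>x. x \<notin> cball x0 R \<Longrightarrow> F x = 0" and t: "\<bar>t\<bar> < \<epsilon>"
  shows "(LINT x:cball x0 (2 * R)|lborel. F (\<Phi> t x) * density x) = (LINT x:cball x0 (2 * R)|lborel. F x * density x)"
proof -
  let ?D = "cball x0 (2 * R)" and ?D3 = "cball x0 (3 * R)" and ?D4 = "cball x0 (4 * R)"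
  obtain L where L: "L > 0" "\<And>x y. x \<in> ?D4 \<Longrightarrow> y \<in> ?D4 \<Longrightarrow> norm (X x - X y) \<le> L * norm (x - y)"
    using C1_on_convex_lipschitz[OF X_C1 compact_cball convex_cball sub] by blast
  note B0 = B_nonneg and disp' = flow_displacement and move = flow_in_cball
  have C0: "C \<ge> 0" using order_trans[OF abs_ge_zero FC] .
  have K0: "K \<ge> 0"
  proof -
    have "K * norm (axis undefined 1 :: real ^ ('r + 'r)) \<ge> 0"
      using order_trans[OF abs_ge_zero FK[of "axis undefined 1" 0]] by simp
    then show ?thesis by (simp add: norm_axis_1)
  qed
  have in4: "\<Phi> t x \<in> ?D4" if "x \<in> ?D3" "\<bar>t\<bar> \<le> \<epsilon>" for x t
    using move[OF that(1) order_refl that(2)] R by auto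
  obtain M' where M': "M' \<ge> 0" "\<And>x y t. x \<in> ?D3 \<Longrightarrow> y \<in> ?D3 \<Longrightarrow> \<bar>t\<bar> \<le> \<epsilon> \<Longrightarrow>
    norm (\<Phi> t x - \<Phi> t y) \<le> M' * norm (x - y)" using flow_lipschitz by blast
  define M where "M = K * M'"
  have M0: "M \<ge> 0" using K0 M'(1) by (simp add: M_def)
  have lip: "\<bar>F (\<Phi> t x) - F (\<Phi> t y)\<bar> \<le> M * norm (x - y)" if "x \<in> ?D3" "y \<in> ?D3" "\<bar>t\<bar> \<le> \<epsilon>" for x y t
    using order_trans[OF FK mult_left_mono[OF M'(2)[OF that] K0]] by (simp add: M_def mult.assoc)
  have cont3: "continuous_on ?D3 (\<lambda>x. F (\<Phi> t x))" if t: "\<bar>t\<bar> \<le> \<epsilon>" for t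
    by (rule lipschitz_on_continuous_on[of M], intro lipschitz_onI) (use lip[OF _ _ t] M0 in \<open>auto simp: dist_norm\<close>)
  \<comment> \<open>Extension by 0 outside the admissible starting points. It is continuous on the
    whole space because a point whose orbit reaches the support of \<open>F\<close> starts within 3
    / 2 R.\<close>
  define Fh where "Fh t x = (if x \<in> ?D3 then F (\<Phi> t x) else 0)" for t x
  have Fh0: "Fh t x = 0" if "x \<notin> cball x0 (3 / 2 * R)" "\<bar>t\<bar> \<le> \<epsilon>" for t x
  proof (cases "x \<in> ?D3")
    case True
    have "dist x0 x \<le> dist x0 (\<Phi> t x) + R / 2"
      using disp'[OF True that(2)] dist_triangle[of x0 x "\<Phi> t x"] by simp
    then have "\<Phi> t x \<notin> cball x0 R" using that(1) by auto
    then show ?thesis using supp by (simp add: Fh_def)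
  qed (auto simp: Fh_def)
  have Fhc: "continuous_on UNIV (Fh t)" if t: "\<bar>t\<bar> \<le> \<epsilon>" for t
  proof -
    have "continuous_on (?D3 \<union> - ball x0 (2 * R)) (Fh t)"
    proof (rule continuous_on_closed_Un)
      show "continuous_on ?D3 (Fh t)"
        using cont3[OF t] by (rule continuous_on_eq) (simp add: Fh_def)
      have "Fh t x = 0" if "x \<in> - ball x0 (2 * R)" for x
        using that R by (intro Fh0 t) auto
      then show "continuous_on (- ball x0 (2 * R)) (Fh t)"
        by (intro continuous_on_eq[OF continuous_on_const[of _ 0]]) simp
    qed auto
    moreover have "?D3 \<union> - ball x0 (2 * R) = UNIV" using R by auto
    ultimately show ?thesis by simp
  qed
  have Fhb: "\<bar>Fh t x\<bar> \<le> C" for t x using FC C0 by (simp add: Fh_def)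
  have dD: "continuous_on ?D density"
    using density_continuous sub R by (auto elim!: continuous_on_subset)
  define P where "P = (LINT x:?D|lborel. density x)"
  have P0: "P \<ge> 0"
    unfolding P_def set_lebesgue_integral_def by (intro Bochner_Integration.integral_nonneg) simp
  define G where "G t = (LINT x:?D|lborel. F (\<Phi> t x) * density x)" for t
  have GF: "G t = (LINT x:?D|lborel. Fh t x * density x)" for t
    unfolding G_def by (rule set_lebesgue_integral_cong) (use R in \<open>auto simp: Fh_def\<close>)
  \<comment> \<open>Along the orbit the velocity departs from its initial value by at most
    \<open>L\<close> times the displacement, which is at most \<open>B * \<bar>h\<bar>\<close>;
    integrating over time h gives an error of order h^2.\<close>
  have step: "norm (\<Phi> h x - (x + h *\<^sub>R X x)) \<le> L * B * \<bar>h\<bar> * \<bar>h\<bar>" if x: "x \<in> ?D3" and h: "\<bar>h\<bar> \<le> \<epsilon>" for x h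
  proof -
    let ?g = "\<lambda>s. \<Phi> s x - s *\<^sub>R X x"
    have seg: "\<bar>s\<bar> \<le> \<bar>h\<bar>" if "s \<in> closed_segment 0 h" for s
      using that by (auto simp: closed_segment_eq_real_ivl split: if_splits)
    have "norm (?g h - ?g 0) \<le> L * B * \<bar>h\<bar> * norm (h - 0)"
    proof (rule differentiable_bound[OF convex_closed_segment])
      fix s assume s: "s \<in> closed_segment 0 h"
      then have se: "\<bar>s\<bar> \<le> \<epsilon>" using seg h by fastforce
      have "(?g has_vector_derivative X (\<Phi> s x) - 1 *\<^sub>R X x) (at s)"
        by (intro derivative_intros deriv x se) (auto intro!: derivative_eq_intros)
      then show "(?g has_derivative (\<lambda>r. r *\<^sub>R (X (\<Phi> s x) - X x))) (at s within closed_segment 0 h)"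
        by (simp add: has_vector_derivative_def has_derivative_at_withinI)
      have "norm (X (\<Phi> s x) - X x) \<le> L * norm (\<Phi> s x - x)"
        using x R by (intro L in4 se) auto
      also have "\<dots> \<le> L * (B * \<bar>h\<bar>)"
        using disp[OF x se] mult_left_mono[OF seg[OF s] B0] L(1) by (intro mult_left_mono) (auto simp: dist_norm)
      finally have le: "norm (X (\<Phi> s x) - X x) \<le> L * (B * \<bar>h\<bar>)" .
      show "onorm (\<lambda>r. r *\<^sub>R (X (\<Phi> s x) - X x)) \<le> L * B * \<bar>h\<bar>"
        by (rule onorm_le) (use mult_left_mono[OF le abs_ge_zero] in \<open>simp add: mult.commute mult.left_commute\<close>)
    qed auto
    then show ?thesis by (simp add: zero[OF x] algebra_simps)
  qed
  have der: "(G has_field_derivative 0) (at t)" if t: "\<bar>t\<bar> < \<epsilon>" for t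
  proof -
    have te: "\<bar>t\<bar> \<le> \<epsilon>" using t by simp
    have "((\<lambda>h. (G (t + h) - G t) / h) \<longlongrightarrow> 0) (at 0)"
      unfolding LIM_eq
    proof (intro allI impI)
      fix e :: real assume e: "e > 0"
      have e1: "e / (2 * (C + 1)) > 0" using e C0 by simp
      have ab: "0 < 3 / 2 * R" "3 / 2 * R < 2 * R" "?D \<subseteq> S" using R sub by auto
      obtain d where d: "d > 0"
        "\<And>h F K. \<bar>h\<bar> < d \<Longrightarrow> continuous_on UNIV F \<Longrightarrow> (\<And>x. x \<notin> cball x0 (3 / 2 * R) \<Longrightarrow> F x = 0) \<Longrightarrow> (\<And>x. \<bar>F x\<bar> \<le> K) \<Longrightarrow>
          \<bar>(LINT x:?D|lborel. F (x + h *\<^sub>R X x) * density x) - (LINT x:?D|lborel. F x * density x)\<bar> \<le> e / (2 * (C + 1)) * \<bar>h\<bar> * K"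
        using euler_step_integral[OF ab e1] by blast
      \<comment> \<open>Constant of the quadratic error: Lipschitz constant of the integrand,
        constant of the step error, and mass of the domain.\<close>
      define Q where "Q = M * (L * B) * P"
      have Q0: "Q \<ge> 0" using M0 L B0 P0 by (simp add: Q_def)
      define s where "s = min (min d (\<epsilon> - \<bar>t\<bar>)) (e / (2 * (Q + 1)))"
      have "\<bar>(G (t + h) - G t) / h\<bar> < e" if h: "h \<noteq> 0" "\<bar>h\<bar> < s" for h
      proof -
        have hd: "\<bar>h\<bar> < d" and th: "\<bar>t + h\<bar> \<le> \<epsilon>" and hQ: "\<bar>h\<bar> < e / (2 * (Q + 1))"
          using h t by (auto simp: s_def)
        have he: "\<bar>h\<bar> \<le> \<epsilon>" using h t by (auto simp: s_def)
        let ?H = "LINT x:?D|lborel. Fh t (x + h *\<^sub>R X x) * density x"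
        have psi: "x + h *\<^sub>R X x \<in> ?D3" if "x \<in> ?D" for x
        proof -
          have "dist x0 (x + h *\<^sub>R X x) \<le> dist x0 x + \<bar>h\<bar> * norm (X x)"
            using norm_triangle_ineq[of "x0 - x" "- (h *\<^sub>R X x)"] by (simp add: dist_norm algebra_simps)
          moreover have "\<bar>h\<bar> * norm (X x) \<le> \<epsilon> * B"
            using XB[of x] that R he B0 \<epsilon> by (intro mult_mono) auto
          ultimately show ?thesis using that B R by (simp add: mult.commute)
        qed
        have phi: "\<Phi> h x \<in> ?D3" if "x \<in> ?D" for x
          using move[OF that _ he] R by auto
        \<comment> \<open>The group law moves the additional time h into the initial point, so that
          the integrand at the fixed time \<open>t\<close> is evaluated at a flow step of length
          h.\<close>
        have G2: "G (t + h) = (LINT x:?D|lborel. Fh t (\<Phi> h x) * density x)"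
          unfolding G_def
        proof (rule set_lebesgue_integral_cong)
          show "\<forall>x. x \<in> ?D \<longrightarrow> F (\<Phi> (t + h) x) * density x = Fh t (\<Phi> h x) * density x"
            using group[OF _ phi te he th] phi R by (auto simp: Fh_def)
        qed simp
        have cD: "continuous_on ?D (\<lambda>x. F (\<Phi> (t + h) x))"
          using cont3[OF th] by (rule continuous_on_subset) (use R in auto)
        have i1: "set_integrable lborel ?D (\<lambda>x. Fh t (\<Phi> h x) * density x)"
        proof -
          have "Fh t (\<Phi> h x) = F (\<Phi> (t + h) x)" if "x \<in> ?D" for x
            using group[OF _ phi[OF that] te he th] phi[OF that] that R by (auto simp: Fh_def)
          then have "continuous_on ?D (\<lambda>x. Fh t (\<Phi> h x))" by (intro continuous_on_eq[OF cD]) simp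
          then show ?thesis by (intro set_integrable_compact compact_cball continuous_on_mult dD)
        qed
        have i2: "set_integrable lborel ?D (\<lambda>x. Fh t (x + h *\<^sub>R X x) * density x)"
        proof -
          have "continuous_on ?D X"
            using C1_on_continuous[OF X_C1] ab(3) by (rule continuous_on_subset)
          then have "continuous_on ?D (\<lambda>x. x + h *\<^sub>R X x)" by (intro continuous_intros)
          then show ?thesis
            by (intro set_integrable_compact compact_cball continuous_on_mult dD continuous_on_compose2[OF Fhc[OF te]]) auto
        qed
        have "\<bar>G (t + h) - ?H\<bar> = \<bar>LINT x:?D|lborel. Fh t (\<Phi> h x) * density x - Fh t (x + h *\<^sub>R X x) * density x\<bar>"
          unfolding G2 by (simp add: set_integral_diff(2)[OF i1 i2])
        also have "\<dots> \<le> (LINT x:?D|lborel. M * (L * B * \<bar>h\<bar> * \<bar>h\<bar>) * density x)"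
        proof (rule set_integral_abs_le[OF set_integral_diff(1)[OF i1 i2]])
          show "set_integrable lborel ?D (\<lambda>x. M * (L * B * \<bar>h\<bar> * \<bar>h\<bar>) * density x)"
            by (intro set_integrable_compact compact_cball continuous_intros dD)
          fix x assume x: "x \<in> ?D"
          then have x3: "x \<in> ?D3" using R by auto
          have "\<bar>Fh t (\<Phi> h x) - Fh t (x + h *\<^sub>R X x)\<bar> \<le> M * norm (\<Phi> h x - (x + h *\<^sub>R X x))"
            using lip[OF phi[OF x] psi[OF x] te] phi[OF x] psi[OF x] by (simp add: Fh_def)
          also have "\<dots> \<le> M * (L * B * \<bar>h\<bar> * \<bar>h\<bar>)" by (intro mult_left_mono step x3 he M0)
          finally show "\<bar>Fh t (\<Phi> h x) * density x - Fh t (x + h *\<^sub>R X x) * density x\<bar> \<le> M * (L * B * \<bar>h\<bar> * \<bar>h\<bar>) * density x"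
            by (simp add: left_diff_distrib[symmetric] abs_mult mult_right_mono)
        qed
        also have "\<dots> = Q * \<bar>h\<bar> * \<bar>h\<bar>" by (simp add: Q_def P_def)
        finally have 1: "\<bar>G (t + h) - ?H\<bar> \<le> Q * \<bar>h\<bar> * \<bar>h\<bar>" .
        have 2: "\<bar>?H - G t\<bar> \<le> e / (2 * (C + 1)) * \<bar>h\<bar> * C"
          unfolding GF[of t] by (rule d(2)[OF hd Fhc[OF te] Fh0 Fhb]) (use te in auto)
        have "e / (2 * (C + 1)) * C \<le> e / 2" using e C0 by (simp add: field_simps)
        moreover have "Q * \<bar>h\<bar> < e / 2"
        proof -
          have "Q * \<bar>h\<bar> \<le> (Q + 1) * \<bar>h\<bar>" by (intro mult_right_mono) auto
          also have "\<dots> < e / 2" using hQ Q0 by (simp add: field_simps)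
          finally show ?thesis .
        qed
        ultimately have "Q * \<bar>h\<bar> + e / (2 * (C + 1)) * C < e" by linarith
        then have "\<bar>h\<bar> * (Q * \<bar>h\<bar> + e / (2 * (C + 1)) * C) < \<bar>h\<bar> * e"
          using h by (intro mult_strict_left_mono) auto
        then have "\<bar>G (t + h) - G t\<bar> < \<bar>h\<bar> * e"
          using 1 2 by (simp add: algebra_simps)
        then show ?thesis using h by (simp add: abs_divide field_simps)
      qed
      moreover have "s > 0" using d(1) t e Q0 by (simp add: s_def)
      ultimately show "\<exists>s>0. \<forall>x. x \<noteq> 0 \<and> norm (x - 0) < s \<longrightarrow> norm ((G (t + x) - G t) / x - 0) < e"
        by auto
    qed
    then show ?thesis unfolding DERIV_def .
  qed
  have "\<exists>c. \<forall>t\<in>{-\<epsilon><..<\<epsilon>}. G t = c"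
    by (rule has_field_derivative_zero_constant) (auto intro!: has_field_derivative_at_within der)
  then have "G t = G 0" using t \<epsilon> by (metis abs_less_iff abs_zero greaterThanLessThan_iff minus_less_iff)
  also have "G 0 = (LINT x:?D|lborel. F x * density x)"
    unfolding G_def by (rule set_lebesgue_integral_cong) (use R in \<open>auto simp: zero\<close>)
  finally show ?thesis unfolding G_def .
qed

text \<open>The indicator of an open set is the increasing limit of the Lipschitz functions min 1 (n
  times the distance to the complement), to which the invariance of integrals applies; monotone
  convergence does the rest.\<close>

lemma flow_open_set_invariant:
  assumes U: "open U" "U \<subseteq> cball x0 R" and t: "\<bar>t\<bar> < \<epsilon>"
  shows "(\<integral>\<^sup>+x. ennreal (indicator (cball x0 (2 * R)) x * (indicator U (\<Phi> t x) * density x)) \<partial>lborel)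
       = (\<integral>\<^sup>+x. ennreal (indicator U x * density x) \<partial>lborel)"
proof -
  let ?D = "cball x0 (2 * R)"
  define F where "F n x = min 1 (real n * infdist x (- U))" for n :: nat and x
  have ne: "- U \<noteq> {}"
    using U(2) bounded_subset[OF bounded_cball, of U] not_bounded_UNIV by (metis Compl_empty_eq double_compl)
  have FK: "\<bar>F n x - F n y\<bar> \<le> real n * norm (x - y)" for n x y
  proof -
    have "\<bar>F n x - F n y\<bar> \<le> \<bar>real n * infdist x (- U) - real n * infdist y (- U)\<bar>"
      unfolding F_def by linarith
    also have "\<dots> = real n * \<bar>infdist x (- U) - infdist y (- U)\<bar>"
      by (simp add: right_diff_distrib[symmetric] abs_mult)
    also have "\<dots> \<le> real n * norm (x - y)"
      using infdist_triangle_abs[of x "- U" y] by (intro mult_left_mono) (auto simp: dist_norm)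
    finally show ?thesis .
  qed
  have F01: "0 \<le> F n x" "F n x \<le> 1" for n x
    unfolding F_def by (auto simp: infdist_nonneg)
  have F0: "F n x = 0" if "x \<notin> U" for n x
    using that by (simp add: F_def)
  have Finc: "F m x \<le> F n x" if "m \<le> n" for m n x
    unfolding F_def using that by (intro min.mono mult_right_mono) (auto simp: infdist_nonneg)
  have Flim: "(\<lambda>n. F n x) \<longlonglongrightarrow> indicator U x" for x
  proof (cases "x \<in> U")
    case True
    then have "infdist x (- U) > 0"
      using U(1) ne by (intro infdist_pos_not_in_closed) auto
    then obtain N where N: "1 < real N * infdist x (- U)" using reals_Archimedean3 by blast
    have "F n x = 1" if "n \<ge> N" for n
    proof -
      have "real N * infdist x (- U) \<le> real n * infdist x (- U)"
        using that by (intro mult_right_mono infdist_nonneg) auto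
      then show ?thesis using N by (simp add: F_def)
    qed
    then show ?thesis using True by (intro tendsto_eventually eventually_sequentiallyI[of N]) simp
  qed (simp add: F0)
  have te: "\<bar>t\<bar> \<le> \<epsilon>" using t by simp
  have dD: "continuous_on ?D density"
    using density_continuous sub R by (auto elim!: continuous_on_subset)
  have Fc: "continuous_on T (F n)" for T n
    unfolding F_def by (intro continuous_intros)
  have Phic: "continuous_on ?D (\<Phi> t)"
    using flow_continuous[OF te] by (rule continuous_on_subset) (use R in auto)
  have idc: "continuous_on ?D (\<lambda>x. x)" by simp
  have lim: "(\<lambda>n. \<integral>\<^sup>+x. ennreal (indicator ?D x *\<^sub>R (F n (g x) * density x)) \<partial>lborel)
      \<longlonglongrightarrow> (\<integral>\<^sup>+x. ennreal (indicator ?D x * (indicator U (g x) * density x)) \<partial>lborel)"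
    and val: "(\<integral>\<^sup>+x. ennreal (indicator ?D x *\<^sub>R (F n (g x) * density x)) \<partial>lborel)
      = ennreal (LINT x:?D|lborel. F n (g x) * density x)"
    if g: "continuous_on ?D g" for g n
  proof -
    have i: "set_integrable lborel ?D (\<lambda>x. F n (g x) * density x)" for n
      by (intro set_integrable_compact compact_cball continuous_on_mult dD continuous_on_compose2[OF Fc g]) auto
    then show "(\<integral>\<^sup>+x. ennreal (indicator ?D x *\<^sub>R (F n (g x) * density x)) \<partial>lborel)
      = ennreal (LINT x:?D|lborel. F n (g x) * density x)"
      unfolding set_integrable_def set_lebesgue_integral_def
      by (intro nn_integral_eq_integral) (auto simp: F01)
    show "(\<lambda>n. \<integral>\<^sup>+x. ennreal (indicator ?D x *\<^sub>R (F n (g x) * density x)) \<partial>lborel)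
      \<longlonglongrightarrow> (\<integral>\<^sup>+x. ennreal (indicator ?D x * (indicator U (g x) * density x)) \<partial>lborel)"
    proof (rule nn_integral_LIMSEQ)
      show "incseq (\<lambda>n x. ennreal (indicator ?D x *\<^sub>R (F n (g x) * density x)))"
        by (auto simp: incseq_def le_fun_def intro!: ennreal_leI mult_left_mono mult_right_mono Finc)
      show "(\<lambda>x. ennreal (indicator ?D x *\<^sub>R (F n (g x) * density x))) \<in> borel_measurable lborel" for n
        using borel_measurable_integrable[OF i[unfolded set_integrable_def]] by measurable
      show "(\<lambda>n. ennreal (indicator ?D x *\<^sub>R (F n (g x) * density x))) \<longlonglongrightarrow> ennreal (indicator ?D x * (indicator U (g x) * density x))" for x
        unfolding real_scaleR_def by (intro tendsto_ennrealI tendsto_mult tendsto_const Flim)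
    qed
  qed
  have "(LINT x:?D|lborel. F n (\<Phi> t x) * density x) = (LINT x:?D|lborel. F n x * density x)" for n
  proof (rule flow_integral_invariant[OF FK, of n 1])
    show "\<bar>F n x\<bar> \<le> 1" for x using F01[of n x] by simp
    show "F n x = 0" if "x \<notin> cball x0 R" for x using that U(2) by (intro F0) blast
  qed fact
  then have "(\<integral>\<^sup>+x. ennreal (indicator ?D x * (indicator U (\<Phi> t x) * density x)) \<partial>lborel)
      = (\<integral>\<^sup>+x. ennreal (indicator ?D x * (indicator U x * density x)) \<partial>lborel)"
    using LIMSEQ_unique[OF lim[OF Phic]] lim[OF idc] unfolding val[OF Phic] val[OF idc] by simp
  also have "(\<lambda>x. indicator ?D x * (indicator U x * density x)) = (\<lambda>x. indicator U x * density x)"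
    using U(2) R by (auto simp: fun_eq_iff indicator_def)
  finally show ?thesis by simp
qed

end

section \<open>Hamiltonian flows in charts\<close>

lemma frechet_derivative_cong_open:
  assumes S: "open S" "x \<in> S" and f: "f differentiable (at x)" and eq: "\<And>y. y \<in> S \<Longrightarrow> f y = g y"
  shows "frechet_derivative g (at x) = frechet_derivative f (at x)"
proof -
  have "(f has_derivative frechet_derivative f (at x)) (at x)"
    using f by (simp add: frechet_derivative_works)
  then have "(g has_derivative frechet_derivative f (at x)) (at x)"
    by (rule has_derivative_transform_within_open[OF _ S eq])
  then show ?thesis by (rule frechet_derivative_at[symmetric])
qed

lemma frechet_derivative_component:
  fixes f :: "'a::euclidean_space \<Rightarrow> 'b::real_normed_vector ^ 'n::finite"
  assumes "C1_on S f" "x \<in> S"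
  shows "frechet_derivative (\<lambda>x. f x $ i) (at x) v = frechet_derivative f (at x) v $ i"
  using frechet_derivative_at[OF bounded_linear.has_derivative[OF bounded_linear_vec_nth C1_on_has_derivative[OF assms], of i]]
  by (simp add: fun_eq_iff)

section \<open>The form and the Hamiltonian vector field in a chart\<close>

context symplectic_manifold
begin

definition chart_form :: "('m, 'r) chart \<Rightarrow> real ^ ('r + 'r) \<Rightarrow> real ^ ('r + 'r) ^ ('r + 'r)"
  where "chart_form c x = \<omega> c (chart_inv c x)"

lemma chart_inv_in_dom: "c \<in> atlas \<Longrightarrow> x \<in> chart_image c \<Longrightarrow> chart_inv c x \<in> chart_dom c"
  using chart_homeomorphism[of c] by (auto simp: homeomorphism_def)

lemma coord_in_image: "c \<in> atlas \<Longrightarrow> m \<in> chart_dom c \<Longrightarrow> coord c m \<in> chart_image c"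
  by (simp add: chart_image_def)

lemma chart_inv_coord: "c \<in> atlas \<Longrightarrow> m \<in> chart_dom c \<Longrightarrow> chart_inv c (coord c m) = m"
  using chart_homeomorphism[of c] by (auto simp: homeomorphism_def)

lemma coord_chart_inv: "c \<in> atlas \<Longrightarrow> x \<in> chart_image c \<Longrightarrow> coord c (chart_inv c x) = x"
  using chart_homeomorphism[of c] by (auto simp: homeomorphism_def)

lemma chart_form_C1: "c \<in> atlas \<Longrightarrow> C1_on (chart_image c) (\<lambda>x. chart_form c x $ i $ j)"
  unfolding chart_form_def by (intro C1_on_component smooth_on_C1 form_smooth)

lemma axis_form: "axis i 1 \<bullet> (A *v axis j 1) = A $ i $ j" for A :: "real ^ 'n::finite ^ 'n"
  by (simp add: matrix_vector_mult_basis column_def inner_axis_axis inner_axis' )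

lemma chart_form_antisym:
  assumes c: "c \<in> atlas" and x: "x \<in> chart_image c"
  shows "chart_form c x $ i $ j = - chart_form c x $ j $ i"
proof -
  let ?A = "chart_form c x"
  have alt: "u \<bullet> (?A *v u) = 0" for u
    using form_alternating[OF c chart_inv_in_dom[OF c x]] by (simp add: chart_form_def)
  have "0 = (axis i 1 + axis j 1) \<bullet> (?A *v (axis i 1 + axis j 1))" by (simp add: alt)
  also have "\<dots> = ?A $ i $ j + ?A $ j $ i"
    by (simp add: matrix_vector_right_distrib inner_add_left inner_add_right axis_form alt)
  finally show ?thesis by simp
qed

text \<open>The transpose appears because the velocity occupies the first slot of the form. A vector
  in its kernel pairs to 0 with every vector, so nondegeneracy makes it 0.\<close>

lemma det_chart_form_nz:
  assumes c: "c \<in> atlas" and x: "x \<in> chart_image c"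
  shows "det (transpose (chart_form c x)) \<noteq> 0"
proof -
  have "u = 0" if "transpose (chart_form c x) *v u = 0" for u
  proof (rule form_nondegenerate[OF c chart_inv_in_dom[OF c x]])
    show "\<forall>v. u \<bullet> (\<omega> c (chart_inv c x) *v v) = 0"
    proof
      fix v
      have "u \<bullet> (chart_form c x *v v) = (u v* chart_form c x) \<bullet> v" by (rule dot_lmul_matrix[symmetric])
      also have "u v* chart_form c x = transpose (chart_form c x) *v u" by simp
      finally show "u \<bullet> (\<omega> c (chart_inv c x) *v v) = 0" using that by (simp add: chart_form_def)
    qed
  qed
  then have "\<exists>B. B ** transpose (chart_form c x) = mat 1"
    unfolding matrix_left_invertible_ker by blast
  then show ?thesis by (simp add: invertible_left_inverse[symmetric] invertible_det_nz)
qed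

end

context hamiltonian_system
begin

definition chart_hamiltonian :: "('m, 'r) chart \<Rightarrow> real ^ ('r + 'r) \<Rightarrow> real"
  where "chart_hamiltonian c = H \<circ> chart_inv c"

definition chart_gradient :: "('m, 'r) chart \<Rightarrow> real ^ ('r + 'r) \<Rightarrow> real ^ ('r + 'r)"
  where "chart_gradient c x = (\<chi> i. frechet_derivative (chart_hamiltonian c) (at x) (axis i 1))"

text \<open>Hamilton's equations solved for the velocity by Cramer's rule, which exhibits it as \<open>C\<^sup>1\<close>.\<close>

definition chart_field :: "('m, 'r) chart \<Rightarrow> real ^ ('r + 'r) \<Rightarrow> real ^ ('r + 'r)"
  where "chart_field c x =
    (\<chi> k. det (\<chi> i j. if j = k then chart_gradient c x $ i else transpose (chart_form c x) $ i $ j)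
      / det (transpose (chart_form c x)))"

lemma chart_field_iff:
  assumes "c \<in> atlas" "x \<in> chart_image c"
  shows "transpose (chart_form c x) *v u = chart_gradient c x \<longleftrightarrow> u = chart_field c x"
  unfolding chart_field_def by (rule cramer[OF det_chart_form_nz[OF assms]])

lemma chart_hamiltonian_smooth: "c \<in> atlas \<Longrightarrow> smooth_on (chart_image c) (chart_hamiltonian c)"
  unfolding chart_hamiltonian_def by (rule hamiltonian_smooth)

lemma chart_hamiltonian_derivative:
  assumes c: "c \<in> atlas" and x: "x \<in> chart_image c"
  shows "frechet_derivative (chart_hamiltonian c) (at x) v = chart_gradient c x \<bullet> v"
proof -
  have "frechet_derivative (chart_hamiltonian c) (at x) v
      = (\<Sum>b\<in>Basis. (v \<bullet> b) *\<^sub>R frechet_derivative (chart_hamiltonian c) (at x) b)"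
    by (rule frechet_expand[OF smooth_on_C1[OF chart_hamiltonian_smooth[OF c]] x])
  also have "\<dots> = (\<Sum>i\<in>UNIV. v $ i * chart_gradient c x $ i)"
    unfolding chart_gradient_def by (simp add: sum_Basis_cart inner_axis)
  finally show ?thesis by (simp add: inner_vec_def mult.commute)
qed

lemma velocity_eq_chart_field:
  assumes c: "c \<in> atlas" and x: "x \<in> chart_image c"
    and u: "\<And>v. u \<bullet> (chart_form c x *v v) = frechet_derivative (chart_hamiltonian c) (at x) v"
  shows "u = chart_field c x"
proof -
  have "(transpose (chart_form c x) *v u) \<bullet> v = chart_gradient c x \<bullet> v" for v
    using u[of v] chart_hamiltonian_derivative[OF c x] dot_lmul_matrix[of u "chart_form c x" v] by simp
  then have "transpose (chart_form c x) *v u = chart_gradient c x" by (metis vector_eq_rdot)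
  then show ?thesis using chart_field_iff[OF c x] by blast
qed

lemma chart_field_sum:
  assumes c: "c \<in> atlas" and x: "x \<in> chart_image c"
  shows "(\<Sum>k\<in>UNIV. chart_field c x $ k * chart_form c x $ k $ j) = frechet_derivative (chart_hamiltonian c) (at x) (axis j 1)"
proof -
  have "(transpose (chart_form c x) *v chart_field c x) $ j = chart_gradient c x $ j"
    using chart_field_iff[OF c x, of "chart_field c x"] by simp
  then show ?thesis by (simp add: chart_gradient_def matrix_vector_mult_def transpose_def mult.commute)
qed

lemma chart_field_C1: assumes c: "c \<in> atlas" shows "C1_on (chart_image c) (chart_field c)"
proof (rule C1_on_vec)
  fix k
  have g: "C1_on (chart_image c) (\<lambda>x. chart_gradient c x $ i)" for i
    unfolding chart_gradient_def using smooth_on_C1[OF smooth_on_deriv[OF chart_hamiltonian_smooth[OF c]]] by simp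
  have t: "C1_on (chart_image c) (\<lambda>x. transpose (chart_form c x) $ i $ j)" for i j
    unfolding transpose_def using chart_form_C1[OF c] by simp
  have m: "C1_on (chart_image c) (\<lambda>x. (\<chi> i j. if j = k then chart_gradient c x $ i else transpose (chart_form c x) $ i $ j) $ i $ j)" for i j
    by (cases "j = k") (simp_all add: g t)
  have "C1_on (chart_image c) (\<lambda>x. det (\<chi> i j. if j = k then chart_gradient c x $ i else transpose (chart_form c x) $ i $ j)
      * inverse (det (transpose (chart_form c x))))"
    by (intro C1_on_mult C1_on_det C1_on_inverse m t det_chart_form_nz[OF c])
  then show "C1_on (chart_image c) (\<lambda>x. chart_field c x $ k)"
    by (simp add: chart_field_def divide_inverse)
qed

text \<open>Cartan's formula in coordinates: L_X W = d (i_X W) + i_X dW, where i_X W = dH is closed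
  by the symmetry of the Hessian, and dW = 0.\<close>

lemma chart_field_lie_derivative:
  assumes c: "c \<in> atlas" and x: "x \<in> chart_image c"
  shows "(\<Sum>k\<in>UNIV. matrix (frechet_derivative (chart_field c) (at x)) $ k $ i * chart_form c x $ k $ j) +
      (\<Sum>k\<in>UNIV. chart_form c x $ i $ k * matrix (frechet_derivative (chart_field c) (at x)) $ k $ j) +
      frechet_derivative (\<lambda>x. chart_form c x $ i $ j) (at x) (chart_field c x) = 0"
proof -
  let ?V = "chart_image c" and ?X = "chart_field c" and ?W = "chart_form c"
  let ?J = "matrix (frechet_derivative ?X (at x))"
  let ?D = "\<lambda>k i j. frechet_derivative (\<lambda>x. ?W x $ i $ j) (at x) (axis k 1)"
  let ?H2 = "\<lambda>i j. frechet_derivative (\<lambda>x. frechet_derivative (chart_hamiltonian c) (at x) (axis j 1)) (at x) (axis i 1)"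
  note X_has = C1_on_has_derivative[OF C1_on_component[OF chart_field_C1[OF c]] x]
  note W_has = C1_on_has_derivative[OF chart_form_C1[OF c] x]
  have J: "?J $ k $ i = frechet_derivative (\<lambda>x. ?X x $ k) (at x) (axis i 1)" for k i
    by (simp add: matrix_def frechet_derivative_component[OF chart_field_C1[OF c] x])
  \<comment> \<open>Hamilton's equation for the j-th coordinate, differentiated in direction
    i.\<close>
  have A: "(\<Sum>k\<in>UNIV. ?J $ k $ i * ?W x $ k $ j) + (\<Sum>k\<in>UNIV. ?X x $ k * ?D i k j) = ?H2 i j" for i j
  proof -
    let ?f = "\<lambda>x. \<Sum>k\<in>UNIV. ?X x $ k * ?W x $ k $ j"
    have f: "(?f has_derivative (\<lambda>v. \<Sum>k\<in>UNIV. ?X x $ k * frechet_derivative (\<lambda>x. ?W x $ k $ j) (at x) v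
        + frechet_derivative (\<lambda>x. ?X x $ k) (at x) v * ?W x $ k $ j)) (at x)"
      by (intro has_derivative_sum has_derivative_mult X_has W_has)
    have "?H2 i j = frechet_derivative ?f (at x) (axis i 1)"
      by (subst frechet_derivative_cong_open[OF image_open[OF c] x, of ?f])
         (use f chart_field_sum[OF c] in \<open>auto simp: differentiable_def\<close>)
    also have "\<dots> = (\<Sum>k\<in>UNIV. ?X x $ k * ?D i k j + ?J $ k $ i * ?W x $ k $ j)"
      unfolding frechet_derivative_at[OF f, symmetric] J ..
    finally show ?thesis by (simp add: sum.distrib)
  qed
  have sym: "?H2 i j = ?H2 j i" for i j
    by (rule second_derivative_symmetric[where f = "chart_hamiltonian c" and f' = "\<lambda>x. frechet_derivative (chart_hamiltonian c) (at x)",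
        OF image_open[OF c] x C1_on_has_derivative[OF smooth_on_C1] smooth_on_C1[OF smooth_on_deriv]])
       (simp_all add: chart_hamiltonian_smooth[OF c])
  have Dneg: "?D k i j = - ?D k j i" for k i j
  proof -
    have m: "((\<lambda>x. - ?W x $ j $ i) has_derivative (\<lambda>v. - frechet_derivative (\<lambda>x. ?W x $ j $ i) (at x) v)) (at x)"
      by (rule has_derivative_minus[OF W_has])
    have "frechet_derivative (\<lambda>x. ?W x $ i $ j) (at x) = frechet_derivative (\<lambda>x. - ?W x $ j $ i) (at x)"
      by (rule frechet_derivative_cong_open[OF image_open[OF c] x differentiableI[OF m]])
         (rule chart_form_antisym[OF c, symmetric])
    then show ?thesis unfolding frechet_derivative_at[OF m, symmetric] by (rule fun_cong)
  qed
  have closed: "?D i j k + ?D j k i + ?D k i j = 0" for i j k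
    using form_closed[OF c x, of j k i] by (simp add: chart_form_def)
  have WX: "frechet_derivative (\<lambda>x. ?W x $ i $ j) (at x) (?X x) = (\<Sum>k\<in>UNIV. ?X x $ k * ?D k i j)"
    by (subst frechet_expand[OF chart_form_C1[OF c] x]) (simp add: sum_Basis_cart inner_axis)
  have "(\<Sum>k\<in>UNIV. ?W x $ i $ k * ?J $ k $ j) = - (\<Sum>k\<in>UNIV. ?J $ k $ j * ?W x $ k $ i)"
    unfolding chart_form_antisym[OF c x, of i] by (simp add: sum_negf mult.commute)
  then have "(\<Sum>k\<in>UNIV. ?J $ k $ i * ?W x $ k $ j) + (\<Sum>k\<in>UNIV. ?W x $ i $ k * ?J $ k $ j) +
      frechet_derivative (\<lambda>x. ?W x $ i $ j) (at x) (?X x)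
      = - (\<Sum>k\<in>UNIV. ?X x $ k * ?D i k j) + (\<Sum>k\<in>UNIV. ?X x $ k * ?D j k i) + (\<Sum>k\<in>UNIV. ?X x $ k * ?D k i j)"
    using A[of i j] A[of j i] sym[of i j] unfolding WX by linarith
  also have "\<dots> = (\<Sum>k\<in>UNIV. ?X x $ k * (?D i j k + ?D j k i + ?D k i j))"
    unfolding Dneg[where k=i and j=j] by (simp add: sum_negf sum.distrib distrib_left)
  finally show ?thesis by (simp add: closed)
qed

lemma invariant_form_chart: "c \<in> atlas \<Longrightarrow> invariant_form (chart_image c) (chart_field c) (chart_form c)"
  by unfold_locales (auto intro: image_open chart_field_C1 chart_form_C1 chart_field_lie_derivative)

section \<open>Solution curves: topology of charts, uniqueness, group law\<close>

abbreviation solution :: "(real \<Rightarrow> 'm) \<Rightarrow> bool"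
  where "solution \<equiv> solves_hamilton_equations atlas \<omega> H"

lemma solution_continuous: "solution x \<Longrightarrow> continuous_on UNIV x"
  by (simp add: solves_hamilton_equations_def)

lemma solution_velocity:
  assumes x: "solution x" and c: "c \<in> atlas" and t: "x t \<in> chart_dom c"
  shows "((\<lambda>s. coord c (x s)) has_vector_derivative chart_field c (coord c (x t))) (at t)"
proof -
  obtain u where u: "((\<lambda>s. coord c (x s)) has_vector_derivative u) (at t)"
    "\<And>v. u \<bullet> (\<omega> c (x t) *v v) = frechet_derivative (H \<circ> chart_inv c) (at (coord c (x t))) v"
    using x c t unfolding solves_hamilton_equations_def by blast
  have "u = chart_field c (coord c (x t))"
    by (rule velocity_eq_chart_field[OF c coord_in_image[OF c t]])
       (simp add: chart_form_def chart_inv_coord[OF c t] u(2) chart_hamiltonian_def)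
  then show ?thesis using u(1) by simp
qed

lemma solution_shift: "solution x \<Longrightarrow> solution (\<lambda>t. x (s + t))"
proof -
  assume x: "solution x"
  have "continuous_on UNIV (\<lambda>t. x (s + t))"
    by (rule continuous_on_compose2[OF solution_continuous[OF x]]) (auto intro!: continuous_intros)
  moreover have "\<exists>u. ((\<lambda>r. coord c (x (s + r))) has_vector_derivative u) (at t) \<and>
      (\<forall>v. u \<bullet> (\<omega> c (x (s + t)) *v v) = frechet_derivative (H \<circ> chart_inv c) (at (coord c (x (s + t)))) v)"
    if ct: "c \<in> atlas" "x (s + t) \<in> chart_dom c" for t c
  proof -
    obtain u where u: "((\<lambda>r. coord c (x r)) has_vector_derivative u) (at (s + t))"
      "\<forall>v. u \<bullet> (\<omega> c (x (s + t)) *v v) = frechet_derivative (H \<circ> chart_inv c) (at (coord c (x (s + t)))) v"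
      using x ct unfolding solves_hamilton_equations_def by blast
    have "((\<lambda>r. s + r) has_vector_derivative 1) (at t)" by (auto intro!: derivative_eq_intros)
    from vector_diff_chain_at[OF this u(1)] show ?thesis
      using u(2) by (intro exI[of _ u]) (simp add: comp_def)
  qed
  ultimately show ?thesis unfolding solves_hamilton_equations_def by blast
qed

text \<open>Being closed in a chart domain does not make a set closed in the manifold. Compactness
  does, since the manifold is Hausdorff.\<close>

lemma chart_ball:
  assumes c: "c \<in> atlas" and K: "compact K" "K \<subseteq> chart_image c"
  shows "closed {m \<in> chart_dom c. coord c m \<in> K}"
proof -
  have "{m \<in> chart_dom c. coord c m \<in> K} = chart_inv c ` K"
    using K by (force simp: chart_inv_coord[OF c] coord_chart_inv[OF c] chart_inv_in_dom[OF c] image_iff)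
  moreover have "compact (chart_inv c ` K)"
    using chart_homeomorphism[OF c] K
    by (intro compact_continuous_image) (auto simp: homeomorphism_def elim: continuous_on_subset)
  ultimately show ?thesis by (simp add: compact_imp_closed)
qed

lemma chart_preimage_open:
  assumes c: "c \<in> atlas" and V: "open V"
  shows "open {m \<in> chart_dom c. coord c m \<in> V}"
proof -
  have "continuous_on (chart_dom c) (coord c)"
    using chart_homeomorphism[OF c] by (simp add: homeomorphism_def)
  then have "open (coord c -` V \<inter> chart_dom c)"
    using dom_open[OF c] V by (subst (asm) continuous_on_open_vimage) auto
  moreover have "coord c -` V \<inter> chart_dom c = {m \<in> chart_dom c. coord c m \<in> V}" by auto
  ultimately show ?thesis by simp
qed

lemma chart_image_open_subset:
  assumes c: "c \<in> atlas" and U: "open U" "U \<subseteq> chart_dom c"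
  shows "open (coord c ` U)"
proof -
  have "continuous_on (chart_image c) (chart_inv c)"
    using chart_homeomorphism[OF c] by (simp add: homeomorphism_def)
  then have "open (chart_inv c -` U \<inter> chart_image c)"
    using image_open[OF c] U by (subst (asm) continuous_on_open_vimage) auto
  moreover have "chart_inv c -` U \<inter> chart_image c = coord c ` U"
    using U(2) by (force simp: image_iff chart_inv_coord[OF c] coord_chart_inv[OF c] coord_in_image[OF c])
  ultimately show ?thesis by simp
qed

lemma chart_at:
  obtains c where "c \<in> atlas" "m \<in> chart_dom c"
  using covering by blast

text \<open>The set of times at which the curves agree is closed because the manifold is Hausdorff,
  and open by Gronwall's inequality in a chart around the common point.\<close>

lemma solution_unique:
  assumes x: "solution x" and y: "solution y" and eq: "x 0 = y 0"
  shows "x t = y t"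
proof -
  let ?T = "{t. x t = y t}"
  note xc = solution_continuous[OF x] and yc = solution_continuous[OF y]
  have "closed ?T" by (rule closed_Collect_eq[OF xc yc])
  moreover have "open ?T"
    unfolding open_dist
  proof (intro ballI)
    fix t0 assume t0: "t0 \<in> ?T"
    obtain c where c: "c \<in> atlas" "x t0 \<in> chart_dom c" using chart_at by blast
    let ?p = "coord c (x t0)" and ?X = "chart_field c"
    obtain r where r: "r > 0" "cball ?p r \<subseteq> chart_image c"
      using image_open[OF c(1)] coord_in_image[OF c] open_contains_cball by blast
    obtain L where "L > 0" and L: "\<And>a b. a \<in> cball ?p r \<Longrightarrow> b \<in> cball ?p r \<Longrightarrow> norm (?X a - ?X b) \<le> L * norm (a - b)"
      using C1_on_convex_lipschitz[OF chart_field_C1[OF c(1)] compact_cball convex_cball r(2)] by blast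
    let ?O = "{m \<in> chart_dom c. coord c m \<in> ball ?p r}"
    have O: "open ?O" by (rule chart_preimage_open[OF c(1) open_ball])
    have "open (x -` ?O \<inter> y -` ?O)"
      using open_vimage[OF O xc] open_vimage[OF O yc] by (rule open_Int)
    moreover have "t0 \<in> x -` ?O \<inter> y -` ?O" using c r t0 by auto
    ultimately obtain e where e: "e > 0" "\<And>s. dist s t0 < e \<Longrightarrow> s \<in> x -` ?O \<inter> y -` ?O"
      unfolding open_dist by blast
    have "s \<in> ?T" if s: "dist s t0 < e" for s
    proof -
      have seg: "r' \<in> x -` ?O \<inter> y -` ?O" if "r' \<in> closed_segment t0 s" for r'
        using that s by (intro e(2)) (auto simp: closed_segment_eq_real_ivl dist_real_def split: if_splits)
      have "norm (coord c (x s) - coord c (y s)) \<le> exp (L * \<bar>s - t0\<bar>) * norm (coord c (x t0) - coord c (y t0))"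
      proof (rule gronwall)
        fix r' assume "r' \<in> closed_segment t0 s"
        note sr = seg[OF this]
        show "((\<lambda>s. coord c (x s)) has_vector_derivative ?X (coord c (x r'))) (at r')"
          using sr by (intro solution_velocity x c) auto
        show "((\<lambda>s. coord c (y s)) has_vector_derivative ?X (coord c (y r'))) (at r')"
          using sr by (intro solution_velocity y c) auto
        show "norm (?X (coord c (x r')) - ?X (coord c (y r'))) \<le> L * norm (coord c (x r') - coord c (y r'))"
          using sr by (intro L) auto
      qed
      also have "\<dots> = 0" using t0 by simp
      finally have eq: "coord c (x s) = coord c (y s)" by simp
      have "x s \<in> chart_dom c" "y s \<in> chart_dom c" using e(2)[OF s] by auto
      then have "x s = chart_inv c (coord c (x s))" "y s = chart_inv c (coord c (y s))"
        by (simp_all add: chart_inv_coord[OF c(1)])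
      then show ?thesis using eq by simp
    qed
    then show "\<exists>e>0. \<forall>s. dist s t0 < e \<longrightarrow> s \<in> ?T" using e(1) by blast
  qed
  ultimately have "?T = {} \<or> ?T = UNIV" using clopen[of ?T] by blast
  then show ?thesis using eq by blast
qed

lemma flow_group: "\<gamma> m (s + t) = \<gamma> (\<gamma> m s) t"
  by (rule solution_unique[OF solution_shift[OF flow_solution] flow_solution]) (simp add: flow_initial)

lemma flow_inverse [simp]: "\<gamma> (\<gamma> m t) (- t) = m" "\<gamma> (\<gamma> m (- t)) t = m"
  using flow_group[of m t "- t"] flow_group[of m "- t" t] by (simp_all add: flow_initial)

end

text \<open>At the first time outside \<open>U\<close> the curve would be a limit of points of the
  closed set \<open>K\<close>, hence in \<open>K\<close> and so in \<open>U\<close>.\<close>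

lemma first_exit:
  fixes x :: "real \<Rightarrow> 'a::topological_space"
  assumes x: "continuous_on UNIV x" and U: "open U" and K: "closed K" "K \<subseteq> U" and x0: "x 0 \<in> U"
    and stay: "\<And>r. 0 \<le> r \<Longrightarrow> r \<le> T \<Longrightarrow> (\<And>s. 0 \<le> s \<Longrightarrow> s \<le> r \<Longrightarrow> x s \<in> U) \<Longrightarrow> x r \<in> K"
    and t: "0 \<le> t" "t \<le> T"
  shows "x t \<in> U"
proof (rule ccontr)
  assume "x t \<notin> U"
  let ?E = "{0..t} \<inter> x -` (- U)"
  have ne: "?E \<noteq> {}" using t \<open>x t \<notin> U\<close> by auto
  have bdd: "bdd_below ?E" by (rule bdd_belowI[of _ 0]) auto
  have cl: "closed ?E" using U by (intro closed_Int closed_vimage x) auto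
  define \<tau> where "\<tau> = Inf ?E"
  have \<tau>: "\<tau> \<in> ?E" unfolding \<tau>_def by (rule closed_contains_Inf[OF ne bdd cl])
  then have \<tau>0: "\<tau> > 0" using x0 by (cases "\<tau> = 0") auto
  have before: "x s \<in> U" if "0 \<le> s" "s < \<tau>" for s
  proof (rule ccontr)
    assume "x s \<notin> U"
    then have "s \<in> ?E" using that \<tau> by auto
    then have "\<tau> \<le> s" unfolding \<tau>_def by (rule cInf_lower[OF _ bdd])
    then show False using that by simp
  qed
  have "{0..<\<tau>} \<subseteq> x -` K"
    using before \<tau> t by (auto intro!: stay)
  then have "closure {0..<\<tau>} \<subseteq> x -` K"
    using K(1) by (intro closure_minimal closed_vimage x)
  then have "x \<tau> \<in> K" using \<tau>0 by (auto simp: closure_atLeastLessThan subset_iff)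
  then show False using \<tau> K(2) by auto
qed

text \<open>The counterpart of \<open>local_flow\<close> on the manifold: a ball in a chart, and a
  time so short that speed \<open>B\<close> allows a displacement of at most R / 2.\<close>

locale flow_box = hamiltonian_system atlas \<omega> H \<gamma>
  for atlas :: "('m::{t2_space, second_countable_topology}, 'r::finite) chart set"
    and \<omega> H and \<gamma> :: "'m \<Rightarrow> real \<Rightarrow> 'm" +
  fixes c :: "('m, 'r) chart" and x0 :: "real ^ ('r + 'r)" and R \<epsilon> B :: real
  assumes c: "c \<in> atlas" and R_pos: "R > 0" and ball_sub: "cball x0 (4 * R) \<subseteq> chart_image c"
    and \<epsilon>_pos: "\<epsilon> > 0" and B\<epsilon>: "B * \<epsilon> \<le> R / 2"
    and field_bound: "\<And>x. x \<in> cball x0 (4 * R) \<Longrightarrow> norm (chart_field c x) \<le> B"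
begin

definition box :: "real \<Rightarrow> 'm set"
  where "box b = {m \<in> chart_dom c. coord c m \<in> ball x0 b}"

definition closed_box :: "real \<Rightarrow> 'm set"
  where "closed_box b = {m \<in> chart_dom c. coord c m \<in> cball x0 b}"

lemma open_box: "open (box b)"
  unfolding box_def by (rule chart_preimage_open[OF c open_ball])

lemma closed_closed_box: "b \<le> 4 * R \<Longrightarrow> closed (closed_box b)"
  unfolding closed_box_def using ball_sub by (intro chart_ball[OF c compact_cball]) auto

lemma B_nonneg': "B \<ge> 0"
  using order_trans[OF norm_ge_zero field_bound[of x0]] R_pos by simp

lemma displacement_while_inside:
  assumes T: "\<And>s. s \<in> closed_segment 0 t \<Longrightarrow> \<gamma> m s \<in> box (4 * R)"
  shows "dist (coord c (\<gamma> m t)) (coord c m) \<le> B * \<bar>t\<bar>"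
proof -
  have "norm (coord c (\<gamma> m t) - coord c (\<gamma> m 0)) \<le> B * norm (t - 0)"
  proof (rule differentiable_bound[OF convex_closed_segment])
    fix s assume s: "s \<in> closed_segment 0 t"
    let ?v = "chart_field c (coord c (\<gamma> m s))"
    have in4: "\<gamma> m s \<in> chart_dom c" "coord c (\<gamma> m s) \<in> ball x0 (4 * R)"
      using T[OF s] by (auto simp: box_def)
    show "((\<lambda>s. coord c (\<gamma> m s)) has_derivative (\<lambda>r. r *\<^sub>R ?v)) (at s within closed_segment 0 t)"
      using solution_velocity[OF flow_solution c in4(1)]
      by (simp add: has_vector_derivative_def has_derivative_at_withinI)
    have "norm ?v \<le> B" using in4(2) by (intro field_bound) auto
    then show "onorm (\<lambda>r. r *\<^sub>R ?v) \<le> B"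
      by (intro onorm_le) (simp add: mult.commute[of B] mult_left_mono)
  qed auto
  then show ?thesis by (simp add: dist_norm flow_initial)
qed

text \<open>The displacement bound is valid only while the orbit stays in the box, so a first-exit
  argument is needed: as long as the orbit is within 4 R, it is in fact within 3 R + R / 2.\<close>

lemma stays_in_box:
  assumes m: "m \<in> closed_box (3 * R)" and t: "\<bar>t\<bar> \<le> \<epsilon>"
  shows "\<gamma> m t \<in> box (4 * R)"
proof -
  define \<sigma> :: real where "\<sigma> = (if t \<ge> 0 then 1 else -1)"
  have \<sigma>: "\<bar>\<sigma>\<bar> = 1" by (simp add: \<sigma>_def)
  have "\<gamma> m (\<sigma> * \<bar>t\<bar>) \<in> box (4 * R)"
  proof (rule first_exit[where x = "\<lambda>s. \<gamma> m (\<sigma> * s)" and T = \<epsilon> and K = "closed_box (3 * R + R / 2)"])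
    show "continuous_on UNIV (\<lambda>s. \<gamma> m (\<sigma> * s))"
      by (rule continuous_on_compose2[OF solution_continuous[OF flow_solution]]) (auto intro!: continuous_intros)
    show "closed (closed_box (3 * R + R / 2))" using R_pos by (intro closed_closed_box) simp
    show "closed_box (3 * R + R / 2) \<subseteq> box (4 * R)" using R_pos by (auto simp: closed_box_def box_def)
    show "\<gamma> m (\<sigma> * 0) \<in> box (4 * R)" using m R_pos by (auto simp: closed_box_def box_def flow_initial)
    fix r assume r: "0 \<le> r" "r \<le> \<epsilon>" and in_r: "\<And>s. 0 \<le> s \<Longrightarrow> s \<le> r \<Longrightarrow> \<gamma> m (\<sigma> * s) \<in> box (4 * R)"
    have "\<gamma> m s \<in> box (4 * R)" if "s \<in> closed_segment 0 (\<sigma> * r)" for s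
      using in_r[of "\<sigma> * s"] that r \<sigma> by (cases "r = 0") (auto simp: \<sigma>_def closed_segment_eq_real_ivl split: if_splits)
    from displacement_while_inside[of "\<sigma> * r" m, OF this]
    have "dist (coord c (\<gamma> m (\<sigma> * r))) (coord c m) \<le> B * r" using r \<sigma> by (simp add: abs_mult)
    also have "\<dots> \<le> R / 2" using mult_left_mono[OF r(2) B_nonneg'] B\<epsilon> by simp
    finally have "dist x0 (coord c (\<gamma> m (\<sigma> * r))) \<le> 3 * R + R / 2"
      using m dist_triangle[of x0 "coord c (\<gamma> m (\<sigma> * r))" "coord c m"] by (simp add: closed_box_def dist_commute)
    then show "\<gamma> m (\<sigma> * r) \<in> closed_box (3 * R + R / 2)"
      using in_r[of r] r by (simp add: closed_box_def box_def)
  qed (use t open_box in auto)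
  then show ?thesis by (simp add: \<sigma>_def split: if_splits)
qed

lemma displacement:
  assumes m: "m \<in> closed_box (3 * R)" and t: "\<bar>t\<bar> \<le> \<epsilon>"
  shows "dist (coord c (\<gamma> m t)) (coord c m) \<le> B * \<bar>t\<bar>"
  using t by (intro displacement_while_inside stays_in_box[OF m])
    (auto simp: closed_segment_eq_real_ivl split: if_splits)

definition \<Phi> :: "real \<Rightarrow> real ^ ('r + 'r) \<Rightarrow> real ^ ('r + 'r)"
  where "\<Phi> t x = coord c (\<gamma> (chart_inv c x) t)"

lemma chart_inv_closed_box: "b \<le> 4 * R \<Longrightarrow> x \<in> cball x0 b \<Longrightarrow> chart_inv c x \<in> closed_box b"
  using ball_sub chart_inv_in_dom[OF c, of x] coord_chart_inv[OF c, of x] by (auto simp: closed_box_def subset_iff)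

sublocale local_flow "chart_image c" "chart_field c" "chart_form c" \<Phi> x0 R \<epsilon> B
proof -
  interpret invariant_form "chart_image c" "chart_field c" "chart_form c" by (rule invariant_form_chart[OF c])
  have inv3: "chart_inv c x \<in> closed_box (3 * R)" if "x \<in> cball x0 (3 * R)" for x
    using chart_inv_closed_box[OF _ that] R_pos by simp
  have inv: "coord c (chart_inv c x) = x" if "x \<in> cball x0 (3 * R)" for x
    using that ball_sub R_pos by (intro coord_chart_inv[OF c]) auto
  show "local_flow (chart_image c) (chart_field c) (chart_form c) \<Phi> x0 R \<epsilon> B"
  proof unfold_locales
    fix x t assume x: "x \<in> cball x0 (3 * R)" and t: "\<bar>t\<bar> \<le> \<epsilon>"
    show "((\<lambda>t. \<Phi> t x) has_vector_derivative chart_field c (\<Phi> t x)) (at t)"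
      unfolding \<Phi>_def using stays_in_box[OF inv3[OF x] t]
      by (intro solution_velocity flow_solution c) (simp add: box_def)
    show "dist (\<Phi> t x) x \<le> B * \<bar>t\<bar>"
      using displacement[OF inv3[OF x] t] by (simp add: \<Phi>_def inv[OF x])
  next
    fix x t h assume x: "x \<in> cball x0 (3 * R)" and h: "\<bar>h\<bar> \<le> \<epsilon>"
    have "\<gamma> (chart_inv c x) h \<in> chart_dom c" using stays_in_box[OF inv3[OF x] h] by (simp add: box_def)
    then show "\<Phi> (t + h) x = \<Phi> t (\<Phi> h x)"
      using flow_group[of "chart_inv c x" h t] by (simp add: \<Phi>_def chart_inv_coord[OF c] add.commute)
  qed (use R_pos ball_sub \<epsilon>_pos B\<epsilon> field_bound in \<open>auto simp: \<Phi>_def flow_initial inv\<close>)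
qed

lemma box_flow_continuous:
  assumes t: "\<bar>t\<bar> \<le> \<epsilon>"
  shows "continuous_on (closed_box (3 * R)) (\<lambda>m. \<gamma> m t)"
proof -
  have m: "m \<in> chart_dom c" "coord c m \<in> cball x0 (3 * R)" if "m \<in> closed_box (3 * R)" for m
    using that by (auto simp: closed_box_def)
  have "continuous_on (closed_box (3 * R)) (coord c)"
    using chart_homeomorphism[OF c] by (auto simp: homeomorphism_def closed_box_def elim!: continuous_on_subset)
  then have 1: "continuous_on (closed_box (3 * R)) (\<lambda>m. \<Phi> t (coord c m))"
    by (rule continuous_on_compose2[OF flow_continuous[OF t]]) (use m in auto)
  have in4: "\<gamma> m t \<in> chart_dom c" if "m \<in> closed_box (3 * R)" for m
    using stays_in_box[OF that t] by (simp add: box_def)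
  have "continuous_on (chart_image c) (chart_inv c)"
    using chart_homeomorphism[OF c] by (simp add: homeomorphism_def)
  then have "continuous_on (closed_box (3 * R)) (\<lambda>m. chart_inv c (\<Phi> t (coord c m)))"
    by (rule continuous_on_compose2[OF _ 1]) (use m in4 in \<open>auto simp: \<Phi>_def chart_inv_coord[OF c] coord_in_image[OF c]\<close>)
  then show ?thesis
    by (rule continuous_on_eq) (use m in4 in \<open>simp add: \<Phi>_def chart_inv_coord[OF c]\<close>)
qed

text \<open>Uniform control of the flow at time 0: points near \<open>p\<close> all stay in
  \<open>U\<close> for a common time, since the speed bound holds on the whole box.\<close>

lemma flow_near_center:
  assumes p: "p \<in> chart_dom c" "coord c p = x0" and U: "open U" "p \<in> U"
  obtains N \<delta> where "open N" "p \<in> N" "\<delta> > 0" "\<And>q s. q \<in> N \<Longrightarrow> \<bar>s\<bar> < \<delta> \<Longrightarrow> \<gamma> q s \<in> U"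
proof -
  have "open (coord c ` (U \<inter> chart_dom c))"
    by (rule chart_image_open_subset[OF c]) (use U dom_open[OF c] in auto)
  moreover have "x0 \<in> coord c ` (U \<inter> chart_dom c)" using p U by auto
  ultimately obtain r0 where r0: "r0 > 0" "ball x0 r0 \<subseteq> coord c ` (U \<inter> chart_dom c)" by (rule openE)
  define r where "r = min r0 R"
  have r: "r > 0" "r \<le> R" "ball x0 r \<subseteq> coord c ` (U \<inter> chart_dom c)" using r0 R_pos by (auto simp: r_def)
  \<comment> \<open>Start within r / 2 of the centre and move by less than r / 2; the 1 in the time
    bound keeps the denominator positive when \<open>B\<close> is 0.\<close>
  show thesis
  proof (rule that[of "box (r / 2)" "min \<epsilon> (r / (2 * (B + 1)))"])
    show "open (box (r / 2))" by (rule open_box)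
    show "p \<in> box (r / 2)" using p r by (simp add: box_def)
    show "min \<epsilon> (r / (2 * (B + 1))) > 0" using \<epsilon>_pos r B_nonneg' by simp
    fix q s assume q: "q \<in> box (r / 2)" and s: "\<bar>s\<bar> < min \<epsilon> (r / (2 * (B + 1)))"
    have q3: "q \<in> closed_box (3 * R)" using q r by (auto simp: box_def closed_box_def)
    have se: "\<bar>s\<bar> \<le> \<epsilon>" using s by simp
    have "B * \<bar>s\<bar> \<le> (B + 1) * \<bar>s\<bar>" by (intro mult_right_mono) auto
    also have "\<dots> < r / 2" using s B_nonneg' by (simp add: field_simps)
    finally have "dist (coord c (\<gamma> q s)) (coord c q) < r / 2"
      using displacement[OF q3 se] by simp
    then have "coord c (\<gamma> q s) \<in> ball x0 r"
      using q dist_triangle[of x0 "coord c (\<gamma> q s)" "coord c q"] by (simp add: box_def dist_commute)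
    then obtain u where u: "u \<in> U" "u \<in> chart_dom c" "coord c (\<gamma> q s) = coord c u" using r(3) by blast
    have "\<gamma> q s \<in> chart_dom c" using stays_in_box[OF q3 se] by (simp add: box_def)
    then have "\<gamma> q s = u" using u(2,3) chart_inv_coord[OF c] by metis
    then show "\<gamma> q s \<in> U" using u by simp
  qed
qed

section \<open>The symplectic measure inside a flow box\<close>

context
  fixes \<nu> :: "'m measure"
  assumes sets_\<nu>: "sets \<nu> = sets borel"
    and \<nu>_chart: "\<And>A. A \<in> sets borel \<Longrightarrow> A \<subseteq> chart_dom c \<Longrightarrow>
      emeasure \<nu> A = (\<integral>\<^sup>+x\<in>coord c ` A. ennreal \<bar>top_power (\<omega> c (chart_inv c x))\<bar> \<partial>lborel)"
begin

lemma \<nu>_chart_density: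
  "A \<in> sets borel \<Longrightarrow> A \<subseteq> chart_dom c \<Longrightarrow> emeasure \<nu> A = (\<integral>\<^sup>+x. ennreal (indicator (coord c ` A) x * density x) \<partial>lborel)"
  unfolding \<nu>_chart
  by (intro nn_integral_cong) (auto simp: density_def chart_form_def indicator_def)

text \<open>The density is continuous on a compact ball. Finiteness is what the uniqueness theorem
  for measures on a generator asks for in extending invariance to Borel sets.\<close>

lemma box_finite: "emeasure \<nu> (box R) < \<infinity>"
proof -
  have "emeasure \<nu> (box R) = (\<integral>\<^sup>+x. ennreal (indicator (coord c ` box R) x * density x) \<partial>lborel)"
    by (rule \<nu>_chart_density) (use open_box in \<open>auto simp: box_def\<close>)
  also have "\<dots> \<le> (\<integral>\<^sup>+x. ennreal (indicator (cball x0 R) x *\<^sub>R density x) \<partial>lborel)"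
    by (intro nn_integral_mono ennreal_leI) (auto simp: box_def indicator_def)
  also have "\<dots> < \<infinity>"
  proof -
    have "set_integrable lborel (cball x0 R) density"
      using density_continuous ball_sub R_pos by (intro set_integrable_compact compact_cball) (auto elim!: continuous_on_subset)
    from integrableD(2)[OF this[unfolded set_integrable_def]] show ?thesis by (simp add: less_top)
  qed
  finally show ?thesis .
qed

text \<open>A point carried into \<open>box R\<close> is recovered by flowing back, which moves by
  at most R / 2, so it started within 2 R. Thus the whole preimage lies in the chart and the
  integral identity for open sets applies.\<close>

lemma box_measure_open:
  assumes U: "open U" "U \<subseteq> box R" and t: "\<bar>t\<bar> < \<epsilon>" and m: "{p. \<gamma> p t \<in> U} \<in> sets borel"
  shows "emeasure \<nu> {p. \<gamma> p t \<in> U} = emeasure \<nu> U"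
proof -
  let ?T = "{p. \<gamma> p t \<in> U}" and ?U = "coord c ` U"
  have te: "\<bar>t\<bar> \<le> \<epsilon>" "\<bar>- t\<bar> \<le> \<epsilon>" using t by auto
  have Ud: "U \<subseteq> chart_dom c" using U(2) by (auto simp: box_def)
  have T: "p \<in> closed_box (2 * R)" if "p \<in> ?T" for p
  proof -
    have q: "\<gamma> p t \<in> box R" using that U by auto
    then have q3: "\<gamma> p t \<in> closed_box (3 * R)" using R_pos by (auto simp: box_def closed_box_def)
    have "dist (coord c p) (coord c (\<gamma> p t)) \<le> R / 2"
      using displacement[OF q3 te(2)] mult_left_mono[OF te(1) B_nonneg'] B\<epsilon> by simp
    moreover have "p \<in> chart_dom c" using stays_in_box[OF q3 te(2)] by (simp add: box_def)
    ultimately show ?thesis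
      using q dist_triangle[of x0 "coord c p" "coord c (\<gamma> p t)"] R_pos by (simp add: box_def closed_box_def dist_commute)
  qed
  have Td: "?T \<subseteq> chart_dom c" using T by (auto simp: closed_box_def)
  have img: "x \<in> coord c ` ?T \<longleftrightarrow> x \<in> cball x0 (2 * R) \<and> \<Phi> t x \<in> ?U" for x
  proof
    assume "x \<in> coord c ` ?T"
    then obtain p where p: "\<gamma> p t \<in> U" "x = coord c p" by auto
    then show "x \<in> cball x0 (2 * R) \<and> \<Phi> t x \<in> ?U"
      using T[of p] Td by (auto simp: closed_box_def \<Phi>_def chart_inv_coord[OF c])
  next
    assume x: "x \<in> cball x0 (2 * R) \<and> \<Phi> t x \<in> ?U"
    then have x3: "x \<in> cball x0 (3 * R)" "x \<in> chart_image c" using R_pos ball_sub by auto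
    then have "\<gamma> (chart_inv c x) t \<in> chart_dom c"
      using stays_in_box[OF chart_inv_closed_box te(1)] R_pos by (simp add: box_def)
    moreover obtain u where u: "u \<in> U" "coord c (\<gamma> (chart_inv c x) t) = coord c u" using x by (auto simp: \<Phi>_def)
    ultimately have "\<gamma> (chart_inv c x) t \<in> U" using Ud chart_inv_coord[OF c] by (metis subsetD)
    then show "x \<in> coord c ` ?T" using coord_chart_inv[OF c x3(2)] by (intro image_eqI[of _ _ "chart_inv c x"]) auto
  qed
  have "emeasure \<nu> ?T = (\<integral>\<^sup>+x. ennreal (indicator (coord c ` ?T) x * density x) \<partial>lborel)"
    by (rule \<nu>_chart_density[OF m Td])
  also have "\<dots> = (\<integral>\<^sup>+x. ennreal (indicator (cball x0 (2 * R)) x * (indicator ?U (\<Phi> t x) * density x)) \<partial>lborel)"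
    unfolding indicator_def img by (intro nn_integral_cong) auto
  also have "\<dots> = (\<integral>\<^sup>+x. ennreal (indicator ?U x * density x) \<partial>lborel)"
  proof (rule flow_open_set_invariant[OF chart_image_open_subset[OF c U(1) Ud] _ t])
    show "?U \<subseteq> cball x0 R" using U(2) by (auto simp: box_def)
  qed
  also have "\<dots> = emeasure \<nu> U"
    using U(1) by (intro \<nu>_chart_density[symmetric] Ud) auto
  finally show ?thesis .
qed

text \<open>The measure and its image under the flow are cut down to \<open>box R\<close>, where
  they are finite and agree on the intersection-stable family of open sets. The qualified
  \<open>density\<close> constructs a measure; the short name is the density of the form in the
  chart.\<close>

lemma box_measure:
  assumes t: "\<bar>t\<bar> < \<epsilon>" and m [measurable]: "(\<lambda>p. \<gamma> p t) \<in> borel_measurable borel"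
    and A: "A \<in> sets borel" "A \<subseteq> box R"
  shows "emeasure \<nu> {p. \<gamma> p t \<in> A} = emeasure \<nu> A"
proof -
  have [measurable]: "(\<lambda>p. \<gamma> p t) \<in> measurable \<nu> borel" "box R \<in> sets borel" "box R \<in> sets \<nu>"
    using m sets_\<nu> open_box by (auto cong: measurable_cong_sets)
  have space: "space \<nu> = UNIV" using sets_eq_imp_space_eq[OF sets_\<nu>] by simp
  have M: "emeasure (Nonnegative_Lebesgue_Integration.density \<nu> (indicator (box R))) A = emeasure \<nu> (box R \<inter> A)"
    if "A \<in> sets borel" for A
    using that by (subst emeasure_restricted) (auto simp: sets_\<nu> open_box)
  have N: "emeasure (Nonnegative_Lebesgue_Integration.density (distr \<nu> borel (\<lambda>p. \<gamma> p t)) (indicator (box R))) A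
      = emeasure \<nu> {p. \<gamma> p t \<in> box R \<inter> A}" if "A \<in> sets borel" for A
    using that by (subst emeasure_restricted) (auto simp: emeasure_distr space vimage_def open_box)
  have "Nonnegative_Lebesgue_Integration.density \<nu> (indicator (box R))
      = Nonnegative_Lebesgue_Integration.density (distr \<nu> borel (\<lambda>p. \<gamma> p t)) (indicator (box R))"
  proof (rule measure_eqI_generator_eq[where E = "{U. open U}" and \<Omega> = UNIV and A = "\<lambda>_. UNIV"])
    show "Int_stable {U :: 'm set. open U}" by (auto simp: Int_stable_def)
    fix U :: "'m set" assume "U \<in> {U. open U}"
    then have U: "open U" by simp
    have "{p. \<gamma> p t \<in> box R \<inter> U} \<in> sets borel"
      using measurable_sets[OF m, of "box R \<inter> U"] U open_box by (auto simp: vimage_def)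
    then have "emeasure \<nu> {p. \<gamma> p t \<in> box R \<inter> U} = emeasure \<nu> (box R \<inter> U)"
      using U open_box by (intro box_measure_open t) auto
    then show "emeasure (Nonnegative_Lebesgue_Integration.density \<nu> (indicator (box R))) U
      = emeasure (Nonnegative_Lebesgue_Integration.density (distr \<nu> borel (\<lambda>p. \<gamma> p t)) (indicator (box R))) U"
      using U by (simp add: M N)
  qed (use box_finite in \<open>auto simp: sets_\<nu> borel_def M\<close>)
  then have "emeasure \<nu> (box R \<inter> A) = emeasure \<nu> {p. \<gamma> p t \<in> box R \<inter> A}"
    using M[OF A(1)] N[OF A(1)] by simp
  then show ?thesis using A(2) by (simp add: Int_absorb1)
qed

end

end

section \<open>Liouville's theorem\<close>

text \<open>Both the times with \<open>P\<close> and those without it form open sets, so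
  connectedness of the real line carries \<open>P\<close> from one time to all.\<close>

lemma locally_invariant_real:
  fixes P :: "real \<Rightarrow> bool"
  assumes loc: "\<And>s. \<exists>\<delta>>0. \<forall>t t'. \<bar>t - s\<bar> < \<delta> \<longrightarrow> \<bar>t' - s\<bar> < \<delta> \<longrightarrow> P t \<longrightarrow> P t'"
    and P0: "P a"
  shows "P t"
proof -
  have "open {t. P t}" "open {t. \<not> P t}"
    unfolding open_dist dist_real_def using loc by (simp_all, (metis abs_zero diff_self)+)
  then have "open {t. P t}" "closed {t. P t}" by (auto simp: closed_def Collect_neg_eq)
  then have "{t. P t} = {} \<or> {t. P t} = UNIV" using clopen[of "{t. P t}"] by blast
  then show ?thesis using P0 by blast
qed

context hamiltonian_system
begin

lemma flow_box_exists:
  obtains c x0 R \<epsilon> B where "flow_box atlas \<omega> H \<gamma> c x0 R \<epsilon> B" "p \<in> chart_dom c" "coord c p = x0"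
proof -
  obtain c where c: "c \<in> atlas" "p \<in> chart_dom c" using chart_at by blast
  let ?x0 = "coord c p"
  obtain r where r: "r > 0" "cball ?x0 r \<subseteq> chart_image c"
    using image_open[OF c(1)] coord_in_image[OF c] open_contains_cball by blast
  have "continuous_on (cball ?x0 r) (chart_field c)"
    using C1_on_continuous[OF chart_field_C1[OF c(1)]] r(2) by (rule continuous_on_subset)
  from compact_imp_bounded[OF compact_continuous_image[OF this compact_cball]]
  obtain B where B: "B > 0" "\<And>x. x \<in> cball ?x0 r \<Longrightarrow> norm (chart_field c x) \<le> B"
    by (auto simp: bounded_pos)
  \<comment> \<open>With R = r / 4 the largest ball has radius r, and the time is R / 2 divided by
    the speed bound.\<close>
  have "flow_box atlas \<omega> H \<gamma> c ?x0 (r / 4) (r / 8 / B) B"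
    using r B c by unfold_locales auto
  then show thesis using c(2) by (rule that) simp
qed

lemma flow_near_start:
  assumes U: "open U" "p \<in> U"
  obtains N \<delta> where "open N" "p \<in> N" "\<delta> > 0" "\<And>q s. q \<in> N \<Longrightarrow> \<bar>s\<bar> < \<delta> \<Longrightarrow> \<gamma> q s \<in> U"
proof -
  obtain c x0 R \<epsilon> B where b: "flow_box atlas \<omega> H \<gamma> c x0 R \<epsilon> B" and p: "p \<in> chart_dom c" "coord c p = x0"
    using flow_box_exists by blast
  interpret flow_box atlas \<omega> H \<gamma> c x0 R \<epsilon> B by (rule b)
  show thesis using flow_near_center[OF p U] that by blast
qed

lemma flow_isCont_near:
  obtains N \<epsilon> where "open N" "p \<in> N" "\<epsilon> > 0" "\<And>q s. q \<in> N \<Longrightarrow> \<bar>s\<bar> < \<epsilon> \<Longrightarrow> isCont (\<lambda>m. \<gamma> m s) q"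
proof -
  obtain c x0 R \<epsilon> B where b: "flow_box atlas \<omega> H \<gamma> c x0 R \<epsilon> B" and p: "p \<in> chart_dom c" "coord c p = x0"
    using flow_box_exists by blast
  interpret flow_box atlas \<omega> H \<gamma> c x0 R \<epsilon> B by (rule b)
  show thesis
  proof (rule that[of "box R" \<epsilon>])
    show "p \<in> box R" using p R_pos by (simp add: box_def)
    fix q s assume q: "q \<in> box R" and s: "\<bar>s\<bar> < \<epsilon>"
    have "continuous_on (box R) (\<lambda>m. \<gamma> m s)"
      using s R_pos by (intro continuous_on_subset[OF box_flow_continuous]) (auto simp: box_def closed_box_def)
    then show "isCont (\<lambda>m. \<gamma> m s) q"
      using q open_box by (simp add: continuous_on_eq_continuous_at)
  qed (use open_box \<epsilon>_pos in auto)
qed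

lemma orbit_near:
  assumes "open N" "\<gamma> m s \<in> N"
  obtains \<delta> where "\<delta> > 0" "\<And>t. \<bar>t - s\<bar> < \<delta> \<Longrightarrow> \<gamma> m t \<in> N"
proof -
  have "open (\<gamma> m -` N)" using assms(1) solution_continuous[OF flow_solution] by (rule open_vimage)
  then show thesis using assms(2) that unfolding open_dist dist_real_def by auto
qed

text \<open>For times \<open>t\<close> and \<open>t'\<close> close to \<open>s\<close>, the flow for
  \<open>t'\<close> is the flow for \<open>t\<close> followed by a short flow starting near
  \<open>\<gamma> m s\<close>, which is continuous there. This spreads continuity from time 0 to all
  times.\<close>

lemma flow_isCont: "isCont (\<lambda>m. \<gamma> m t) m"
proof (rule locally_invariant_real[where P = "\<lambda>t. isCont (\<lambda>m. \<gamma> m t) m" and a = 0])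
  fix s
  obtain N \<epsilon> where N: "open N" "\<gamma> m s \<in> N" "\<epsilon> > 0"
    "\<And>q s. q \<in> N \<Longrightarrow> \<bar>s\<bar> < \<epsilon> \<Longrightarrow> isCont (\<lambda>m. \<gamma> m s) q" using flow_isCont_near by blast
  obtain \<delta> where \<delta>: "\<delta> > 0" "\<And>t. \<bar>t - s\<bar> < \<delta> \<Longrightarrow> \<gamma> m t \<in> N" using orbit_near[OF N(1,2)] by blast
  have "isCont (\<lambda>m. \<gamma> m t') m" if "\<bar>t - s\<bar> < min \<delta> (\<epsilon> / 2)" "\<bar>t' - s\<bar> < min \<delta> (\<epsilon> / 2)" "isCont (\<lambda>m. \<gamma> m t) m" for t t'
  proof -
    have "\<bar>t' - t\<bar> < \<epsilon>" using that(1,2) by linarith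
    then have "isCont (\<lambda>m. \<gamma> m (t' - t)) (\<gamma> m t)" using that(1) \<delta> by (intro N(4)) auto
    from isCont_o2[OF that(3) this] show ?thesis by (simp add: flow_group[symmetric])
  qed
  moreover have "min \<delta> (\<epsilon> / 2) > 0" using \<delta>(1) N(3) by simp
  ultimately show "\<exists>\<delta>>0. \<forall>t t'. \<bar>t - s\<bar> < \<delta> \<longrightarrow> \<bar>t' - s\<bar> < \<delta> \<longrightarrow> isCont (\<lambda>m. \<gamma> m t) m \<longrightarrow> isCont (\<lambda>m. \<gamma> m t') m"
    by blast
next
  show "isCont (\<lambda>m. \<gamma> m 0) m" unfolding flow_initial by (rule continuous_ident)
qed

lemma flow_continuous_on: "continuous_on UNIV (\<lambda>p. \<gamma> p t)"
  by (intro continuous_at_imp_continuous_on ballI flow_isCont)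

lemma flow_vimage_open:
  assumes "open U" shows "open {p. \<gamma> p t \<in> U}"
proof -
  have "open ((\<lambda>p. \<gamma> p t) -` U)" by (rule open_vimage[OF assms flow_continuous_on])
  then show ?thesis by (simp add: vimage_def)
qed

lemma flow_borel [measurable]: "(\<lambda>p. \<gamma> p t) \<in> borel_measurable borel"
  by (rule borel_measurable_continuous_onI[OF flow_continuous_on])

text \<open>Joint continuity: for \<open>s\<close> near \<open>t\<close>, the point
  \<open>\<gamma> p s\<close> arises from \<open>\<gamma> p t\<close> by a short flow, and short
  flows are controlled uniformly near \<open>\<gamma> m t\<close>.\<close>

lemma flow_jointly_borel: "(\<lambda>(t, m). \<gamma> m t) \<in> measurable (borel \<Otimes>\<^sub>M borel) borel"
proof -
  have "open ((\<lambda>(t, m). \<gamma> m t) -` U)" if U: "open U" for U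
  proof (rule open_prod_intro)
    fix z assume "z \<in> (\<lambda>(t, m). \<gamma> m t) -` U"
    then obtain t m where z: "z = (t, m)" "\<gamma> m t \<in> U" by (cases z) auto
    obtain N \<delta> where N: "open N" "\<gamma> m t \<in> N" "\<delta> > 0" "\<And>q s. q \<in> N \<Longrightarrow> \<bar>s\<bar> < \<delta> \<Longrightarrow> \<gamma> q s \<in> U"
      using flow_near_start[OF U z(2)] by blast
    have "\<gamma> p s \<in> U" if "dist t s < \<delta>" "\<gamma> p t \<in> N" for p s
      using N(4)[OF that(2), of "s - t"] that(1) by (simp add: flow_group[symmetric] dist_real_def)
    then show "\<exists>A B. open A \<and> open B \<and> z \<in> A \<times> B \<and> A \<times> B \<subseteq> (\<lambda>(t, m). \<gamma> m t) -` U"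
      using N flow_vimage_open[OF N(1)] z by (intro exI[of _ "ball t \<delta>"] exI[of _ "{p. \<gamma> p t \<in> N}"]) auto
  qed
  then have "continuous_on UNIV (\<lambda>(t, m). \<gamma> m t)" by (simp add: continuous_on_open_vimage)
  then show ?thesis unfolding borel_prod by (rule borel_measurable_continuous_onI)
qed

text \<open>Along a solution with velocity X the derivative of \<open>H\<close> is dH(X) =
  \<omega>(X, X), which is 0 for an alternating form.\<close>

lemma hamiltonian_conserved: "H (\<gamma> m t) = H m"
proof -
  have "((\<lambda>t. H (\<gamma> m t)) has_real_derivative 0) (at t)" for t
  proof -
    obtain c where c: "c \<in> atlas" "\<gamma> m t \<in> chart_dom c" using chart_at by blast
    let ?x = "coord c (\<gamma> m t)"
    have x: "?x \<in> chart_image c" by (rule coord_in_image[OF c])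
    have "(chart_hamiltonian c has_derivative frechet_derivative (chart_hamiltonian c) (at ?x)) (at ?x)"
      by (rule C1_on_has_derivative[OF smooth_on_C1[OF chart_hamiltonian_smooth[OF c(1)]] x])
    with solution_velocity[OF flow_solution c]
    have "((\<lambda>s. chart_hamiltonian c (coord c (\<gamma> m s))) has_derivative
        (\<lambda>r. frechet_derivative (chart_hamiltonian c) (at ?x) (r *\<^sub>R chart_field c ?x))) (at t)"
      unfolding has_vector_derivative_def by (rule has_derivative_compose)
    moreover have "frechet_derivative (chart_hamiltonian c) (at ?x) (r *\<^sub>R chart_field c ?x) = 0" for r
    proof -
      let ?X = "chart_field c ?x"
      have "chart_gradient c ?x \<bullet> ?X = (transpose (chart_form c ?x) *v ?X) \<bullet> ?X"
        using chart_field_iff[OF c(1) x, of ?X] by simp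
      also have "\<dots> = ?X \<bullet> (\<omega> c (\<gamma> m t) *v ?X)"
        by (simp add: dot_lmul_matrix chart_form_def chart_inv_coord[OF c])
      also have "\<dots> = 0" by (rule form_alternating[OF c])
      finally show ?thesis by (simp add: chart_hamiltonian_derivative[OF c(1) x])
    qed
    ultimately have "((\<lambda>s. chart_hamiltonian c (coord c (\<gamma> m s))) has_derivative (\<lambda>_. 0)) (at t)" by simp
    moreover have "open (\<gamma> m -` chart_dom c)"
      by (rule open_vimage[OF dom_open[OF c(1)] solution_continuous[OF flow_solution]])
    ultimately have "((\<lambda>s. H (\<gamma> m s)) has_derivative (\<lambda>_. 0)) (at t)"
      by (rule has_derivative_transform_within_open)
         (use c in \<open>auto simp: chart_hamiltonian_def chart_inv_coord[OF c(1)]\<close>)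
    then show ?thesis by (simp add: has_field_derivative_def lambda_zero)
  qed
  then have "H (\<gamma> m t) = H (\<gamma> m 0)" by (metis DERIV_isconst_all)
  then show ?thesis by (simp add: flow_initial)
qed

lemma hamiltonian_continuous: "continuous_on UNIV H"
proof (intro continuous_at_imp_continuous_on ballI)
  fix m
  obtain c where c: "c \<in> atlas" "m \<in> chart_dom c" using chart_at by blast
  have cc: "continuous_on (chart_dom c) (coord c)"
    using chart_homeomorphism[OF c(1)] by (simp add: homeomorphism_def)
  have "continuous_on (chart_dom c) (\<lambda>p. chart_hamiltonian c (coord c p))"
    by (rule continuous_on_compose2[OF C1_on_continuous[OF smooth_on_C1[OF chart_hamiltonian_smooth[OF c(1)]]] cc])
       (auto simp: coord_in_image[OF c(1)])
  then have "continuous_on (chart_dom c) H"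
    by (rule continuous_on_eq) (simp add: chart_hamiltonian_def chart_inv_coord[OF c(1)])
  then show "isCont H m" using c dom_open by (simp add: continuous_on_eq_continuous_at)
qed

section \<open>Invariance of the symplectic measure and of the Gibbs measure\<close>

context
  fixes \<nu> :: "'m measure"
  assumes sets_\<nu>: "sets \<nu> = sets borel"
    and \<nu>_chart: "\<And>c A. c \<in> atlas \<Longrightarrow> A \<in> sets borel \<Longrightarrow> A \<subseteq> chart_dom c \<Longrightarrow>
      emeasure \<nu> A = (\<integral>\<^sup>+x\<in>coord c ` A. ennreal \<bar>top_power (\<omega> c (chart_inv c x))\<bar> \<partial>lborel)"
begin

lemma flow_preserves_near_start:
  obtains N \<epsilon> where "open N" "p \<in> N" "\<epsilon> > 0"
    "\<And>A s. A \<in> sets borel \<Longrightarrow> A \<subseteq> N \<Longrightarrow> \<bar>s\<bar> < \<epsilon> \<Longrightarrow> emeasure \<nu> {q. \<gamma> q s \<in> A} = emeasure \<nu> A"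
proof -
  obtain c x0 R \<epsilon> B where b: "flow_box atlas \<omega> H \<gamma> c x0 R \<epsilon> B" and p: "p \<in> chart_dom c" "coord c p = x0"
    using flow_box_exists by blast
  interpret flow_box atlas \<omega> H \<gamma> c x0 R \<epsilon> B by (rule b)
  show thesis
  proof (rule that[of "box R" \<epsilon>, OF open_box _ \<epsilon>_pos])
    show "p \<in> box R" using p R_pos by (simp add: box_def)
    show "emeasure \<nu> {q. \<gamma> q s \<in> A} = emeasure \<nu> A" if "A \<in> sets borel" "A \<subseteq> box R" "\<bar>s\<bar> < \<epsilon>" for A s
      by (rule box_measure[OF sets_\<nu> \<nu>_chart[OF c] that(3) flow_borel that(1,2)])
  qed
qed

text \<open>\<open>{p. \<gamma> p (- t) \<in> A}\<close> is the image of \<open>A\<close> under the flow for time \<open>t\<close>.\<close>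

lemma flow_preserves_near:
  "\<exists>N. open N \<and> m \<in> N \<and> (\<forall>A\<in>sets borel. A \<subseteq> N \<longrightarrow> emeasure \<nu> {p. \<gamma> p (- t) \<in> A} = emeasure \<nu> A)"
  (is "?P t")
proof (rule locally_invariant_real[where P = ?P and a = 0])
  show "?P 0" by (intro exI[of _ UNIV]) (simp add: flow_initial)
next
  fix s
  obtain N \<epsilon> where N: "open N" "\<gamma> m s \<in> N" "\<epsilon> > 0"
    "\<And>A s. A \<in> sets borel \<Longrightarrow> A \<subseteq> N \<Longrightarrow> \<bar>s\<bar> < \<epsilon> \<Longrightarrow> emeasure \<nu> {q. \<gamma> q s \<in> A} = emeasure \<nu> A"
    using flow_preserves_near_start by blast
  obtain \<delta> where \<delta>: "\<delta> > 0" "\<And>t. \<bar>t - s\<bar> < \<delta> \<Longrightarrow> \<gamma> m t \<in> N" using orbit_near[OF N(1,2)] by blast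
  have "?P t'" if t: "\<bar>t - s\<bar> < min \<delta> (\<epsilon> / 2)" "\<bar>t' - s\<bar> < min \<delta> (\<epsilon> / 2)" and P: "?P t" for t t'
  proof -
    obtain N' where N': "open N'" "m \<in> N'"
      "\<And>A. A \<in> sets borel \<Longrightarrow> A \<subseteq> N' \<Longrightarrow> emeasure \<nu> {p. \<gamma> p (- t) \<in> A} = emeasure \<nu> A" using P by blast
    \<comment> \<open>The neighbourhood is shrunk so that time \<open>t\<close> carries it into
      \<open>N\<close>. The image of \<open>A\<close> at time \<open>t\<close> then lies in
      \<open>N\<close>, where the remaining short flow for time \<open>t' - t\<close> preserves the
      measure.\<close>
    show ?thesis
    proof (intro exI[of _ "N' \<inter> {p. \<gamma> p t \<in> N}"] conjI ballI impI)
      show "open (N' \<inter> {p. \<gamma> p t \<in> N})" by (intro open_Int N' flow_vimage_open N)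
      show "m \<in> N' \<inter> {p. \<gamma> p t \<in> N}" using N' \<delta>(2) t by auto
      fix A :: "'m set" assume A: "A \<in> sets borel" "A \<subseteq> N' \<inter> {p. \<gamma> p t \<in> N}"
      let ?C = "{p. \<gamma> p (- t) \<in> A}"
      have C: "?C \<in> sets borel" using measurable_sets[OF flow_borel[of "- t"] A(1)] by (simp add: vimage_def)
      have CN: "?C \<subseteq> N" using A(2) by fastforce
      have tt: "\<bar>t - t'\<bar> < \<epsilon>" using t by linarith
      have "{p. \<gamma> p (- t') \<in> A} = {p. \<gamma> p (t - t') \<in> ?C}" by (simp add: flow_group[symmetric])
      then have "emeasure \<nu> {p. \<gamma> p (- t') \<in> A} = emeasure \<nu> ?C"
        using N(4)[OF C CN tt] by simp
      also have "\<dots> = emeasure \<nu> A" using A by (intro N') auto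
      finally show "emeasure \<nu> {p. \<gamma> p (- t') \<in> A} = emeasure \<nu> A" .
    qed
  qed
  moreover have "min \<delta> (\<epsilon> / 2) > 0" using \<delta>(1) N(3) by simp
  ultimately show "\<exists>\<delta>>0. \<forall>t t'. \<bar>t - s\<bar> < \<delta> \<longrightarrow> \<bar>t' - s\<bar> < \<delta> \<longrightarrow> ?P t \<longrightarrow> ?P t'" by blast
qed

text \<open>Each point has a neighbourhood on whose Borel subsets the measure is preserved. By
  second countability, countably many of these cover the manifold; cutting \<open>A\<close> into
  disjoint pieces inside them and summing gives the claim.\<close>

theorem liouville: "distr \<nu> borel (\<lambda>p. \<gamma> p t) = \<nu>"
proof (rule measure_eqI)
  show "sets (distr \<nu> borel (\<lambda>p. \<gamma> p t)) = sets \<nu>" by (simp add: sets_\<nu>)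
  fix A assume "A \<in> sets (distr \<nu> borel (\<lambda>p. \<gamma> p t))"
  then have A: "A \<in> sets borel" by simp
  have [measurable]: "(\<lambda>p. \<gamma> p t) \<in> measurable \<nu> borel"
    using flow_borel sets_\<nu> by (simp cong: measurable_cong_sets)
  have space: "space \<nu> = UNIV" using sets_eq_imp_space_eq[OF sets_\<nu>] by simp
  \<comment> \<open>The local statement concerns images under the flow; taken at time
    \<open>- t\<close> it becomes one about preimages at time \<open>t\<close>.\<close>
  obtain N where N: "\<And>m. open (N m)" "\<And>m. m \<in> N m"
    "\<And>m A. A \<in> sets borel \<Longrightarrow> A \<subseteq> N m \<Longrightarrow> emeasure \<nu> {p. \<gamma> p t \<in> A} = emeasure \<nu> A"
    using flow_preserves_near[of _ "- t"] by (simp, metis)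
  obtain F where F: "F \<subseteq> range N" "countable F" "\<Union>F = \<Union>(range N)"
    using Lindelof[of "range N"] N(1) by auto
  have F_UN: "\<Union>F = UNIV" using F(3) N(2) by blast
  then have ne: "F \<noteq> {}" by auto
  define E where "E = (\<lambda>i. A \<inter> disjointed (from_nat_into F) i)"
  have in_F: "from_nat_into F i \<in> F" for i by (rule from_nat_into[OF ne])
  have Fo: "open (from_nat_into F i)" for i using in_F[of i] F(1) N(1) by auto
  have E_meas: "E i \<in> sets borel" for i
    unfolding E_def disjointed_def using A Fo by (intro sets.Int sets.Diff sets.finite_UN) auto
  have E_disj: "disjoint_family E"
    using disjoint_family_disjointed[of "from_nat_into F"] by (auto simp: E_def disjoint_family_on_def)
  have E_UN: "(\<Union>i. E i) = A"
    using F_UN by (simp add: E_def Int_UN_distrib[symmetric] UN_disjointed_eq range_from_nat_into[OF ne F(2)])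
  have E_eq: "emeasure \<nu> {p. \<gamma> p t \<in> E i} = emeasure \<nu> (E i)" for i
  proof -
    obtain m where "from_nat_into F i = N m" using in_F[of i] F(1) by auto
    then have "E i \<subseteq> N m" using disjointed_subset[of "from_nat_into F" i] by (auto simp: E_def)
    then show ?thesis by (rule N(3)[OF E_meas])
  qed
  have "emeasure (distr \<nu> borel (\<lambda>p. \<gamma> p t)) A = emeasure (distr \<nu> borel (\<lambda>p. \<gamma> p t)) (\<Union>i. E i)"
    by (simp add: E_UN)
  also have "\<dots> = (\<Sum>i. emeasure (distr \<nu> borel (\<lambda>p. \<gamma> p t)) (E i))"
    by (rule suminf_emeasure[symmetric]) (use E_meas E_disj in auto)
  also have "\<dots> = (\<Sum>i. emeasure \<nu> (E i))"
    using E_meas by (simp add: emeasure_distr space vimage_def E_eq)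
  also have "\<dots> = emeasure \<nu> (\<Union>i. E i)" by (rule suminf_emeasure) (use E_meas E_disj sets_\<nu> in auto)
  finally show "emeasure (distr \<nu> borel (\<lambda>p. \<gamma> p t)) A = emeasure \<nu> A" by (simp add: E_UN)
qed

lemma gibbs_measure_flow:
  assumes fin: "integrable \<nu> (\<lambda>m. exp (- \<beta> * H m))"
  shows "measure_flow (density \<nu> (\<lambda>m. ennreal (exp (- \<beta> * H m)))) (\<lambda>t m. \<gamma> m t)"
proof -
  let ?g = "\<lambda>m. ennreal (exp (- \<beta> * H m))"
  let ?M = "density \<nu> ?g"
  have H [measurable]: "H \<in> borel_measurable borel"
    by (rule borel_measurable_continuous_onI[OF hamiltonian_continuous])
  have cong: "measurable \<nu> M = measurable borel M" for M :: "'b measure"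
    by (rule measurable_cong_sets[OF sets_\<nu> refl])
  have gm [measurable]: "?g \<in> borel_measurable \<nu>" and [measurable]: "(\<lambda>p. \<gamma> p t) \<in> measurable \<nu> borel" for t unfolding cong by measurable
  have space: "space \<nu> = UNIV" using sets_eq_imp_space_eq[OF sets_\<nu>] by simp
  interpret finite_measure ?M
  proof (rule finite_measureI)
    show "emeasure ?M (space ?M) \<noteq> \<infinity>"
    proof -
      have "emeasure ?M (space ?M) = (\<integral>\<^sup>+x. ?g x * indicator (space \<nu>) x \<partial>\<nu>)"
        unfolding space_density by (rule emeasure_density[OF gm sets.top])
      also have "\<dots> = (\<integral>\<^sup>+x. ?g x \<partial>\<nu>)" by (intro nn_integral_cong) (simp add: indicator_def)
      finally show ?thesis using integrableD(2)[OF fin] by (simp add: less_top)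
    qed
  qed
  show ?thesis
  proof unfold_locales
    have eq: "measurable (lborel \<Otimes>\<^sub>M ?M) ?M = measurable (borel \<Otimes>\<^sub>M borel) borel"
      by (intro measurable_cong_sets sets_pair_measure_cong) (simp_all add: sets_\<nu>)
    show "(\<lambda>(t, x). \<gamma> x t) \<in> measurable (lborel \<Otimes>\<^sub>M ?M) ?M" unfolding eq by (rule flow_jointly_borel)
    show "\<gamma> x 0 = x" for x by (rule flow_initial)
    show "\<gamma> x (s + t) = \<gamma> (\<gamma> x t) s" for x s t using flow_group[of x t s] by (simp add: add.commute)
    show "space ?M = UNIV" by (simp add: space)
    fix t
    show "distr ?M ?M (\<lambda>m. \<gamma> m t) = ?M"
    proof (rule measure_eqI)
      fix A assume "A \<in> sets (distr ?M ?M (\<lambda>m. \<gamma> m t))"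
      then have A [measurable]: "A \<in> sets borel" by (simp add: sets_\<nu>)
      have m: "(\<lambda>m. \<gamma> m t) \<in> measurable ?M ?M"
        using flow_borel by (simp add: sets_\<nu> cong: measurable_cong_sets)
      have A': "{p. \<gamma> p t \<in> A} \<in> sets borel" using measurable_sets[OF flow_borel[of t] A] by (simp add: vimage_def)
      have "emeasure (distr ?M ?M (\<lambda>m. \<gamma> m t)) A = emeasure ?M {p. \<gamma> p t \<in> A}"
        using m A by (subst emeasure_distr) (simp_all add: sets_\<nu> space vimage_def)
      also have "\<dots> = (\<integral>\<^sup>+p. ?g p * indicator {p. \<gamma> p t \<in> A} p \<partial>\<nu>)"
        using A' by (intro emeasure_density gm) (simp_all add: sets_\<nu>)
      \<comment> \<open>Conservation of \<open>H\<close> makes the whole integrand a function of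
        \<open>\<gamma> p t\<close>, as the transformation rule for image measures requires.\<close>
      also have "\<dots> = (\<integral>\<^sup>+p. ?g (\<gamma> p t) * indicator A (\<gamma> p t) \<partial>\<nu>)"
        by (simp add: hamiltonian_conserved indicator_def)
      also have "\<dots> = (\<integral>\<^sup>+p. ?g p * indicator A p \<partial>distr \<nu> borel (\<lambda>p. \<gamma> p t))"
        by (subst nn_integral_distr) auto
      also have "\<dots> = emeasure ?M A"
        unfolding liouville using A by (intro emeasure_density[symmetric] gm) (simp_all add: sets_\<nu>)
      finally show "emeasure (distr ?M ?M (\<lambda>m. \<gamma> m t)) A = emeasure ?M A" .
    qed simp
  qed
qed

end

end

section \<open>Autocorrelation and orbital average\<close>

text \<open>Completion decides measurability from almost everywhere equality. Both \<open>dm\<close>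
  and \<open>lebesgue\<close> are completions, and these facts bring their integrals down to the
  Borel level.\<close>

lemma
  fixes f g :: "'a \<Rightarrow> real"
  assumes g: "g \<in> borel_measurable M" and ae: "AE x in M. f x = g x"
  shows completion_measurable_cong_AE: "f \<in> borel_measurable (completion M)"
    and completion_integrable_cong_AE: "integrable (completion M) f \<longleftrightarrow> integrable M g"
    and completion_integral_cong_AE: "integral\<^sup>L (completion M) f = integral\<^sup>L M g"
proof -
  have ae': "AE x in completion M. f x = g x" by (rule AE_completion[OF ae])
  have gc: "g \<in> borel_measurable (completion M)" by (rule measurable_completion[OF g])
  show f: "f \<in> borel_measurable (completion M)"
  proof (rule measurableI)
    fix A :: "real set" assume A: "A \<in> sets borel"
    show "f -` A \<inter> space (completion M) \<in> sets (completion M)"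
    proof (rule completion.in_sets_AE)
      show "AE x in completion M. (x \<in> g -` A \<inter> space (completion M)) = (x \<in> f -` A \<inter> space (completion M))"
        using ae' by eventually_elim auto
      show "g -` A \<inter> space (completion M) \<in> sets (completion M)" by (rule measurable_sets[OF gc A])
    qed auto
  qed simp
  show "integrable (completion M) f \<longleftrightarrow> integrable M g"
    using integrable_cong_AE[OF f gc ae'] integrable_completion[OF g] by simp
  show "integral\<^sup>L (completion M) f = integral\<^sup>L M g"
    using integral_cong_AE[OF f gc ae'] integral_completion[OF g] by simp
qed

lemma time_average_eq:
  assumes "has_time_average f l" shows "time_average f = l"
  unfolding time_average_def
  using assms by (intro the_equality) (auto simp: has_time_average_def intro: tendsto_unique[OF trivial_limit_at_top_linorder])

text \<open>Time averages are defined with Lebesgue measure, so a function of time may be altered on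
  a null set, even a non-Borel one. This is needed because \<open>A\<close> is followed along orbits
  through its Borel representative.\<close>

lemma has_time_average_cong_AE:
  fixes f g :: "real \<Rightarrow> real"
  assumes g: "\<And>T. set_integrable lborel {0..T} g" and ae: "AE t in lborel. f t = g t"
    and lim: "((\<lambda>T. (LINT t:{0..T}|lborel. g t) / T) \<longlongrightarrow> l) at_top"
  shows "has_time_average f l"
proof -
  have m: "(\<lambda>t. indicator {0..T} t *\<^sub>R g t) \<in> borel_measurable lborel" for T
    using g[of T] unfolding set_integrable_def by (rule borel_measurable_integrable)
  have ae': "AE t in lborel. indicator {0..T} t *\<^sub>R f t = indicator {0..T} t *\<^sub>R g t" for T
    using ae by eventually_elim simp
  have "set_integrable lebesgue {0..T} f" for T
    using g[of T] unfolding set_integrable_def completion_integrable_cong_AE[OF m ae'] .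
  moreover have "(LINT t:{0..T}|lebesgue. f t) = (LINT t:{0..T}|lborel. g t)" for T
    unfolding set_lebesgue_integral_def by (rule completion_integral_cong_AE[OF m ae'])
  ultimately show ?thesis using lim by (simp add: has_time_average_def)
qed

lemma abs_powr_2: "\<bar>x :: real\<bar> powr 2 = x\<^sup>2" by (cases "x = 0") (auto simp: powr_numeral)

context measure_flow
begin

lemma flow_AE:
  assumes "AE x in M. P x" shows "AE x in M. P (\<phi> t x)"
  using AE_distrD[OF flow_at_measurable[of t], of P] assms unfolding flow_distr by blast

text \<open>At each fixed time the set of bad points is null by invariance. Fubini, applied to a
  measurable null set containing them, exchanges the quantifiers over times and points.\<close>

lemma flow_AE_lborel:
  assumes "AE x in M. P x" shows "AE x in M. AE t in lborel. P (\<phi> t x)"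
proof -
  obtain N where N: "N \<in> sets M" "emeasure M N = 0" "\<And>x. \<not> P x \<Longrightarrow> x \<in> N"
    using AE_E[OF assms] by (auto simp: subset_iff)
  have ae: "AE x in M. x \<notin> N" using N by (intro AE_not_in) auto
  have "AE x in M. AE t in lborel. \<phi> t x \<notin> N"
  proof (subst pr.AE_commute[symmetric])
    have [measurable]: "N \<in> sets M" by (rule N)
    show "{z \<in> space (lborel \<Otimes>\<^sub>M M). \<phi> (fst z) (snd z) \<notin> N} \<in> sets (lborel \<Otimes>\<^sub>M M)"
      using measurable_sets[OF flow_measurable, of "- N"] N(1) sets.compl_sets[OF N(1)]
      by (simp add: vimage_def split_beta Compl_eq_Diff_UNIV Int_def conj_commute)
    show "AE t in lborel. AE x in M. \<phi> t x \<notin> N" using flow_AE[OF ae] by simp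
  qed
  then show ?thesis
  proof eventually_elim
    case (elim x)
    then show ?case by (rule eventually_mono) (use N(3) in blast)
  qed
qed

end

text \<open>\<open>time_average\<close> is a definite description, so the equation is meaningful
  only together with the existence of the limits. The conclusion asserts that existence for almost
  every orbit and for the correlation, and integrability of the squared orbital average, which makes
  its norm a genuine integral.\<close>

theorem theorem4:
  fixes atlas :: "('m::{t2_space, second_countable_topology}, 'r::finite) chart set"
    and \<omega> :: "('m, 'r) chart \<Rightarrow> 'm \<Rightarrow> real ^ ('r + 'r) ^ ('r + 'r)"
    and H A :: "'m \<Rightarrow> real"
    and \<gamma> :: "'m \<Rightarrow> real \<Rightarrow> 'm"
    and dm :: "'m measure"
    and \<beta> :: real
  assumes "hamiltonian_system atlas \<omega> H \<gamma>"
    and "is_symplectic_measure atlas \<omega> dm"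
    and "\<beta> > 0"
    and "partition_finite dm H \<beta>"
    and "A \<in> Lp_beta dm H \<beta> 1 \<inter> Lp_beta dm H \<beta> 2"
  shows "(AE m in dm. \<exists>l. has_time_average (\<lambda>t. A (\<gamma> m t)) l) \<and>
         orbital_average \<gamma> A \<in> Lp_beta dm H \<beta> 2 \<and>
         (\<exists>l. has_time_average (correlation_at dm H \<beta> \<gamma> A) l) \<and>
         autocorrelation dm H \<beta> \<gamma> A = (norm_beta dm H \<beta> (orbital_average \<gamma> A))\<^sup>2"
proof -
  interpret hamiltonian_system atlas \<omega> H \<gamma> by fact
  obtain \<nu> where \<nu>: "sets \<nu> = sets borel" "dm = completion \<nu>"
    and \<nu>_chart: "\<And>c A. c \<in> atlas \<Longrightarrow> A \<in> sets borel \<Longrightarrow> A \<subseteq> chart_dom c \<Longrightarrow>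
      emeasure \<nu> A = (\<integral>\<^sup>+x\<in>coord c ` A. ennreal \<bar>top_power (\<omega> c (chart_inv c x))\<bar> \<partial>lborel)"
    using assms(2) unfolding is_symplectic_measure_def by blast
  let ?g = "\<lambda>m. exp (- \<beta> * H m)"
  let ?M = "density \<nu> (\<lambda>m. ennreal (?g m))"
  have cong: "measurable \<nu> N = measurable borel N" for N :: "real measure"
    by (rule measurable_cong_sets[OF \<nu>(1) refl])
  have [measurable]: "H \<in> borel_measurable borel"
    by (rule borel_measurable_continuous_onI[OF hamiltonian_continuous])
  have g [measurable]: "?g \<in> borel_measurable \<nu>" unfolding cong by measurable
  have Z_fin: "integrable \<nu> ?g"
    using assms(4) unfolding partition_finite_def \<nu>(2) integrable_completion[OF g] .
  interpret measure_flow ?M "\<lambda>t m. \<gamma> m t"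
    by (rule gibbs_measure_flow[OF \<nu>(1) \<nu>_chart Z_fin])
  \<comment> \<open>The weight is strictly positive, so both measures have the same null
    sets.\<close>
  have AE_M: "(AE x in ?M. P x) \<longleftrightarrow> (AE x in \<nu>. P x)" for P
  proof -
    have "(\<lambda>m. ennreal (?g m)) \<in> borel_measurable \<nu>" by (rule measurable_compose[OF g measurable_ennreal])
    from AE_density[OF this, of P] show ?thesis by simp
  qed
  have int_M: "integrable ?M f \<longleftrightarrow> integrable \<nu> (\<lambda>x. f x * ?g x)"
    "integral\<^sup>L ?M f = integral\<^sup>L \<nu> (\<lambda>x. f x * ?g x)" if "f \<in> borel_measurable \<nu>" for f :: "'m \<Rightarrow> real"
    unfolding integrable_density[OF that g AE_I2[OF exp_ge_zero]] integral_density[OF that g AE_I2[OF exp_ge_zero]]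
      real_scaleR_def mult.commute[of "exp _"] by (rule refl)+
  have int_dm: "integrable dm (\<lambda>x. f x * ?g x) \<longleftrightarrow> integrable ?M f'"
    "(LINT x|dm. f x * ?g x) = integral\<^sup>L ?M f'" if f': "f' \<in> borel_measurable \<nu>" and ae: "AE x in \<nu>. f x = f' x" for f f' :: "'m \<Rightarrow> real"
  proof -
    have m: "(\<lambda>x. f' x * ?g x) \<in> borel_measurable \<nu>" by (intro borel_measurable_times f' g)
    have ae': "AE x in \<nu>. f x * ?g x = f' x * ?g x" using ae by eventually_elim simp
    show "integrable dm (\<lambda>x. f x * ?g x) \<longleftrightarrow> integrable ?M f'" "(LINT x|dm. f x * ?g x) = integral\<^sup>L ?M f'"
      unfolding int_M[OF f'] \<nu>(2)
      by (rule completion_integrable_cong_AE[OF m ae'], rule completion_integral_cong_AE[OF m ae'])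
  qed
  \<comment> \<open>The ergodic results are applied to this Borel representative of
    \<open>A\<close>.\<close>
  obtain A' where A': "A' \<in> borel_measurable \<nu>" and AA': "AE x in \<nu>. A x = A' x"
    using completion_ex_borel_measurable_real[of A \<nu>] assms(5) unfolding Lp_beta_def \<nu>(2) by blast
  have A2: "integrable ?M (\<lambda>x. (A' x)\<^sup>2)"
  proof -
    have ae: "AE x in \<nu>. \<bar>A x\<bar> powr 2 = (A' x)\<^sup>2" using AA' by eventually_elim (simp add: abs_powr_2)
    have "integrable dm (\<lambda>m. \<bar>A m\<bar> powr 2 * ?g m)" using assms(5) by (simp add: Lp_beta_def)
    then show ?thesis unfolding int_dm(1)[OF borel_measurable_power[OF A'] ae] .
  qed
  have A'M: "A' \<in> borel_measurable ?M" using A' by simp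
  note A1 = square_integrable_integrable[OF A'M A2]
  define L where "L = flow_limit A'"
  have L_meas: "L \<in> borel_measurable \<nu>"
    using flow_limit_measurable[OF A'M A2] by (simp add: L_def)
  have L2: "integrable ?M (\<lambda>x. (L x)\<^sup>2)"
    unfolding L_def by (rule flow_limit_square(1)[OF A'M A2])
  have AM: "AE x in ?M. A x = A' x" using AA' by (simp only: AE_M)
  have orbit_A: "AE m in ?M. AE t in lborel. A (\<gamma> m t) = A' (\<gamma> m t)" by (rule flow_AE_lborel[OF AM])
  have orbit: "AE m in ?M. has_time_average (\<lambda>t. A (\<gamma> m t)) (L m)"
    using orbit_A orbit_integrable_AE[OF A1] window_average_AE_tendsto[OF A'M A2]
  proof eventually_elim
    case (elim m)
    show ?case
    proof (rule has_time_average_cong_AE[OF _ elim(1)])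
      show "set_integrable lborel {0..T} (\<lambda>t. A' (\<gamma> m t))" for T
        by (rule orbit_integrable_upto[where f = A' and x = m]) (use elim(2) in blast)
      show "((\<lambda>T. (LINT t:{0..T}|lborel. A' (\<gamma> m t)) / T) \<longlongrightarrow> L m) at_top"
        using elim(3) unfolding window_average_def L_def .
    qed
  qed
  then have orbit\<nu>: "AE m in \<nu>. has_time_average (\<lambda>t. A (\<gamma> m t)) (L m)" by (simp only: AE_M)
  then have avg: "AE m in \<nu>. orbital_average \<gamma> A m = L m"
    by eventually_elim (simp add: orbital_average_def time_average_eq)
  have 1: "AE m in dm. \<exists>l. has_time_average (\<lambda>t. A (\<gamma> m t)) l"
    unfolding \<nu>(2) by (rule AE_completion) (use orbit\<nu> in eventually_elim, blast)
  have 2: "orbital_average \<gamma> A \<in> Lp_beta dm H \<beta> 2"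
  proof -
    have ae: "AE m in \<nu>. \<bar>orbital_average \<gamma> A m\<bar> powr 2 = (L m)\<^sup>2" using avg by eventually_elim (simp add: abs_powr_2)
    have "integrable dm (\<lambda>m. \<bar>orbital_average \<gamma> A m\<bar> powr 2 * ?g m)"
      unfolding int_dm(1)[OF borel_measurable_power[OF L_meas] ae] by (rule L2)
    moreover have "orbital_average \<gamma> A \<in> borel_measurable dm"
      unfolding \<nu>(2) by (rule completion_measurable_cong_AE[OF L_meas avg])
    ultimately show ?thesis by (simp add: Lp_beta_def)
  qed
  let ?Z = "partition_function dm H \<beta>"
  let ?c = "\<lambda>t. 1 / ?Z * (\<integral>m. A' m * A' (\<gamma> m t) \<partial>?M)"
  have corr: "correlation_at dm H \<beta> \<gamma> A t = ?c t" for t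
  proof -
    have "AE m in ?M. A (\<gamma> m t) = A' (\<gamma> m t)" by (rule flow_AE[OF AM])
    then have "AE m in \<nu>. A (\<gamma> m t) = A' (\<gamma> m t)" by (simp only: AE_M)
    then have ae: "AE m in \<nu>. A (\<gamma> m 0) * A (\<gamma> m t) = A' m * A' (\<gamma> m t)"
      using AA' by eventually_elim (simp add: flow_initial)
    have "(\<lambda>m. A' m * A' (\<gamma> m t)) \<in> borel_measurable ?M"
      by (intro borel_measurable_times A'M measurable_compose[OF flow_at_measurable A'M])
    then have "(\<lambda>m. A' m * A' (\<gamma> m t)) \<in> borel_measurable \<nu>" by simp
    from int_dm(2)[OF this ae] show ?thesis
      by (simp add: correlation_at_def inner_beta_def evolved_def)
  qed
  have 3: "has_time_average (correlation_at dm H \<beta> \<gamma> A) (1 / ?Z * (\<integral>m. (L m)\<^sup>2 \<partial>?M))"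
  proof (rule has_time_average_cong_AE[where g = ?c])
    show "set_integrable lborel {0..T} ?c" for T
      using correlation_integrable[OF A'M A2, of T] by (intro set_integrable_mult_right) 
    have "((\<lambda>T. 1 / ?Z * ((LINT t:{0..T}|lborel. (\<integral>m. A' m * A' (\<gamma> m t) \<partial>?M)) / T)) \<longlongrightarrow> 1 / ?Z * (\<integral>m. (L m)\<^sup>2 \<partial>?M)) at_top"
      unfolding L_def by (intro tendsto_mult tendsto_const correlation_time_average[OF A'M A2])
    then show "((\<lambda>T. (LINT t:{0..T}|lborel. ?c t) / T) \<longlongrightarrow> 1 / ?Z * (\<integral>m. (L m)\<^sup>2 \<partial>?M)) at_top"
      by simp
  qed (simp add: corr)
  have "(norm_beta dm H \<beta> (orbital_average \<gamma> A))\<^sup>2 = 1 / ?Z * (\<integral>m. (L m)\<^sup>2 \<partial>?M)"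
  proof -
    have ae: "AE m in \<nu>. orbital_average \<gamma> A m * orbital_average \<gamma> A m = (L m)\<^sup>2"
      using avg by eventually_elim (simp add: power2_eq_square)
    have "inner_beta dm H \<beta> (orbital_average \<gamma> A) (orbital_average \<gamma> A) = 1 / ?Z * (\<integral>m. (L m)\<^sup>2 \<partial>?M)"
      unfolding inner_beta_def int_dm(2)[OF borel_measurable_power[OF L_meas] ae] ..
    \<comment> \<open>Makes the inner product nonnegative, so that squaring undoes the square root
      in \<open>norm_beta\<close>.\<close>
    moreover have "?Z \<ge> 0" unfolding partition_function_def by (intro Bochner_Integration.integral_nonneg) simp
    ultimately show ?thesis by (simp add: norm_beta_def)
  qed
  then show ?thesis
    using 1 2 3 time_average_eq[OF 3] by (auto simp: autocorrelation_def)
qed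

end
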